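(* Let $\mathcal{L}$ be a Lévy operator and $e^{-t\mathcal{L}}$ its (symmetric Markov) semigroup. Consider the logarithmic Sobolev inequality $$\mathrm{Ent}(f^2)\le2\beta(\varepsilon)\|f\|_2^2+2\varepsilon\,\overline{\mathcal{E}}(f)\qquad(\ast)$$ for $f\in L^1(\mathbb{R}^N)\cap H_{\mathcal{L}}(\mathbb{R}^N)$. 1. Let $q>2$. If $\mathcal{L}$ is supercontractive, i.e. $\|u(t)\|_q\le B(t,q)\|u_0\|_2$ for every $2\le q<\infty$ and $t>0$, then $(\ast)$ holds for any $\varepsilon>0$ and any $f\in L^1(\mathbb{R}^N)\cap H_{\mathcal{L}}(\mathbb{R}^N)$ with $$\beta(\varepsilon)=(1-2/q)^{-1}\log\Big(B\big(\varepsilon(1-2/q),q\big)\Big).$$ 2. If $\mathcal{L}$ is ultracontractive, i.e. it is supercontractive and $B(t):=\sup_qB(t,q)<\infty$ for all $t>0$ (so that $\|u(t)\|_\infty\le B(t)\|u_0\|_2$ for $t>0$), then $(\ast)$ holds for any $\varepsilon>0$ and any such $f$ with $\beta(\varepsilon)=\log B(\varepsilon)$. On the other hand: 3. If $\mathcal{L}$ satisfies $(\ast)$ for all $\varepsilon>0$, with $\beta:(0,\infty)\to\mathbb{R}$ any continuous function, then $\mathcal{L}$ is supercontractive. 4. If, in addition, $$M(t)=\frac1t\int_0^t\beta(s)\,ds<\infty\qquad\text{for any }t>0,$$ then $\mathcal{L}$ is ultracontractive.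
   Context: $L^p=L^p(\mathbb{R}^N)$ with Lebesgue measure and norm $\|\cdot\|_p$. A Lévy operator is $\mathcal{L}f(x)=\mathrm{P.V.}\int_{\mathbb{R}^N}(f(x)-f(y))J(x,y)\,dy$ with $J\ge0$ measurable, $J(x,y)=J(y,x)$ and $\sup_x\int J(x,y)\min\{1,|x-y|^2\}\,dy<\infty$. Set $\mathcal{E}(f,g)=\frac12\iint (f(x)-f(y))(g(x)-g(y))J(x,y)\,dx\,dy$, $\overline{\mathcal{E}}(f)=\mathcal{E}(f,f)$, and $H_{\mathcal{L}}(\mathbb{R}^N)=\{f\in L^2:\overline{\mathcal{E}}(f)<\infty\}$; $\mathcal{L}$ is understood as the self-adjoint operator on $L^2$ given by $\langle\mathcal{L}f,g\rangle=\mathcal{E}(f,g)$. For $u_0\in L^2$, the solution of $\partial_tu+\mathcal{L}u=0$, $u(0)=u_0$, is the unique $u\in C([0,\infty);L^2)\cap C^1((0,\infty);L^2)\cap C((0,\infty);H_{\mathcal{L}})$ satisfying $\frac{du}{dt}+\mathcal{L}u=0$ in $(0,\infty)$ and $u(0)=u_0$; write $e^{-t\mathcal{L}}u_0=u(t)$. This semigroup is a symmetric Markov semigroup: self-adjoint on $L^2$, positivity preserving and contractive in $L^\infty$ (and in every $L^p$-norm). Entropy: $\mathrm{Ent}(f)=\int_{\mathbb{R}^N}\Phi(|f|)-\Phi\left(\int_{\mathbb{R}^N}|f|\right)$ with $\Phi(s)=s\log s$ ($\Phi(0)=0$). Supercontractive: there is a finite function $B(t,q)\ge0$ with $\|u(t)\|_q\le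 B(t,q)\|u_0\|_2$ for every $2\le q<\infty$, $t>0$ and $u_0\in L^2$. Ultracontractive: supercontractive with $B(t)=\sup_qB(t,q)<\infty$ for all $t>0$. *)

theory Defs
  imports "HOL-Analysis.Analysis"
begin

text \<open>Elements of \<open>L\<^sup>p\<close> are represented by Borel functions; every class modulo
  null sets has such a representative. Equality of elements is equality almost everywhere.\<close>

definition Lp_space :: "real \<Rightarrow> ((real^'n) \<Rightarrow> real) set" where
  "Lp_space p =
     {f \<in> borel_measurable lborel. integrable lborel (\<lambda>x. \<bar>f x\<bar> powr p)}"

definition Lp_norm :: "real \<Rightarrow> ((real^'n) \<Rightarrow> real) \<Rightarrow> real" where
  "Lp_norm p f = (\<integral>x. \<bar>f x\<bar> powr p \<partial>lborel) powr (1 / p)"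

definition L2_inner :: "((real^'n) \<Rightarrow> real) \<Rightarrow> ((real^'n) \<Rightarrow> real) \<Rightarrow> real" where
  "L2_inner f g = (\<integral>x. f x * g x \<partial>lborel)"

text \<open>Integral with values in the extended reals. It agrees with the Lebesgue integral on
  integrable functions and, unlike the Bochner integral, is \<open>\<infinity>\<close> or \<open>-\<infinity>\<close> when
  exactly one of the two parts diverges. Since \<open>\<infinity> - \<infinity> = \<infinity>\<close> for \<open>ereal\<close>,
  its value is below \<open>\<infinity>\<close> only if the positive part is integrable.\<close>

definition ext_integral :: "'b measure \<Rightarrow> ('b \<Rightarrow> real) \<Rightarrow> ereal" where
  "ext_integral M f =
     enn2ereal (\<integral>\<^sup>+ x. ennreal (max 0 (f x)) \<partial>M)
       - enn2ereal (\<integral>\<^sup>+ x. ennreal (max 0 (- f x)) \<partial>M)"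

definition levy_kernel :: "(real^'n \<Rightarrow> real^'n \<Rightarrow> real) \<Rightarrow> bool" where
  "levy_kernel J \<longleftrightarrow>
     (\<lambda>(x, y). J x y) \<in> borel_measurable (lborel \<Otimes>\<^sub>M lborel) \<and>
     (\<forall>x y. 0 \<le> J x y) \<and>
     (\<forall>x y. J x y = J y x) \<and>
     (SUP x. \<integral>\<^sup>+ y. ennreal (J x y * min 1 ((dist x y)\<^sup>2)) \<partial>lborel) < \<infinity>"

definition levy_form ::
  "(real^'n \<Rightarrow> real^'n \<Rightarrow> real) \<Rightarrow> (real^'n \<Rightarrow> real) \<Rightarrow> (real^'n \<Rightarrow> real) \<Rightarrow> real" where
  "levy_form J f g =
     1 / 2 * (\<integral>(x, y). (f x - f y) * (g x - g y) * J x y \<partial>(lborel \<Otimes>\<^sub>M lborel))"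

text \<open>The diagonal \<open>\<E>(f, f)\<close> of the form, as a possibly infinite quantity.\<close>

definition levy_energy ::
  "(real^'n \<Rightarrow> real^'n \<Rightarrow> real) \<Rightarrow> (real^'n \<Rightarrow> real) \<Rightarrow> ennreal" where
  "levy_energy J f =
     (\<integral>\<^sup>+ (x, y). ennreal ((f x - f y)\<^sup>2 * J x y) \<partial>(lborel \<Otimes>\<^sub>M lborel)) / 2"

definition levy_space :: "(real^'n \<Rightarrow> real^'n \<Rightarrow> real) \<Rightarrow> (real^'n \<Rightarrow> real) set" where
  "levy_space J = {f \<in> Lp_space 2. levy_energy J f < \<infinity>}"

text \<open>The graph of the self-adjoint operator of the form: \<open>f\<close> is in its domain and
  \<open>h\<close> represents its value at \<open>f\<close>.\<close>

definition levy_operator ::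
  "(real^'n \<Rightarrow> real^'n \<Rightarrow> real) \<Rightarrow> (real^'n \<Rightarrow> real) \<Rightarrow> (real^'n \<Rightarrow> real) \<Rightarrow> bool" where
  "levy_operator J f h \<longleftrightarrow>
     f \<in> levy_space J \<and> h \<in> Lp_space 2 \<and>
     (\<forall>g \<in> levy_space J. L2_inner h g = levy_form J f g)"

definition L2_continuous_on :: "real set \<Rightarrow> (real \<Rightarrow> (real^'n) \<Rightarrow> real) \<Rightarrow> bool" where
  "L2_continuous_on T u \<longleftrightarrow>
     (\<forall>t\<in>T. u t \<in> Lp_space 2) \<and>
     (\<forall>t\<in>T. ((\<lambda>s. Lp_norm 2 (\<lambda>x. u s x - u t x)) \<longlongrightarrow> 0) (at t within T))"

definition L2_has_derivative_on ::
  "real set \<Rightarrow> (real \<Rightarrow> (real^'n) \<Rightarrow> real) \<Rightarrow> (real \<Rightarrow> (real^'n) \<Rightarrow> real) \<Rightarrow> bool" where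
  "L2_has_derivative_on T u v \<longleftrightarrow>
     (\<forall>t\<in>T. u t \<in> Lp_space 2 \<and> v t \<in> Lp_space 2) \<and>
     (\<forall>t\<in>T. ((\<lambda>s. Lp_norm 2 (\<lambda>x. (u s x - u t x) / (s - t) - v t x)) \<longlongrightarrow> 0)
               (at t within T))"

text \<open>Continuity for the norm \<open>\<parallel>f\<parallel>\<^sup>2 = \<parallel>f\<parallel>\<^sub>2\<^sup>2 + \<E>(f, f)\<close> of the form domain.\<close>

definition levy_space_continuous_on ::
  "(real^'n \<Rightarrow> real^'n \<Rightarrow> real) \<Rightarrow> real set \<Rightarrow> (real \<Rightarrow> (real^'n) \<Rightarrow> real) \<Rightarrow> bool" where
  "levy_space_continuous_on J T u \<longleftrightarrow>
     (\<forall>t\<in>T. u t \<in> levy_space J) \<and> L2_continuous_on T u \<and>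
     (\<forall>t\<in>T. ((\<lambda>s. levy_energy J (\<lambda>x. u s x - u t x)) \<longlongrightarrow> 0) (at t within T))"

definition levy_solution ::
  "(real^'n \<Rightarrow> real^'n \<Rightarrow> real) \<Rightarrow> (real^'n \<Rightarrow> real) \<Rightarrow> (real \<Rightarrow> (real^'n) \<Rightarrow> real) \<Rightarrow> bool"
  where
  "levy_solution J u0 u \<longleftrightarrow>
     L2_continuous_on {0..} u \<and>
     levy_space_continuous_on J {0<..} u \<and>
     (AE x in lborel. u 0 x = u0 x) \<and>
     (\<exists>v. L2_has_derivative_on {0<..} u v \<and> L2_continuous_on {0<..} v \<and>
          (\<forall>t>0. levy_operator J (u t) (\<lambda>x. - v t x)))"

text \<open>\<open>S t u0\<close> is the value at time \<open>t\<close> of the solution with initial value \<open>u0\<close>. Since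
  solutions are unique up to null sets, this determines \<open>S\<close> from the kernel.\<close>

definition levy_semigroup ::
  "(real^'n \<Rightarrow> real^'n \<Rightarrow> real) \<Rightarrow> (real \<Rightarrow> (real^'n \<Rightarrow> real) \<Rightarrow> (real^'n \<Rightarrow> real)) \<Rightarrow> bool"
  where
  "levy_semigroup J S \<longleftrightarrow> (\<forall>u0 \<in> Lp_space 2. levy_solution J u0 (\<lambda>t. S t u0))"

definition Phi :: "real \<Rightarrow> real" where
  "Phi s = s * ln s"

text \<open>Meaningful for integrable \<open>f\<close>: otherwise the second integral is the default value 0.\<close>

definition Ent :: "((real^'n) \<Rightarrow> real) \<Rightarrow> ereal" where
  "Ent f = ext_integral lborel (\<lambda>x. Phi \<bar>f x\<bar>) - ereal (Phi (\<integral>x. \<bar>f x\<bar> \<partial>lborel))"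

text \<open>The logarithmic Sobolev inequality at the parameter \<open>\<epsilon>\<close>, where \<open>b\<close> is the
  value \<open>\<beta> \<epsilon>\<close>.\<close>

definition log_sobolev :: "(real^'n \<Rightarrow> real^'n \<Rightarrow> real) \<Rightarrow> real \<Rightarrow> real \<Rightarrow> bool" where
  "log_sobolev J b \<epsilon> \<longleftrightarrow>
     (\<forall>f \<in> Lp_space 1 \<inter> levy_space J.
        Ent (\<lambda>x. (f x)\<^sup>2) \<le>
          ereal (2 * b * (Lp_norm 2 f)\<^sup>2) + ereal (2 * \<epsilon>) * enn2ereal (levy_energy J f))"

definition supercontractive_with ::
  "(real \<Rightarrow> (real^'n \<Rightarrow> real) \<Rightarrow> (real^'n \<Rightarrow> real)) \<Rightarrow> (real \<Rightarrow> real \<Rightarrow> real) \<Rightarrow> bool" where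
  "supercontractive_with S B \<longleftrightarrow>
     (\<forall>t>0. \<forall>q\<ge>2. 0 \<le> B t q \<and>
        (\<forall>u0 \<in> Lp_space 2.
           S t u0 \<in> Lp_space q \<and> Lp_norm q (S t u0) \<le> B t q * Lp_norm 2 u0))"

definition supercontractive ::
  "(real \<Rightarrow> (real^'n \<Rightarrow> real) \<Rightarrow> (real^'n \<Rightarrow> real)) \<Rightarrow> bool" where
  "supercontractive S \<longleftrightarrow> (\<exists>B. supercontractive_with S B)"

definition ultracontractive_with ::
  "(real \<Rightarrow> (real^'n \<Rightarrow> real) \<Rightarrow> (real^'n \<Rightarrow> real)) \<Rightarrow> (real \<Rightarrow> real \<Rightarrow> real) \<Rightarrow> bool" where
  "ultracontractive_with S B \<longleftrightarrow>
     supercontractive_with S B \<and> (\<forall>t>0. bdd_above (B t ` {2..}))"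

definition ultracontractive ::
  "(real \<Rightarrow> (real^'n \<Rightarrow> real) \<Rightarrow> (real^'n \<Rightarrow> real)) \<Rightarrow> bool" where
  "ultracontractive S \<longleftrightarrow> (\<exists>B. ultracontractive_with S B)"

definition beta_mean :: "(real \<Rightarrow> real) \<Rightarrow> real \<Rightarrow> ereal" where
  "beta_mean \<beta> t =
     ereal (1 / t) * ext_integral lborel (\<lambda>s. indicator {0<..<t} s * \<beta> s)"

end

theory Submission
  imports Defs
begin

text \<open>Uniqueness for the evolution equation makes \<open>S\<close> a linear, symmetric,
  positivity-preserving semigroup that contracts \<open>L\<^sup>1\<close> and every \<open>L\<^sup>p\<close>, \<open>p \<ge> 2\<close>: for a convex
  function \<open>h\<close> with Lipschitz derivative \<open>k\<close>, \<open>\<integral> h (u t)\<close> has the derivative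
  \<open>- \<E>(u t, k (u t)) \<le> 0\<close>.

  Smoothing implies the logarithmic Sobolev inequality by interpolation. With \<open>c = 1 - 2 / q\<close>
  (\<open>c = 1\<close> for \<open>q = \<infinity>\<close>), duality turns the hypothesis into
  \<open>\<parallel>S t (f powr (1 + c))\<parallel>\<^sub>2 \<le> B \<parallel>f\<parallel>\<^sub>2 powr (1 + c)\<close> for \<open>f \<ge> 0\<close>. Positivity and the identity
  \<open>\<parallel>S (t / 2) g\<parallel>\<^sub>2\<^sup>2 = \<langle>S t g, g\<rangle>\<close> allow one to halve \<open>t\<close> and \<open>c\<close> and to replace \<open>B\<close> by its
  square root. Along \<open>s = 2\<^bsup>-n\<^esup>\<close> this gives
  \<open>\<langle>S (s t) f, f powr (1 + s c)\<rangle> \<le> B powr s * \<parallel>f\<parallel>\<^sub>2 powr (2 + s c)\<close>, whose derivative at \<open>s = 0\<close> is the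
  logarithmic Sobolev inequality with \<open>t = \<epsilon> c\<close>.

  Conversely, by Gross's argument, \<open>\<parallel>u r\<parallel>\<close> in \<open>L\<^sup>p\<close> with the moving exponent
  \<open>p = 2 t / (t - r)\<close> grows at most at the logarithmic rate \<open>\<beta> (t - r) / t\<close>, hence
  \<open>\<parallel>u t\<parallel>\<^sub>q \<le> exp (1 / t \<integral>\<^bsub>2 t / q\<^esub>\<^bsup>t\<^esup> \<beta>) \<parallel>u 0\<parallel>\<^sub>2\<close>. The bound is uniform in \<open>q\<close> as soon as the mean of
  \<open>\<beta>\<close> over \<open>(0, t)\<close> is below \<open>\<infinity>\<close>.\<close>


section \<open>The spaces \<open>L\<^sup>p\<close> and convergence in \<open>L\<^sup>2\<close>\<close>

text \<open>Solutions are differentiable only in the sense of \<open>L\<^sup>2\<close> and only at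
  positive times, so both derivatives in the outline are replaced by one-sided estimates. At s = 0,
  a function f of finite energy satisfies <S h f, f> >= ||f||^2 - h E(f, f), and exp y >= 1 + y
  bounds f^(1+sc) from below by f + sc f ln f. The dyadic inequality bounds the same pairing from
  above, so comparing first-order terms suffices. For the moving exponent, the integral of w^p is
  estimated from the left by convexity, and a monotonicity lemma for left difference quotients
  integrates the resulting rate. Powers and logarithms are harmless only for bounded nonnegative
  functions. The general case is reached by truncation, under which the energy does not grow.
  Integrability of f controls the negative part of f^2 ln(f^2); the integral of its positive part
  might a priori be infinite and is shown to be finite. The logarithms of norms along the flow make
  sense because the semigroup is injective.\<close>

lemma Lp_space_2_iff:
  "f \<in> Lp_space 2 \<longleftrightarrow> f \<in> borel_measurable lborel \<and> integrable lborel (\<lambda>x. (f x)\<^sup>2)"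
  by (simp add: Lp_space_def)

lemma Lp_norm_2: "Lp_norm 2 f = sqrt (\<integral>x. (f x)\<^sup>2 \<partial>lborel)"
  by (simp add: Lp_norm_def powr_half_sqrt)

lemma Lp_norm_2_sq: "(Lp_norm 2 f)\<^sup>2 = L2_inner f f"
  by (simp add: Lp_norm_2 L2_inner_def power2_eq_square[symmetric])

lemma Lp_norm_nonneg [simp]: "0 \<le> Lp_norm p f"
  by (simp add: Lp_norm_def)

lemma L2_inner_self_nonneg: "0 \<le> L2_inner f f"
  by (simp add: L2_inner_def)

lemma L2_inner_commute: "L2_inner f g = L2_inner g f"
  by (simp add: L2_inner_def mult.commute)

lemma Lp_norm_powr:
  assumes "0 < p"
  shows "Lp_norm p f powr p = (\<integral>x. \<bar>f x\<bar> powr p \<partial>lborel)"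
  using assms by (simp add: Lp_norm_def powr_powr)

lemma Lp_norm_zero_AE:
  assumes "f \<in> Lp_space p" "0 < p" "Lp_norm p f = 0"
  shows "AE x in lborel. f x = 0"
proof -
  have "(\<integral>x. \<bar>f x\<bar> powr p \<partial>lborel) = 0" using Lp_norm_powr[OF assms(2), of f] assms(3) by simp
  then have "AE x in lborel. \<bar>f x\<bar> powr p = 0"
    using assms(1) by (subst (asm) integral_nonneg_eq_0_iff_AE) (auto simp: Lp_space_def)
  then show ?thesis by simp
qed

lemma Holder_inequality:
  assumes pq: "1 < p" "1 < q" "1 / p + 1 / q = 1" and f: "f \<in> Lp_space p" and g: "g \<in> Lp_space q"
  shows "integrable lborel (\<lambda>x. f x * g x)"
    and "(\<integral>x. \<bar>f x * g x\<bar> \<partial>lborel) \<le> Lp_norm p f * Lp_norm q g"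
proof -
  have [measurable]: "f \<in> borel_measurable borel" "g \<in> borel_measurable borel"
    and fi: "integrable lborel (\<lambda>x. \<bar>f x\<bar> powr p)" and gi: "integrable lborel (\<lambda>x. \<bar>g x\<bar> powr q)"
    using f g by (auto simp: Lp_space_def)
  have young: "\<bar>a * b\<bar> \<le> \<bar>a\<bar> powr p / p + \<bar>b\<bar> powr q / q" for a b
    using Youngs_inequality[OF pq, of "\<bar>a\<bar>" "\<bar>b\<bar>"] by (simp add: abs_mult)
  show int: "integrable lborel (\<lambda>x. f x * g x)"
  proof (rule Bochner_Integration.integrable_bound)
    show "integrable lborel (\<lambda>x. \<bar>f x\<bar> powr p / p + \<bar>g x\<bar> powr q / q)"
      using fi gi by auto
    show "AE x in lborel. norm (f x * g x) \<le> norm (\<bar>f x\<bar> powr p / p + \<bar>g x\<bar> powr q / q)"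
      using young by (intro AE_I2) (auto intro: order_trans[OF _ abs_ge_self])
  qed measurable
  define A where "A = Lp_norm p f"
  define B where "B = Lp_norm q g"
  show "(\<integral>x. \<bar>f x * g x\<bar> \<partial>lborel) \<le> Lp_norm p f * Lp_norm q g"
  proof (cases "A = 0 \<or> B = 0")
    case True
    then have "AE x in lborel. \<bar>f x * g x\<bar> = 0"
      using Lp_norm_zero_AE[OF f] Lp_norm_zero_AE[OF g] pq
      by (auto simp: A_def B_def elim: eventually_mono)
    then have "(\<integral>x. \<bar>f x * g x\<bar> \<partial>lborel) = 0" by (rule integral_eq_zero_AE)
    then show ?thesis by simp
  next
    case False
    then have AB: "0 < A" "0 < B" by (auto simp: A_def B_def less_le)
    have "(\<integral>x. \<bar>f x * g x\<bar> / (A * B) \<partial>lborel)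
        \<le> (\<integral>x. \<bar>f x\<bar> powr p / (A powr p * p) + \<bar>g x\<bar> powr q / (B powr q * q) \<partial>lborel)"
    proof (rule integral_mono)
      show "\<bar>f x * g x\<bar> / (A * B) \<le> \<bar>f x\<bar> powr p / (A powr p * p) + \<bar>g x\<bar> powr q / (B powr q * q)" for x
        using young[of "f x / A" "g x / B"] AB by (simp add: powr_divide abs_mult)
    qed (use fi gi int in auto)
    also have "\<dots> = A powr p / (A powr p * p) + B powr q / (B powr q * q)"
      using fi gi Lp_norm_powr[of p f] Lp_norm_powr[of q g] pq by (simp add: A_def B_def)
    also have "\<dots> = 1" using AB pq by simp
    finally show ?thesis using AB by (simp add: A_def B_def)
  qed
qed

lemma L2_integrable_mult:
  "f \<in> Lp_space 2 \<Longrightarrow> g \<in> Lp_space 2 \<Longrightarrow> integrable lborel (\<lambda>x. f x * g x)"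
  by (rule Holder_inequality(1)[of 2 2]) auto

lemma L2_Cauchy_Schwarz:
  assumes "f \<in> Lp_space 2" "g \<in> Lp_space 2"
  shows "\<bar>L2_inner f g\<bar> \<le> Lp_norm 2 f * Lp_norm 2 g"
proof -
  have "\<bar>L2_inner f g\<bar> \<le> (\<integral>x. \<bar>f x * g x\<bar> \<partial>lborel)"
    unfolding L2_inner_def by (rule integral_abs_bound)
  also have "\<dots> \<le> Lp_norm 2 f * Lp_norm 2 g"
    by (rule Holder_inequality(2)) (use assms in auto)
  finally show ?thesis .
qed

lemma L2_dominated:
  assumes "f \<in> Lp_space 2" "g \<in> borel_measurable lborel" "AE x in lborel. \<bar>g x\<bar> \<le> K * \<bar>f x\<bar>"
  shows "g \<in> Lp_space 2"
  unfolding Lp_space_2_iff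
proof
  show "integrable lborel (\<lambda>x. (g x)\<^sup>2)"
  proof (rule Bochner_Integration.integrable_bound)
    show "integrable lborel (\<lambda>x. K\<^sup>2 * (f x)\<^sup>2)"
      using assms by (simp add: Lp_space_2_iff)
    show "(\<lambda>x. (g x)\<^sup>2) \<in> borel_measurable lborel" using assms by auto
    show "AE x in lborel. norm ((g x)\<^sup>2) \<le> norm (K\<^sup>2 * (f x)\<^sup>2)"
      using assms(3)
    proof eventually_elim
      case (elim x)
      then have "(\<bar>g x\<bar>)\<^sup>2 \<le> (K * \<bar>f x\<bar>)\<^sup>2" by (intro power_mono) auto
      then show ?case by (simp add: power_mult_distrib)
    qed
  qed
qed fact

lemma L2_cong_AE:
  assumes "f \<in> Lp_space 2" "g \<in> borel_measurable lborel" "AE x in lborel. g x = f x"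
  shows "g \<in> Lp_space 2"
  using assms(3) by (intro L2_dominated[OF assms(1,2), of 1]) auto

lemma L2_scale: "f \<in> Lp_space 2 \<Longrightarrow> (\<lambda>x. c * f x) \<in> Lp_space 2"
  by (auto simp: Lp_space_2_iff power_mult_distrib)

lemma L2_divide: "f \<in> Lp_space 2 \<Longrightarrow> (\<lambda>x. f x / c) \<in> Lp_space 2"
  using L2_scale[of f "1/c"] by simp

lemma L2_minus: "f \<in> Lp_space 2 \<Longrightarrow> (\<lambda>x. - f x) \<in> Lp_space 2"
  using L2_scale[of f "-1"] by simp

lemma L2_abs: "f \<in> Lp_space 2 \<Longrightarrow> (\<lambda>x. \<bar>f x\<bar>) \<in> Lp_space 2"
  by (auto simp: Lp_space_2_iff)

lemma L2_add:
  assumes "f \<in> Lp_space 2" "g \<in> Lp_space 2"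
  shows "(\<lambda>x. f x + g x) \<in> Lp_space 2"
  using assms L2_integrable_mult[OF assms] by (auto simp: Lp_space_2_iff power2_sum mult.assoc)

lemma L2_diff: "f \<in> Lp_space 2 \<Longrightarrow> g \<in> Lp_space 2 \<Longrightarrow> (\<lambda>x. f x - g x) \<in> Lp_space 2"
  using L2_add[of f "\<lambda>x. - g x"] L2_minus[of g] by simp

lemma L2_inner_add_left:
  "\<lbrakk>f \<in> Lp_space 2; g \<in> Lp_space 2; w \<in> Lp_space 2\<rbrakk> \<Longrightarrow>
    L2_inner (\<lambda>x. f x + g x) w = L2_inner f w + L2_inner g w"
  by (simp add: L2_inner_def distrib_right L2_integrable_mult)

lemma L2_inner_diff_left:
  "\<lbrakk>f \<in> Lp_space 2; g \<in> Lp_space 2; w \<in> Lp_space 2\<rbrakk> \<Longrightarrow>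
    L2_inner (\<lambda>x. f x - g x) w = L2_inner f w - L2_inner g w"
  by (simp add: L2_inner_def left_diff_distrib L2_integrable_mult)

lemma L2_inner_scale_left: "L2_inner (\<lambda>x. c * f x) w = c * L2_inner f w"
  by (simp add: L2_inner_def mult.assoc)

lemma L2_inner_divide_left: "L2_inner (\<lambda>x. f x / c) w = L2_inner f w / c"
  by (simp add: L2_inner_def)

lemma L2_inner_minus_left: "L2_inner (\<lambda>x. - f x) w = - L2_inner f w"
  by (simp add: L2_inner_def)

lemma L2_inner_diff_right:
  "\<lbrakk>f \<in> Lp_space 2; g \<in> Lp_space 2; w \<in> Lp_space 2\<rbrakk> \<Longrightarrow>
    L2_inner w (\<lambda>x. f x - g x) = L2_inner w f - L2_inner w g"
  by (simp add: L2_inner_def right_diff_distrib L2_integrable_mult)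

lemma L2_inner_add_right:
  "\<lbrakk>f \<in> Lp_space 2; g \<in> Lp_space 2; w \<in> Lp_space 2\<rbrakk> \<Longrightarrow>
    L2_inner w (\<lambda>x. f x + g x) = L2_inner w f + L2_inner w g"
  by (simp add: L2_inner_def distrib_left L2_integrable_mult)

lemma L2_inner_scale_right: "L2_inner w (\<lambda>x. c * f x) = c * L2_inner w f"
  by (simp add: L2_inner_def mult.assoc mult.left_commute)

lemma L2_inner_divide_right: "L2_inner w (\<lambda>x. f x / c) = L2_inner w f / c"
  by (simp add: L2_inner_def)

lemma L2_inner_cong_AE:
  assumes "AE x in lborel. f x = f' x" "AE x in lborel. g x = g' x"
    and "f \<in> borel_measurable lborel" "f' \<in> borel_measurable lborel"
    and "g \<in> borel_measurable lborel" "g' \<in> borel_measurable lborel"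
  shows "L2_inner f g = L2_inner f' g'"
  unfolding L2_inner_def
  using assms(1,2) by (intro integral_cong_AE) (use assms in auto)

lemma Lp_norm_cong_AE:
  assumes "AE x in lborel. f x = g x"
    and "f \<in> borel_measurable lborel" "g \<in> borel_measurable lborel"
  shows "Lp_norm p f = Lp_norm p g"
proof -
  have "(\<integral>x. \<bar>f x\<bar> powr p \<partial>lborel) = (\<integral>x. \<bar>g x\<bar> powr p \<partial>lborel)"
    using assms(1) by (intro integral_cong_AE) (use assms in auto)
  then show ?thesis by (simp add: Lp_norm_def)
qed

lemma L2_borel: "f \<in> Lp_space 2 \<Longrightarrow> f \<in> borel_measurable lborel"
  by (simp add: Lp_space_2_iff)

lemma L2_norm_zero_AE:
  assumes "f \<in> Lp_space 2" "L2_inner f f \<le> 0"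
  shows "AE x in lborel. f x = 0"
proof -
  have "(\<integral>x. (f x)\<^sup>2 \<partial>lborel) = 0"
    using assms(2) by (intro antisym) (auto simp: L2_inner_def power2_eq_square)
  then have "AE x in lborel. (f x)\<^sup>2 = 0"
    using assms(1) by (subst (asm) integral_nonneg_eq_0_iff_AE) (auto simp: Lp_space_2_iff)
  then show ?thesis by simp
qed

text \<open>Membership in \<open>Lp_space 2\<close> is part of the notion because the Bochner
  integral of a non-integrable square defaults to 0, so that smallness of \<open>Lp_norm 2\<close>
  alone would say nothing. An arbitrary filter covers one-sided limits, sequences and time reversal
  alike.\<close>

definition L2_tendsto ::
  "('a \<Rightarrow> (real^'n) \<Rightarrow> real) \<Rightarrow> ((real^'n) \<Rightarrow> real) \<Rightarrow> 'a filter \<Rightarrow> bool" where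
  "L2_tendsto u f F \<longleftrightarrow> (\<forall>\<^sub>F s in F. u s \<in> Lp_space 2) \<and> f \<in> Lp_space 2 \<and>
     ((\<lambda>s. Lp_norm 2 (\<lambda>x. u s x - f x)) \<longlongrightarrow> 0) F"

lemma L2_tendsto_const: "f \<in> Lp_space 2 \<Longrightarrow> L2_tendsto (\<lambda>s. f) f F"
  by (simp add: L2_tendsto_def Lp_norm_2)

lemma L2_tendsto_inner:
  assumes u: "L2_tendsto u f F" and w: "L2_tendsto w g F"
  shows "((\<lambda>s. L2_inner (u s) (w s)) \<longlongrightarrow> L2_inner f g) F"
proof -
  let ?d = "\<lambda>s. Lp_norm 2 (\<lambda>x. u s x - f x)" and ?e = "\<lambda>s. Lp_norm 2 (\<lambda>x. w s x - g x)"
  have f: "f \<in> Lp_space 2" and g: "g \<in> Lp_space 2" using u w by (auto simp: L2_tendsto_def)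
  have "((\<lambda>s. ?d s * ?e s + ?d s * Lp_norm 2 g + Lp_norm 2 f * ?e s) \<longlongrightarrow>
      0 * 0 + 0 * Lp_norm 2 g + Lp_norm 2 f * 0) F"
    using u w unfolding L2_tendsto_def by (intro tendsto_intros) auto
  then have lim: "((\<lambda>s. ?d s * ?e s + ?d s * Lp_norm 2 g + Lp_norm 2 f * ?e s) \<longlongrightarrow> 0) F" by simp
  have "((\<lambda>s. L2_inner (u s) (w s) - L2_inner f g) \<longlongrightarrow> 0) F"
  proof (rule Lim_null_comparison[OF _ lim])
    have "\<forall>\<^sub>F s in F. u s \<in> Lp_space 2 \<and> w s \<in> Lp_space 2"
      using u w by (auto simp: L2_tendsto_def eventually_conj_iff)
    then show "\<forall>\<^sub>F s in F. norm (L2_inner (u s) (w s) - L2_inner f g)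
        \<le> ?d s * ?e s + ?d s * Lp_norm 2 g + Lp_norm 2 f * ?e s"
    proof eventually_elim
      case (elim s)
      then have us: "u s \<in> Lp_space 2" and ws: "w s \<in> Lp_space 2" by auto
      have "L2_inner (u s) (w s) - L2_inner f g =
          L2_inner (\<lambda>x. u s x - f x) (\<lambda>x. w s x - g x) + L2_inner (\<lambda>x. u s x - f x) g
          + L2_inner f (\<lambda>x. w s x - g x)"
        using us ws f g by (simp add: L2_inner_diff_left L2_inner_diff_right L2_diff)
      moreover have "\<bar>L2_inner (\<lambda>x. u s x - f x) (\<lambda>x. w s x - g x)\<bar> \<le> ?d s * ?e s"
        "\<bar>L2_inner (\<lambda>x. u s x - f x) g\<bar> \<le> ?d s * Lp_norm 2 g"
        "\<bar>L2_inner f (\<lambda>x. w s x - g x)\<bar> \<le> Lp_norm 2 f * ?e s"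
        using us ws f g by (intro L2_Cauchy_Schwarz L2_diff; simp)+
      ultimately show ?case by simp
    qed
  qed
  then show ?thesis by (simp add: LIM_zero_iff)
qed

text \<open>The product rule: the increment is split so that the quotient of \<open>u\<close> meets
  \<open>w s\<close> and the quotient of \<open>w\<close> meets the fixed \<open>u t\<close>. Both
  limits are then limits of inner products.\<close>

lemma L2_has_derivative_inner:
  assumes u: "L2_tendsto u (u t) (at t within T)" and w: "L2_tendsto w (w t) (at t within T)"
    and u': "L2_tendsto (\<lambda>s x. (u s x - u t x) / (s - t)) v (at t within T)"
    and w': "L2_tendsto (\<lambda>s x. (w s x - w t x) / (s - t)) z (at t within T)"
  shows "((\<lambda>s. L2_inner (u s) (w s)) has_real_derivative (L2_inner v (w t) + L2_inner (u t) z))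
           (at t within T)"
  unfolding has_field_derivative_iff
proof (rule Lim_transform_eventually)
  have ut: "u t \<in> Lp_space 2" and wt: "w t \<in> Lp_space 2" using u w by (auto simp: L2_tendsto_def)
  show "((\<lambda>s. L2_inner (\<lambda>x. (u s x - u t x) / (s - t)) (w s) +
            L2_inner (u t) (\<lambda>x. (w s x - w t x) / (s - t)))
        \<longlongrightarrow> L2_inner v (w t) + L2_inner (u t) z) (at t within T)"
    by (intro tendsto_add L2_tendsto_inner L2_tendsto_const u' w' w ut)
  have "\<forall>\<^sub>F s in at t within T. u s \<in> Lp_space 2 \<and> w s \<in> Lp_space 2"
    using u w by (auto simp: L2_tendsto_def eventually_conj_iff)
  then show "\<forall>\<^sub>F s in at t within T. L2_inner (\<lambda>x. (u s x - u t x) / (s - t)) (w s) +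
            L2_inner (u t) (\<lambda>x. (w s x - w t x) / (s - t)) =
      (L2_inner (u s) (w s) - L2_inner (u t) (w t)) / (s - t)"
  proof eventually_elim
    case (elim s)
    then show ?case using ut wt
      by (simp add: L2_inner_divide_left L2_inner_divide_right L2_inner_diff_left
          L2_inner_diff_right diff_divide_distrib L2_divide)
  qed
qed

section \<open>The form of a Levy kernel\<close>

locale levy =
  fixes J :: "real^'n \<Rightarrow> real^'n \<Rightarrow> real"
  assumes kernel: "levy_kernel J"
begin

lemma J_measurable [measurable]: "(\<lambda>(x, y). J x y) \<in> borel_measurable (lborel \<Otimes>\<^sub>M lborel)"
  and J_nonneg: "0 \<le> J x y"
  using kernel by (auto simp: levy_kernel_def)

lemma J_measurable_fst_snd [measurable]:
  "(\<lambda>z. J (fst z) (snd z)) \<in> borel_measurable (lborel \<Otimes>\<^sub>M lborel)"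
  using J_measurable by (simp add: case_prod_unfold)

lemma form_integrand_measurable:
  assumes "f \<in> borel_measurable lborel" "g \<in> borel_measurable lborel"
  shows "(\<lambda>(x, y). (f x - f y) * (g x - g y) * J x y) \<in> borel_measurable (lborel \<Otimes>\<^sub>M lborel)"
proof -
  have [measurable]: "f \<in> borel_measurable lborel" "g \<in> borel_measurable lborel" by fact+
  show ?thesis unfolding case_prod_unfold by measurable
qed

text \<open>Trades the finite extended-real energy for Bochner integrability, after which
  bilinearity of the form is linearity of the integral.\<close>

lemma levy_space_iff:
  "f \<in> levy_space J \<longleftrightarrow> f \<in> Lp_space 2 \<and>
     integrable (lborel \<Otimes>\<^sub>M lborel) (\<lambda>(x, y). (f x - f y) * (f x - f y) * J x y)"
proof (cases "f \<in> Lp_space 2")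
  case True
  let ?I = "\<integral>\<^sup>+ (x, y). ennreal ((f x - f y)\<^sup>2 * J x y) \<partial>(lborel \<Otimes>\<^sub>M lborel)"
  have "integrable (lborel \<Otimes>\<^sub>M lborel) (\<lambda>(x, y). (f x - f y) * (f x - f y) * J x y) \<longleftrightarrow> ?I < \<infinity>"
    using form_integrand_measurable[of f f] L2_borel[OF True] J_nonneg
    by (simp add: integrable_iff_bounded case_prod_unfold power2_eq_square abs_mult)
  moreover have "?I / 2 < \<infinity> \<longleftrightarrow> ?I < \<infinity>"
    by (simp add: ennreal_divide_eq_top_iff less_top[symmetric])
  ultimately show ?thesis using True by (simp add: levy_space_def levy_energy_def)
qed (simp add: levy_space_def)

lemma levy_space_L2: "f \<in> levy_space J \<Longrightarrow> f \<in> Lp_space 2"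
  by (simp add: levy_space_iff)

lemma levy_energy_eq_form:
  assumes "f \<in> levy_space J"
  shows "levy_energy J f = ennreal (levy_form J f f)"
proof -
  have "integrable (lborel \<Otimes>\<^sub>M lborel) (\<lambda>(x, y). (f x - f y) * (f x - f y) * J x y)"
    using assms by (simp add: levy_space_iff)
  then have "(\<integral>\<^sup>+ (x, y). ennreal ((f x - f y)\<^sup>2 * J x y) \<partial>(lborel \<Otimes>\<^sub>M lborel))
      = ennreal (\<integral>(x, y). (f x - f y) * (f x - f y) * J x y \<partial>(lborel \<Otimes>\<^sub>M lborel))" (is "?L = ennreal ?R")
    using J_nonneg
    by (subst nn_integral_eq_integral[symmetric])
      (auto simp: case_prod_unfold power2_eq_square)
  moreover have "0 \<le> ?R"
    using J_nonneg by (intro Bochner_Integration.integral_nonneg) (auto simp: case_prod_unfold)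
  then have "ennreal ?R / 2 = ennreal (?R / 2)" by (rule ennreal_divide_numeral)
  ultimately show ?thesis unfolding levy_energy_def levy_form_def by simp
qed

lemma form_integrable:
  assumes "f \<in> levy_space J" "g \<in> levy_space J"
  shows "integrable (lborel \<Otimes>\<^sub>M lborel) (\<lambda>(x, y). (f x - f y) * (g x - g y) * J x y)"
proof (rule Bochner_Integration.integrable_bound)
  show "integrable (lborel \<Otimes>\<^sub>M lborel) (\<lambda>z. (case z of (x, y) \<Rightarrow> (f x - f y) * (f x - f y) * J x y) +
      (case z of (x, y) \<Rightarrow> (g x - g y) * (g x - g y) * J x y))"
    using assms by (intro Bochner_Integration.integrable_add) (auto simp: levy_space_iff)
  show "(\<lambda>(x, y). (f x - f y) * (g x - g y) * J x y) \<in> borel_measurable (lborel \<Otimes>\<^sub>M lborel)"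
    using assms by (intro form_integrand_measurable L2_borel levy_space_L2)
  have "\<bar>a * b * c\<bar> \<le> \<bar>a * a * c + b * b * c\<bar>" if "c \<ge> 0" for a b c :: real
  proof -
    have "0 \<le> (\<bar>a\<bar> - \<bar>b\<bar>)\<^sup>2" "0 \<le> \<bar>a\<bar> * \<bar>b\<bar>" by auto
    then have "2 * (\<bar>a\<bar> * \<bar>b\<bar>) \<le> a\<^sup>2 + b\<^sup>2" by (simp add: power2_diff)
    with \<open>0 \<le> \<bar>a\<bar> * \<bar>b\<bar>\<close> have "\<bar>a\<bar> * \<bar>b\<bar> \<le> a * a + b * b"
      unfolding power2_eq_square by linarith
    then have "\<bar>a\<bar> * \<bar>b\<bar> * c \<le> (a * a + b * b) * c" using that by (rule mult_right_mono)
    then show ?thesis using that by (simp add: abs_mult distrib_right)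
  qed
  then show "AE z in lborel \<Otimes>\<^sub>M lborel. norm (case z of (x, y) \<Rightarrow> (f x - f y) * (g x - g y) * J x y)
       \<le> norm ((case z of (x, y) \<Rightarrow> (f x - f y) * (f x - f y) * J x y) +
      (case z of (x, y) \<Rightarrow> (g x - g y) * (g x - g y) * J x y))"
    using J_nonneg by (intro AE_I2) (auto simp: case_prod_unfold)
qed

lemma levy_form_commute: "levy_form J f g = levy_form J g f"
  by (simp add: levy_form_def mult.commute mult.left_commute)

lemma levy_form_self_nonneg: "0 \<le> levy_form J f f"
  using J_nonneg by (auto simp: levy_form_def intro!: Bochner_Integration.integral_nonneg)

lemma levy_space_scale: "f \<in> levy_space J \<Longrightarrow> (\<lambda>x. c * f x) \<in> levy_space J"
proof -
  have *: "(\<lambda>(x, y). (c * f x - c * f y) * (c * f x - c * f y) * J x y) =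
      (\<lambda>z. c\<^sup>2 * (case z of (x, y) \<Rightarrow> (f x - f y) * (f x - f y) * J x y))"
    by (auto simp: fun_eq_iff power2_eq_square algebra_simps)
  show "f \<in> levy_space J \<Longrightarrow> (\<lambda>x. c * f x) \<in> levy_space J"
    by (simp add: levy_space_iff L2_scale *)
qed

lemma levy_space_add:
  assumes "f \<in> levy_space J" "g \<in> levy_space J"
  shows "(\<lambda>x. f x + g x) \<in> levy_space J"
proof -
  have *: "(\<lambda>(x, y). (f x + g x - (f y + g y)) * (f x + g x - (f y + g y)) * J x y) =
     (\<lambda>z. (case z of (x, y) \<Rightarrow> (f x - f y) * (f x - f y) * J x y)
        + 2 * (case z of (x, y) \<Rightarrow> (f x - f y) * (g x - g y) * J x y)
        + (case z of (x, y) \<Rightarrow> (g x - g y) * (g x - g y) * J x y))"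
    by (auto simp: fun_eq_iff algebra_simps)
  have "integrable (lborel \<Otimes>\<^sub>M lborel) (\<lambda>z. (case z of (x, y) \<Rightarrow> (f x - f y) * (f x - f y) * J x y)
        + 2 * (case z of (x, y) \<Rightarrow> (f x - f y) * (g x - g y) * J x y)
        + (case z of (x, y) \<Rightarrow> (g x - g y) * (g x - g y) * J x y))"
    by (intro Bochner_Integration.integrable_add integrable_mult_right form_integrable assms)
  then show ?thesis using assms * by (simp add: levy_space_iff L2_add)
qed

lemma levy_space_diff:
  "f \<in> levy_space J \<Longrightarrow> g \<in> levy_space J \<Longrightarrow> (\<lambda>x. f x - g x) \<in> levy_space J"
  using levy_space_add[of f "\<lambda>x. -1 * g x"] levy_space_scale[of g "-1"] by simp

lemma levy_form_add_left:
  assumes "f \<in> levy_space J" "g \<in> levy_space J" "w \<in> levy_space J"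
  shows "levy_form J (\<lambda>x. f x + g x) w = levy_form J f w + levy_form J g w"
proof -
  have "(\<lambda>(x, y). (f x + g x - (f y + g y)) * (w x - w y) * J x y) =
     (\<lambda>z. (case z of (x, y) \<Rightarrow> (f x - f y) * (w x - w y) * J x y)
        + (case z of (x, y) \<Rightarrow> (g x - g y) * (w x - w y) * J x y))"
    by (auto simp: fun_eq_iff algebra_simps)
  then show ?thesis using assms form_integrable by (simp add: levy_form_def)
qed

lemma levy_form_scale_left: "levy_form J (\<lambda>x. c * f x) w = c * levy_form J f w"
proof -
  have "(\<lambda>(x, y). (c * f x - c * f y) * (w x - w y) * J x y) =
     (\<lambda>z. c * (case z of (x, y) \<Rightarrow> (f x - f y) * (w x - w y) * J x y))"
    by (auto simp: fun_eq_iff algebra_simps)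
  then show ?thesis by (simp add: levy_form_def)
qed

lemma levy_form_diff_left:
  assumes "f \<in> levy_space J" "g \<in> levy_space J" "w \<in> levy_space J"
  shows "levy_form J (\<lambda>x. f x - g x) w = levy_form J f w - levy_form J g w"
  using levy_form_add_left[of f "\<lambda>x. -1 * g x" w] levy_space_scale[of g "-1"] assms
    levy_form_scale_left[of "-1" g w] by simp

lemma levy_form_diff_right:
  assumes "f \<in> levy_space J" "g \<in> levy_space J" "w \<in> levy_space J"
  shows "levy_form J w (\<lambda>x. f x - g x) = levy_form J w f - levy_form J w g"
  using levy_form_diff_left[OF assms] by (simp only: levy_form_commute[of w])

lemma levy_form_le:
  assumes "f \<in> levy_space J" "g \<in> levy_space J" "h \<in> levy_space J" "k \<in> levy_space J"
    and "\<And>x y. (f x - f y) * (g x - g y) \<le> C * ((h x - h y) * (k x - k y))"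
  shows "levy_form J f g \<le> C * levy_form J h k"
proof -
  have "(\<integral>(x, y). (f x - f y) * (g x - g y) * J x y \<partial>(lborel \<Otimes>\<^sub>M lborel)) \<le>
      (\<integral>z. C * (case z of (x, y) \<Rightarrow> (h x - h y) * (k x - k y) * J x y) \<partial>(lborel \<Otimes>\<^sub>M lborel))"
  proof (intro integral_mono integrable_mult_right form_integrable assms(1-4))
    fix z :: "(real^'n) \<times> (real^'n)"
    obtain x y where "z = (x, y)" by fastforce
    moreover have "(f x - f y) * (g x - g y) * J x y \<le> C * ((h x - h y) * (k x - k y) * J x y)"
      using mult_right_mono[OF assms(5)[of x y] J_nonneg[of x y]] by (simp only: mult.assoc)
    ultimately show "(case z of (x, y) \<Rightarrow> (f x - f y) * (g x - g y) * J x y)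
        \<le> C * (case z of (x, y) \<Rightarrow> (h x - h y) * (k x - k y) * J x y)"
      by (simp only: prod.case)
  qed
  then show ?thesis by (simp add: levy_form_def)
qed

lemma levy_form_le_AM:
  assumes "f \<in> levy_space J" "g \<in> levy_space J"
  shows "2 * levy_form J f g \<le> levy_form J f f + levy_form J g g"
proof -
  have "0 \<le> levy_form J (\<lambda>x. f x - g x) (\<lambda>x. f x - g x)" by (rule levy_form_self_nonneg)
  also have "\<dots> = levy_form J f f + levy_form J g g - 2 * levy_form J f g"
    using assms by (simp add: levy_form_diff_left levy_form_diff_right levy_space_diff
        levy_form_commute[of g f])
  finally show ?thesis by simp
qed

text \<open>The contraction property of Dirichlet forms: squared differences grow at most by the
  factor \<open>K\<^sup>2\<close>, and \<open>k 0 = 0\<close> gives the same control of the function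
  itself. Working on a range \<open>I\<close> admits powers, which are Lipschitz only on bounded
  sets.\<close>

lemma levy_space_Lipschitz:
  assumes f: "f \<in> levy_space J" and k: "k \<in> borel_measurable borel"
    and I: "\<And>x. f x \<in> I" "0 \<in> I"
    and lip: "\<And>a b. a \<in> I \<Longrightarrow> b \<in> I \<Longrightarrow> \<bar>k a - k b\<bar> \<le> K * \<bar>a - b\<bar>" and k0: "k 0 = 0"
  shows "(\<lambda>x. k (f x)) \<in> levy_space J"
proof -
  have fm[measurable]: "f \<in> borel_measurable lborel" by (rule L2_borel[OF levy_space_L2[OF f]])
  have km: "(\<lambda>x. k (f x)) \<in> borel_measurable lborel" using k by measurable
  have L2: "(\<lambda>x. k (f x)) \<in> Lp_space 2"
    using lip[of _ 0] I k0 km by (intro L2_dominated[OF levy_space_L2[OF f], of _ K]) auto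
  have "integrable (lborel \<Otimes>\<^sub>M lborel)
     (\<lambda>(x, y). (k (f x) - k (f y)) * (k (f x) - k (f y)) * J x y)"
  proof (rule Bochner_Integration.integrable_bound)
    show "integrable (lborel \<Otimes>\<^sub>M lborel)
        (\<lambda>z. K\<^sup>2 * (case z of (x, y) \<Rightarrow> (f x - f y) * (f x - f y) * J x y))"
      using f by (auto simp: levy_space_iff)
    have "(k (f x) - k (f y)) * (k (f x) - k (f y)) \<le> K\<^sup>2 * ((f x - f y) * (f x - f y))" for x y
    proof -
      have "\<bar>k (f x) - k (f y)\<bar>\<^sup>2 \<le> (K * \<bar>f x - f y\<bar>)\<^sup>2"
        using lip I by (intro power_mono) auto
      then show ?thesis unfolding power_mult_distrib power2_abs by (simp add: power2_eq_square)
    qed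
    from mult_right_mono[OF this J_nonneg]
    have le: "(k (f x) - k (f y)) * (k (f x) - k (f y)) * J x y
        \<le> K\<^sup>2 * ((f x - f y) * (f x - f y) * J x y)" for x y
      by (simp only: mult.assoc)
    have "0 \<le> d * d * J x y" for d x y using J_nonneg by simp
    then have "norm (d * d * J x y) = d * d * J x y"
      "norm (K\<^sup>2 * (d * d * J x y)) = K\<^sup>2 * (d * d * J x y)" for d x y by simp_all
    with le show "AE z in lborel \<Otimes>\<^sub>M lborel.
        norm (case z of (x, y) \<Rightarrow> (k (f x) - k (f y)) * (k (f x) - k (f y)) * J x y)
       \<le> norm (K\<^sup>2 * (case z of (x, y) \<Rightarrow> (f x - f y) * (f x - f y) * J x y))"
      by (intro AE_I2) (auto simp only: prod.case split: prod.split)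
  qed (intro form_integrand_measurable km)
  then show ?thesis using L2 by (simp add: levy_space_iff)
qed

text \<open>By Fubini a null set of points yields a null set of pairs, which makes the form
  independent of the representative.\<close>

lemma AE_pair_lborel:
  fixes f f' :: "real^'n \<Rightarrow> real"
  assumes "AE x in lborel. f x = f' x"
    and [measurable]: "f \<in> borel_measurable lborel" "f' \<in> borel_measurable lborel"
  shows "AE z in lborel \<Otimes>\<^sub>M lborel. f (fst z) = f' (fst z) \<and> f (snd z) = f' (snd z)"
proof (rule lborel_pair.AE_pair_measure)
  show "{z \<in> space (lborel \<Otimes>\<^sub>M lborel). f (fst z) = f' (fst z) \<and> f (snd z) = f' (snd z)}
      \<in> sets (lborel \<Otimes>\<^sub>M lborel)"
    by measurable
  show "AE x in lborel. AE y in lborel. f (fst (x, y)) = f' (fst (x, y)) \<and> f (snd (x, y)) = f' (snd (x, y))"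
    using assms(1)
  proof eventually_elim
    case (elim x)
    show ?case using assms(1) by eventually_elim (simp add: elim)
  qed
qed

lemma levy_form_cong_AE:
  assumes "AE x in lborel. f x = f' x" "AE x in lborel. g x = g' x"
    and "f \<in> borel_measurable lborel" "f' \<in> borel_measurable lborel"
    and "g \<in> borel_measurable lborel" "g' \<in> borel_measurable lborel"
  shows "levy_form J f g = levy_form J f' g'"
proof -
  have "(\<integral>(x, y). (f x - f y) * (g x - g y) * J x y \<partial>(lborel \<Otimes>\<^sub>M lborel)) =
      (\<integral>(x, y). (f' x - f' y) * (g' x - g' y) * J x y \<partial>(lborel \<Otimes>\<^sub>M lborel))"
    using AE_pair_lborel[OF assms(1,3,4)] AE_pair_lborel[OF assms(2,5,6)]
    by (intro integral_cong_AE form_integrand_measurable assms) (auto simp: case_prod_unfold)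
  then show ?thesis by (simp add: levy_form_def)
qed

lemma levy_energy_cong_AE:
  assumes "AE x in lborel. f x = f' x"
    and "f \<in> borel_measurable lborel" "f' \<in> borel_measurable lborel"
  shows "levy_energy J f = levy_energy J f'"
proof -
  have "(\<integral>\<^sup>+ (x, y). ennreal ((f x - f y)\<^sup>2 * J x y) \<partial>(lborel \<Otimes>\<^sub>M lborel)) =
      (\<integral>\<^sup>+ (x, y). ennreal ((f' x - f' y)\<^sup>2 * J x y) \<partial>(lborel \<Otimes>\<^sub>M lborel))"
    using AE_pair_lborel[OF assms] by (intro nn_integral_cong_AE) (auto simp: case_prod_unfold)
  then show ?thesis by (simp add: levy_energy_def)
qed

lemma levy_space_cong_AE:
  assumes "f \<in> levy_space J" "g \<in> borel_measurable lborel" "AE x in lborel. g x = f x"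
  shows "g \<in> levy_space J"
  using assms L2_cong_AE[OF levy_space_L2[OF assms(1)] assms(2,3)]
    levy_energy_cong_AE[OF assms(3,2) L2_borel[OF levy_space_L2[OF assms(1)]]]
  by (simp add: levy_space_def)

end

section \<open>Solutions of the evolution equation\<close>

lemma L2_triangle:
  assumes "f \<in> Lp_space 2" "g \<in> Lp_space 2"
  shows "Lp_norm 2 (\<lambda>x. f x + g x) \<le> Lp_norm 2 f + Lp_norm 2 g"
proof (rule power2_le_imp_le)
  have "(Lp_norm 2 (\<lambda>x. f x + g x))\<^sup>2 = (Lp_norm 2 f)\<^sup>2 + 2 * L2_inner f g + (Lp_norm 2 g)\<^sup>2"
    using assms by (simp add: Lp_norm_2_sq L2_inner_add_left L2_inner_add_right L2_add
        L2_inner_commute[of g f])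
  also have "\<dots> \<le> (Lp_norm 2 f + Lp_norm 2 g)\<^sup>2"
    using L2_Cauchy_Schwarz[OF assms] by (simp add: power2_sum)
  finally show "(Lp_norm 2 (\<lambda>x. f x + g x))\<^sup>2 \<le> (Lp_norm 2 f + Lp_norm 2 g)\<^sup>2" .
qed simp

lemma L2_tendsto_add:
  assumes "L2_tendsto u f F" "L2_tendsto w g F"
  shows "L2_tendsto (\<lambda>s x. u s x + w s x) (\<lambda>x. f x + g x) F"
  unfolding L2_tendsto_def
proof (intro conjI)
  have ev: "\<forall>\<^sub>F s in F. u s \<in> Lp_space 2 \<and> w s \<in> Lp_space 2"
    using assms by (auto simp: L2_tendsto_def eventually_conj_iff)
  then show "\<forall>\<^sub>F s in F. (\<lambda>x. u s x + w s x) \<in> Lp_space 2"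
    by eventually_elim (simp add: L2_add)
  have fg: "f \<in> Lp_space 2" "g \<in> Lp_space 2" using assms by (auto simp: L2_tendsto_def)
  then show "(\<lambda>x. f x + g x) \<in> Lp_space 2" by (rule L2_add)
  show "((\<lambda>s. Lp_norm 2 (\<lambda>x. u s x + w s x - (f x + g x))) \<longlongrightarrow> 0) F"
  proof (rule Lim_null_comparison)
    show "((\<lambda>s. Lp_norm 2 (\<lambda>x. u s x - f x) + Lp_norm 2 (\<lambda>x. w s x - g x)) \<longlongrightarrow> 0) F"
      using assms by (auto simp: L2_tendsto_def intro: tendsto_add_zero)
    show "\<forall>\<^sub>F s in F. norm (Lp_norm 2 (\<lambda>x. u s x + w s x - (f x + g x)))
        \<le> Lp_norm 2 (\<lambda>x. u s x - f x) + Lp_norm 2 (\<lambda>x. w s x - g x)"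
      using ev
    proof eventually_elim
      case (elim s)
      then show ?case
        using L2_triangle[of "\<lambda>x. u s x - f x" "\<lambda>x. w s x - g x"] fg
        by (simp add: L2_diff algebra_simps)
    qed
  qed
qed

lemma L2_tendsto_scale:
  assumes "L2_tendsto u f F"
  shows "L2_tendsto (\<lambda>s x. c * u s x) (\<lambda>x. c * f x) F"
proof -
  have "Lp_norm 2 (\<lambda>x. c * u s x - c * f x) = \<bar>c\<bar> * Lp_norm 2 (\<lambda>x. u s x - f x)" for s
    by (simp add: Lp_norm_2 right_diff_distrib[symmetric] power_mult_distrib real_sqrt_mult)
  moreover have "\<forall>\<^sub>F s in F. (\<lambda>x. c * u s x) \<in> Lp_space 2"
    using assms by (auto simp: L2_tendsto_def L2_scale elim: eventually_mono)
  ultimately show ?thesis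
    using assms by (auto simp: L2_tendsto_def L2_scale intro: tendsto_mult_right_zero)
qed

lemma L2_tendsto_compose:
  assumes "L2_tendsto u f F" "filterlim h F G"
  shows "L2_tendsto (\<lambda>r. u (h r)) f G"
  using assms filterlim_compose[OF _ assms(2)] eventually_compose_filterlim[OF _ assms(2)]
  by (auto simp: L2_tendsto_def)

lemma L2_tendsto_cong_AE:
  assumes "L2_tendsto u f F"
    and "\<forall>\<^sub>F s in F. w s \<in> borel_measurable lborel \<and> (AE x in lborel. w s x = u s x)"
    and "g \<in> borel_measurable lborel" "AE x in lborel. g x = f x"
  shows "L2_tendsto w g F"
  unfolding L2_tendsto_def
proof (intro conjI)
  have f: "f \<in> Lp_space 2" using assms by (simp add: L2_tendsto_def)
  show g: "g \<in> Lp_space 2" using L2_cong_AE[OF f assms(3,4)] .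
  have ev: "\<forall>\<^sub>F s in F. u s \<in> Lp_space 2 \<and> w s \<in> borel_measurable lborel \<and>
      (AE x in lborel. w s x = u s x)"
    using assms by (auto simp: L2_tendsto_def eventually_conj_iff)
  then show "\<forall>\<^sub>F s in F. w s \<in> Lp_space 2"
    by eventually_elim (auto intro: L2_cong_AE)
  have "((\<lambda>s. Lp_norm 2 (\<lambda>x. u s x - f x)) \<longlongrightarrow> 0) F"
    using assms by (simp add: L2_tendsto_def)
  then show "((\<lambda>s. Lp_norm 2 (\<lambda>x. w s x - g x)) \<longlongrightarrow> 0) F"
  proof (rule Lim_transform_eventually)
    show "\<forall>\<^sub>F s in F. Lp_norm 2 (\<lambda>x. u s x - f x) = Lp_norm 2 (\<lambda>x. w s x - g x)"
      using ev
    proof eventually_elim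
      case (elim s)
      then have wu: "AE x in lborel. w s x = u s x" and [measurable]: "w s \<in> borel_measurable lborel"
        "u s \<in> borel_measurable lborel" using L2_borel by auto
      note [measurable] = L2_borel[OF f] L2_borel[OF g]
      show ?case
        by (rule Lp_norm_cong_AE) (use wu assms(4) in \<open>auto elim: AE_mp\<close>)
    qed
  qed
qed

context levy
begin

text \<open>The part of \<open>levy_solution\<close> that is preserved by linear combinations, time shifts and
  changes on null sets without further work; it already implies uniqueness.\<close>

definition flow :: "(real \<Rightarrow> (real^'n) \<Rightarrow> real) \<Rightarrow> bool" where
  "flow u \<longleftrightarrow>
     (\<forall>t\<ge>0. L2_tendsto u (u t) (at t within {0..})) \<and>
     (\<forall>t>0. \<exists>v. u t \<in> levy_space J \<and>
        L2_tendsto (\<lambda>s x. (u s x - u t x) / (s - t)) v (at t) \<and>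
        (\<forall>g\<in>levy_space J. L2_inner v g = - levy_form J (u t) g))"

lemma levy_solution_flow:
  assumes "levy_solution J u0 u"
  shows "flow u"
  unfolding flow_def
proof (intro conjI allI impI)
  fix t :: real assume t: "0 \<le> t"
  have L2: "\<forall>t\<ge>0. u t \<in> Lp_space 2"
    using assms by (auto simp: levy_solution_def L2_continuous_on_def)
  have "\<forall>\<^sub>F s in at t within {0..}. s \<in> {0..}" by (auto simp: eventually_at_filter)
  then have "\<forall>\<^sub>F s in at t within {0..}. u s \<in> Lp_space 2"
    by eventually_elim (use L2 in auto)
  then show "L2_tendsto u (u t) (at t within {0..})"
    using assms t L2 by (auto simp: levy_solution_def L2_continuous_on_def L2_tendsto_def)
next
  obtain v where v: "L2_has_derivative_on {0<..} u v"
    and op: "\<forall>t>0. levy_operator J (u t) (\<lambda>x. - v t x)"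
    using assms by (auto simp: levy_solution_def)
  fix t :: real assume t: "0 < t"
  show "\<exists>v. u t \<in> levy_space J \<and>
        L2_tendsto (\<lambda>s x. (u s x - u t x) / (s - t)) v (at t) \<and>
        (\<forall>g\<in>levy_space J. L2_inner v g = - levy_form J (u t) g)"
  proof (intro exI[of _ "v t"] conjI ballI)
    show "u t \<in> levy_space J" using op t by (simp add: levy_operator_def)
    have at: "at t within {0<..} = at t" using t by (intro at_within_open) auto
    have "\<forall>\<^sub>F s in at t within {0<..}. s \<in> {0<..}" by (auto simp: eventually_at_filter)
    then have "\<forall>\<^sub>F s in at t within {0<..}. (\<lambda>x. (u s x - u t x) / (s - t)) \<in> Lp_space 2"
      by eventually_elim (use v t in \<open>auto simp: L2_has_derivative_on_def intro!: L2_divide L2_diff\<close>)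
    moreover have "((\<lambda>s. Lp_norm 2 (\<lambda>x. (u s x - u t x) / (s - t) - v t x)) \<longlongrightarrow> 0)
        (at t within {0<..})" "v t \<in> Lp_space 2"
      using v t unfolding L2_has_derivative_on_def by blast+
    ultimately show "L2_tendsto (\<lambda>s x. (u s x - u t x) / (s - t)) (v t) (at t)"
      unfolding L2_tendsto_def at by blast
    show "L2_inner (v t) g = - levy_form J (u t) g" if "g \<in> levy_space J" for g
      using op t that L2_inner_minus_left[of "v t" g] by (auto simp: levy_operator_def)
  qed
qed

lemma flow_tendsto0: "flow u \<Longrightarrow> 0 \<le> t \<Longrightarrow> L2_tendsto u (u t) (at t within {0..})"
  by (simp add: flow_def)

lemma flow_tendsto:
  assumes "flow u" "0 < t"
  shows "L2_tendsto u (u t) (at t)"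
proof -
  have "at t within {0..} = at t" using assms by (intro at_within_interior) auto
  then show ?thesis using flow_tendsto0[OF assms(1), of t] assms by simp
qed

lemma flow_L2: "flow u \<Longrightarrow> 0 \<le> t \<Longrightarrow> u t \<in> Lp_space 2"
  using flow_tendsto0 by (auto simp: L2_tendsto_def)

lemma flow_borel: "flow u \<Longrightarrow> 0 \<le> t \<Longrightarrow> u t \<in> borel_measurable lborel"
  by (rule L2_borel[OF flow_L2])

lemma flow_space: "flow u \<Longrightarrow> 0 < t \<Longrightarrow> u t \<in> levy_space J"
  by (auto simp: flow_def)

lemma flow_deriv:
  assumes "flow u" "0 < t"
  obtains v where "v \<in> Lp_space 2" "L2_tendsto (\<lambda>s x. (u s x - u t x) / (s - t)) v (at t)"
    "\<And>g. g \<in> levy_space J \<Longrightarrow> L2_inner v g = - levy_form J (u t) g"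
  using assms by (auto simp: flow_def L2_tendsto_def)

lemma flow_add:
  assumes "flow u" "flow w"
  shows "flow (\<lambda>t x. u t x + w t x)"
proof -
  have "\<exists>v. (\<lambda>x. u t x + w t x) \<in> levy_space J \<and>
     L2_tendsto (\<lambda>s x. (u s x + w s x - (u t x + w t x)) / (s - t)) v (at t) \<and>
     (\<forall>g\<in>levy_space J. L2_inner v g = - levy_form J (\<lambda>x. u t x + w t x) g)" if t: "0 < t" for t
  proof -
    obtain v1 where v1: "v1 \<in> Lp_space 2" "L2_tendsto (\<lambda>s x. (u s x - u t x) / (s - t)) v1 (at t)"
      "\<And>g. g \<in> levy_space J \<Longrightarrow> L2_inner v1 g = - levy_form J (u t) g"
      using flow_deriv[OF assms(1) t] by blast
    obtain v2 where v2: "v2 \<in> Lp_space 2" "L2_tendsto (\<lambda>s x. (w s x - w t x) / (s - t)) v2 (at t)"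
      "\<And>g. g \<in> levy_space J \<Longrightarrow> L2_inner v2 g = - levy_form J (w t) g"
      using flow_deriv[OF assms(2) t] by blast
    have "(\<lambda>s x. (u s x + w s x - (u t x + w t x)) / (s - t)) =
        (\<lambda>s x. (u s x - u t x) / (s - t) + (w s x - w t x) / (s - t))"
      by (auto simp: fun_eq_iff add_divide_distrib[symmetric])
    then show ?thesis
      using v1 v2 L2_tendsto_add[OF v1(2) v2(2)] flow_space[OF assms(1) t] flow_space[OF assms(2) t]
      by (intro exI[of _ "\<lambda>x. v1 x + v2 x"])
        (auto simp: levy_space_add L2_inner_add_left levy_space_L2 levy_form_add_left)
  qed
  then show ?thesis
    using assms unfolding flow_def by (blast intro: L2_tendsto_add)
qed

lemma flow_scale:
  assumes "flow u"
  shows "flow (\<lambda>t x. c * u t x)"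
proof -
  have "\<exists>v. (\<lambda>x. c * u t x) \<in> levy_space J \<and>
     L2_tendsto (\<lambda>s x. (c * u s x - c * u t x) / (s - t)) v (at t) \<and>
     (\<forall>g\<in>levy_space J. L2_inner v g = - levy_form J (\<lambda>x. c * u t x) g)" if t: "0 < t" for t
  proof -
    obtain v1 where v1: "v1 \<in> Lp_space 2" "L2_tendsto (\<lambda>s x. (u s x - u t x) / (s - t)) v1 (at t)"
      "\<And>g. g \<in> levy_space J \<Longrightarrow> L2_inner v1 g = - levy_form J (u t) g"
      using flow_deriv[OF assms(1) t] by blast
    have "(\<lambda>s x. (c * u s x - c * u t x) / (s - t)) = (\<lambda>s x. c * ((u s x - u t x) / (s - t)))"
      by (auto simp: fun_eq_iff right_diff_distrib)
    then show ?thesis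
      using v1 L2_tendsto_scale[OF v1(2), of c] flow_space[OF assms(1) t]
      by (intro exI[of _ "\<lambda>x. c * v1 x"])
        (auto simp: levy_space_scale L2_inner_scale_left levy_form_scale_left)
  qed
  then show ?thesis
    using assms unfolding flow_def by (blast intro: L2_tendsto_scale)
qed

lemma flow_diff: "flow u \<Longrightarrow> flow w \<Longrightarrow> flow (\<lambda>t x. u t x - w t x)"
  using flow_add[of u "\<lambda>t x. -1 * w t x"] flow_scale[of w "-1"] by simp

lemma flow_shift:
  assumes "flow u" "0 \<le> r"
  shows "flow (\<lambda>t. u (t + r))"
proof -
  have "L2_tendsto (\<lambda>s. u (s + r)) (u (t + r)) (at t within {0..})" if "0 \<le> t" for t
  proof (rule L2_tendsto_compose)
    show "L2_tendsto u (u (t + r)) (at (t + r) within {0..})"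
      using assms that by (intro flow_tendsto0) auto
    show "filterlim (\<lambda>s. s + r) (at (t + r) within {0..}) (at t within {0..})"
      using assms(2) unfolding filterlim_at
      by (auto simp: eventually_at_filter intro!: tendsto_intros)
  qed
  moreover have "\<exists>v. u (t + r) \<in> levy_space J \<and>
     L2_tendsto (\<lambda>s x. (u (s + r) x - u (t + r) x) / (s - t)) v (at t) \<and>
     (\<forall>g\<in>levy_space J. L2_inner v g = - levy_form J (u (t + r)) g)" if t: "0 < t" for t
  proof -
    have tr: "0 < t + r" using t assms by simp
    obtain v1 where v1: "v1 \<in> Lp_space 2"
      "L2_tendsto (\<lambda>s x. (u s x - u (t + r) x) / (s - (t + r))) v1 (at (t + r))"
      "\<And>g. g \<in> levy_space J \<Longrightarrow> L2_inner v1 g = - levy_form J (u (t + r)) g"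
      using flow_deriv[OF assms(1) tr] by blast
    have "filterlim (\<lambda>s. s + r) (at (t + r)) (at t)"
      unfolding filterlim_at by (auto simp: eventually_at_filter intro!: tendsto_intros)
    from L2_tendsto_compose[OF v1(2) this] show ?thesis
      using v1 flow_space[OF assms(1) tr] by (intro exI[of _ v1]) auto
  qed
  ultimately show ?thesis unfolding flow_def by blast
qed

text \<open>Allows a solution to be clipped at its almost-everywhere bounds: the clipped
  representative is still a flow and satisfies the bounds at every point, as the pointwise convexity
  estimates demand.\<close>

lemma flow_cong_AE:
  assumes "flow u" and w: "\<And>t. 0 \<le> t \<Longrightarrow> w t \<in> borel_measurable lborel"
    and AE: "\<And>t. 0 \<le> t \<Longrightarrow> AE x in lborel. w t x = u t x"
  shows "flow w"
proof -
  have "L2_tendsto w (w t) (at t within {0..})" if "0 \<le> t" for t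
  proof (rule L2_tendsto_cong_AE[OF flow_tendsto0[OF assms(1) that]])
    have "\<forall>\<^sub>F s in at t within {0..}. s \<in> {0..}" by (auto simp: eventually_at_filter)
    then show "\<forall>\<^sub>F s in at t within {0..}. w s \<in> borel_measurable lborel \<and> (AE x in lborel. w s x = u s x)"
      by eventually_elim (use w AE in auto)
  qed (use w AE that in auto)
  moreover have "\<exists>v. w t \<in> levy_space J \<and>
     L2_tendsto (\<lambda>s x. (w s x - w t x) / (s - t)) v (at t) \<and>
     (\<forall>g\<in>levy_space J. L2_inner v g = - levy_form J (w t) g)" if t: "0 < t" for t
  proof -
    obtain v where v: "v \<in> Lp_space 2" "L2_tendsto (\<lambda>s x. (u s x - u t x) / (s - t)) v (at t)"
      "\<And>g. g \<in> levy_space J \<Longrightarrow> L2_inner v g = - levy_form J (u t) g"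
      using flow_deriv[OF assms(1) t] by blast
    have wt: "w t \<in> levy_space J"
      using levy_space_cong_AE[OF flow_space[OF assms(1) t] w AE] t by simp
    have "L2_tendsto (\<lambda>s x. (w s x - w t x) / (s - t)) v (at t)"
    proof (rule L2_tendsto_cong_AE[OF v(2)])
      have "\<forall>\<^sub>F s in at t. s \<in> {0<..}" using t by (intro eventually_at_in_open') auto
      then show "\<forall>\<^sub>F s in at t. (\<lambda>x. (w s x - w t x) / (s - t)) \<in> borel_measurable lborel \<and>
          (AE x in lborel. (w s x - w t x) / (s - t) = (u s x - u t x) / (s - t))"
      proof eventually_elim
        case (elim s)
        then have [measurable]: "w s \<in> borel_measurable lborel" "w t \<in> borel_measurable lborel"
          using w t by auto
        have "AE x in lborel. w s x = u s x" "AE x in lborel. w t x = u t x"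
          using AE elim t by auto
        then have "AE x in lborel. (w s x - w t x) / (s - t) = (u s x - u t x) / (s - t)"
          by eventually_elim simp
        then show ?case by simp
      qed
    qed (use v L2_borel in auto)
    moreover have "levy_form J (w t) g = levy_form J (u t) g" if "g \<in> levy_space J" for g
      using t that AE flow_borel[OF assms(1)] w L2_borel[OF levy_space_L2[OF that]]
      by (intro levy_form_cong_AE) auto
    ultimately show ?thesis using v wt by (intro exI[of _ v]) auto
  qed
  ultimately show ?thesis unfolding flow_def by blast
qed

lemma levy_form_nonneg:
  assumes "\<And>x y. 0 \<le> (f x - f y) * (g x - g y)"
  shows "0 \<le> levy_form J f g"
proof -
  have "0 \<le> (\<integral>(x, y). (f x - f y) * (g x - g y) * J x y \<partial>(lborel \<Otimes>\<^sub>M lborel))"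
    using mult_nonneg_nonneg[OF assms J_nonneg]
    by (intro Bochner_Integration.integral_nonneg) (simp only: case_prod_unfold)
  then show ?thesis by (simp add: levy_form_def)
qed

end

section \<open>Decay of convex functionals along solutions\<close>

text \<open>\<open>k\<close> selects subgradients of \<open>h\<close>. The subgradient at
  \<open>a\<close> makes the remainder nonnegative; the one at \<open>b\<close> bounds it by
  \<open>(k b - k a) * (b - a)\<close>.\<close>

lemma convex_Lipschitz_remainder:
  fixes h k :: "real \<Rightarrow> real"
  assumes sub: "\<And>a b. a \<in> I \<Longrightarrow> b \<in> I \<Longrightarrow> k a * (b - a) \<le> h b - h a"
    and lip: "\<And>a b. a \<in> I \<Longrightarrow> b \<in> I \<Longrightarrow> \<bar>k a - k b\<bar> \<le> K * \<bar>a - b\<bar>"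
    and "a \<in> I" "b \<in> I"
  shows "\<bar>h b - h a - k a * (b - a)\<bar> \<le> K * (b - a)\<^sup>2"
proof -
  have 1: "k a * (b - a) \<le> h b - h a" "k b * (a - b) \<le> h a - h b" using sub assms by auto
  have "(k b - k a) * (b - a) \<le> \<bar>k b - k a\<bar> * \<bar>b - a\<bar>"
    unfolding abs_mult[symmetric] by (rule abs_ge_self)
  also have "\<dots> \<le> K * \<bar>b - a\<bar> * \<bar>b - a\<bar>" using lip assms by (intro mult_right_mono) auto
  also have "\<dots> = K * (b - a)\<^sup>2" by (simp add: power2_eq_square)
  finally show ?thesis using 1 by (simp add: algebra_simps)
qed

context levy
begin

text \<open>The quadratic remainder makes differentiability in \<open>L\<^sup>2\<close> sufficient:
  the linear part pairs the fixed \<open>k (u t)\<close> with the difference quotient, and the rest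
  is at most \<open>K\<close> times the squared norm of that quotient times
  \<open>\<bar>s - t\<bar>\<close>, hence tends to 0. The range \<open>I\<close> makes room for
  powers of bounded solutions.\<close>

lemma flow_decay:
  assumes u: "flow u" and I: "\<And>t x. 0 \<le> t \<Longrightarrow> u t x \<in> I" "0 \<in> I"
    and hk: "h \<in> borel_measurable borel" "k \<in> borel_measurable borel" "h 0 = 0" "k 0 = 0"
    and sub: "\<And>a b. a \<in> I \<Longrightarrow> b \<in> I \<Longrightarrow> k a * (b - a) \<le> h b - h a"
    and lip: "\<And>a b. a \<in> I \<Longrightarrow> b \<in> I \<Longrightarrow> \<bar>k a - k b\<bar> \<le> K * \<bar>a - b\<bar>"
    and st: "0 \<le> s" "s \<le> t"
  shows "(\<integral>x. h (u t x) \<partial>lborel) \<le> (\<integral>x. h (u s x) \<partial>lborel)"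
proof -
  define Y where "Y = (\<lambda>t. \<integral>x. h (u t x) \<partial>lborel)"
  have quad: "\<bar>h b - h a - k a * (b - a)\<bar> \<le> K * (b - a)\<^sup>2" if "a \<in> I" "b \<in> I" for a b
    using convex_Lipschitz_remainder[OF sub lip that] .
  have [measurable]: "h \<in> borel_measurable borel" "k \<in> borel_measurable borel" by fact+
  have um: "u t \<in> borel_measurable lborel" if "0 \<le> t" for t using flow_borel[OF u that] .
  have hint: "integrable lborel (\<lambda>x. h (u t x))" if t: "0 \<le> t" for t
  proof (rule Bochner_Integration.integrable_bound)
    note [measurable] = um[OF t]
    show "integrable lborel (\<lambda>x. K * (u t x)\<^sup>2)" using flow_L2[OF u t] by (simp add: Lp_space_2_iff)
    show "(\<lambda>x. h (u t x)) \<in> borel_measurable lborel" by measurable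
    show "AE x in lborel. norm (h (u t x)) \<le> norm (K * (u t x)\<^sup>2)"
      using quad[OF I(2) I(1)[OF t]] hk by (intro AE_I2) (auto intro: order_trans[OF _ abs_ge_self])
  qed
  have kL2: "(\<lambda>x. k (u t x)) \<in> Lp_space 2" if t: "0 \<le> t" for t
  proof (rule L2_dominated[OF flow_L2[OF u t], of _ K])
    note [measurable] = um[OF t]
    show "(\<lambda>x. k (u t x)) \<in> borel_measurable lborel" by measurable
    show "AE x in lborel. \<bar>k (u t x)\<bar> \<le> K * \<bar>u t x\<bar>"
      using lip[OF I(1)[OF t] I(2)] hk by auto
  qed
  have est: "\<bar>Y s - Y t - L2_inner (\<lambda>x. k (u t x)) (\<lambda>x. u s x - u t x)\<bar>
      \<le> K * (Lp_norm 2 (\<lambda>x. u s x - u t x))\<^sup>2" if s: "0 \<le> s" and t: "0 \<le> t" for s t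
  proof -
    have d: "(\<lambda>x. u s x - u t x) \<in> Lp_space 2" by (intro L2_diff flow_L2 u s t)
    have i: "integrable lborel (\<lambda>x. k (u t x) * (u s x - u t x))"
      by (rule L2_integrable_mult[OF kL2[OF t] d])
    have "Y s - Y t - L2_inner (\<lambda>x. k (u t x)) (\<lambda>x. u s x - u t x)
      = (\<integral>x. h (u s x) - h (u t x) - k (u t x) * (u s x - u t x) \<partial>lborel)"
      using hint[OF s] hint[OF t] i by (simp add: Y_def L2_inner_def)
    also have "\<bar>\<dots>\<bar> \<le> (\<integral>x. \<bar>h (u s x) - h (u t x) - k (u t x) * (u s x - u t x)\<bar> \<partial>lborel)"
      by (rule integral_abs_bound)
    also have "\<dots> \<le> (\<integral>x. K * (u s x - u t x)\<^sup>2 \<partial>lborel)"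
      using quad[OF I(1)[OF t] I(1)[OF s]] hint[OF s] hint[OF t] i d
      by (intro integral_mono) (auto simp: Lp_space_2_iff)
    finally show ?thesis by (simp add: Lp_norm_2)
  qed
  have cont: "(Y \<longlongrightarrow> Y t) (at t within {0..})" if t: "0 \<le> t" for t
  proof -
    let ?d = "\<lambda>s. Lp_norm 2 (\<lambda>x. u s x - u t x)"
    have "(?d \<longlongrightarrow> 0) (at t within {0..})"
      using flow_tendsto0[OF u t] by (simp add: L2_tendsto_def)
    then have "((\<lambda>s. Lp_norm 2 (\<lambda>x. k (u t x)) * ?d s + K * (?d s)\<^sup>2) \<longlongrightarrow>
        Lp_norm 2 (\<lambda>x. k (u t x)) * 0 + K * 0\<^sup>2) (at t within {0..})"
      by (intro tendsto_intros)
    then have lim: "((\<lambda>s. Lp_norm 2 (\<lambda>x. k (u t x)) * ?d s + K * (?d s)\<^sup>2) \<longlongrightarrow> 0) (at t within {0..})"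
      by simp
    have "((\<lambda>s. Y s - Y t) \<longlongrightarrow> 0) (at t within {0..})"
    proof (rule Lim_null_comparison[OF _ lim])
      have "\<forall>\<^sub>F s in at t within {0..}. s \<in> {0..}" by (auto simp: eventually_at_filter)
      then show "\<forall>\<^sub>F s in at t within {0..}. norm (Y s - Y t)
          \<le> Lp_norm 2 (\<lambda>x. k (u t x)) * ?d s + K * (?d s)\<^sup>2"
      proof eventually_elim
        case (elim s)
        then have s: "0 \<le> s" by simp
        have "\<bar>L2_inner (\<lambda>x. k (u t x)) (\<lambda>x. u s x - u t x)\<bar> \<le> Lp_norm 2 (\<lambda>x. k (u t x)) * ?d s"
          by (intro L2_Cauchy_Schwarz kL2 L2_diff flow_L2 u s t)
        then show ?case using est[OF s t] by simp
      qed
    qed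
    then show ?thesis by (simp add: LIM_zero_iff)
  qed
  have deriv: "(Y has_real_derivative - levy_form J (u t) (\<lambda>x. k (u t x))) (at t)" if t: "0 < t" for t
  proof -
    have kt: "(\<lambda>x. k (u t x)) \<in> levy_space J"
      using lip I t by (intro levy_space_Lipschitz[OF flow_space[OF u t] hk(2), of I K]) (auto simp: hk)
    obtain v where v: "v \<in> Lp_space 2" "L2_tendsto (\<lambda>s x. (u s x - u t x) / (s - t)) v (at t)"
      "\<And>g. g \<in> levy_space J \<Longrightarrow> L2_inner v g = - levy_form J (u t) g"
      using flow_deriv[OF u t] by blast
    let ?q = "\<lambda>s x. (u s x - u t x) / (s - t)"
    have 1: "((\<lambda>s. L2_inner (\<lambda>x. k (u t x)) (?q s)) \<longlongrightarrow> L2_inner (\<lambda>x. k (u t x)) v) (at t)"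
      using t by (intro L2_tendsto_inner v L2_tendsto_const kL2) auto
    have "((\<lambda>s. K * L2_inner (?q s) (?q s) * \<bar>s - t\<bar>) \<longlongrightarrow> K * L2_inner v v * \<bar>t - t\<bar>) (at t)"
      by (intro tendsto_intros L2_tendsto_inner v)
    then have lim: "((\<lambda>s. K * L2_inner (?q s) (?q s) * \<bar>s - t\<bar>) \<longlongrightarrow> 0) (at t)" by simp
    have "((\<lambda>s. (Y s - Y t) / (s - t) - L2_inner (\<lambda>x. k (u t x)) (?q s)) \<longlongrightarrow> 0) (at t)"
    proof (rule Lim_null_comparison[OF _ lim])
      have "\<forall>\<^sub>F s in at t. s \<in> {0<..} - {t}" using t by (intro eventually_at_in_open) auto
      then show "\<forall>\<^sub>F s in at t. norm ((Y s - Y t) / (s - t) - L2_inner (\<lambda>x. k (u t x)) (?q s))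
          \<le> K * L2_inner (?q s) (?q s) * \<bar>s - t\<bar>"
      proof eventually_elim
        case (elim s)
        then have s: "0 \<le> s" "s \<noteq> t" by auto
        have "norm ((Y s - Y t) / (s - t) - L2_inner (\<lambda>x. k (u t x)) (?q s)) =
            \<bar>Y s - Y t - L2_inner (\<lambda>x. k (u t x)) (\<lambda>x. u s x - u t x)\<bar> / \<bar>s - t\<bar>"
          by (simp add: L2_inner_divide_right diff_divide_distrib[symmetric])
        also have "\<dots> \<le> K * (Lp_norm 2 (\<lambda>x. u s x - u t x))\<^sup>2 / \<bar>s - t\<bar>"
          using s t by (intro divide_right_mono est) auto
        also have "\<dots> = K * L2_inner (?q s) (?q s) * \<bar>s - t\<bar>"
        proof -
          have "K * (a / d / d) * \<bar>d\<bar> = K * a / \<bar>d\<bar>" for a d :: real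
            by (cases "0 < d") (auto simp: field_simps)
          then show ?thesis
            unfolding Lp_norm_2_sq L2_inner_divide_left L2_inner_divide_right by (rule sym)
        qed
        finally show ?case .
      qed
    qed
    from tendsto_add[OF this 1]
    have "((\<lambda>s. (Y s - Y t) / (s - t)) \<longlongrightarrow> L2_inner (\<lambda>x. k (u t x)) v) (at t)" by simp
    then show ?thesis using v(3)[OF kt] L2_inner_commute[of v]
      by (simp add: has_field_derivative_iff)
  qed
  \<comment> \<open>Adding the subgradient inequalities at two points shows that \<open>k\<close> is
    monotone, so the integrand of the form is nonnegative.\<close>
  have nonpos: "- levy_form J (u t) (\<lambda>x. k (u t x)) \<le> 0" if t: "0 < t" for t
  proof -
    have "0 \<le> (u t x - u t y) * (k (u t x) - k (u t y))" for x y
      using sub[of "u t x" "u t y"] sub[of "u t y" "u t x"] I t by (simp add: algebra_simps)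
    then show ?thesis using levy_form_nonneg[of "u t"] by simp
  qed
  show ?thesis
  proof (cases "s = t")
    case False
    then have "s < t" using st by simp
    have "Y t \<le> Y s"
    \<comment> \<open>The derivative is available only at positive times; continuity takes care of
      the endpoint when \<open>s\<close> is 0.\<close>
    proof (rule DERIV_nonpos_imp_decreasing_open[OF order.strict_implies_order[OF \<open>s < t\<close>]])
      show "\<exists>y. DERIV Y r :> y \<and> y \<le> 0" if "s < r" "r < t" for r
        using deriv[of r] nonpos[of r] that st by auto
      show "continuous_on {s..t} Y"
        unfolding continuous_on_def
        by (intro ballI tendsto_within_subset[OF cont]) (use st in auto)
    qed
    then show ?thesis by (simp add: Y_def)
  qed simp
qed

section \<open>Uniqueness, positivity and upper bounds as instances of decay\<close>

lemma flow_norm_antimono: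
  assumes "flow u" "0 \<le> s" "s \<le> t"
  shows "L2_inner (u t) (u t) \<le> L2_inner (u s) (u s)"
proof -
  have "(\<integral>x. (u t x)\<^sup>2 / 2 \<partial>lborel) \<le> (\<integral>x. (u s x)\<^sup>2 / 2 \<partial>lborel)"
  proof (rule flow_decay[OF assms(1), of UNIV _ "\<lambda>x. x" 1])
    show "a * (b - a) \<le> b\<^sup>2 / 2 - a\<^sup>2 / 2" for a b :: real
      using zero_le_power2[of "a - b"] by (simp add: power2_diff power2_eq_square algebra_simps)
  qed (use assms in auto)
  then show ?thesis by (simp add: L2_inner_def power2_eq_square)
qed

lemma flow_zero:
  assumes "flow u" "AE x in lborel. u 0 x = 0" "0 \<le> t"
  shows "AE x in lborel. u t x = 0"
proof (rule L2_norm_zero_AE[OF flow_L2[OF assms(1,3)]])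
  have "L2_inner (u 0) (u 0) = L2_inner (\<lambda>x::real^'n. 0) (\<lambda>x. 0)"
    using flow_borel[OF assms(1), of 0]
    by (intro L2_inner_cong_AE[OF assms(2) assms(2)]) auto
  then show "L2_inner (u t) (u t) \<le> 0"
    using flow_norm_antimono[OF assms(1) order_refl assms(3)] by (simp add: L2_inner_def)
qed

lemma flow_unique:
  assumes "flow u" "flow w" "AE x in lborel. u 0 x = w 0 x" "0 \<le> t"
  shows "AE x in lborel. u t x = w t x"
  using flow_zero[OF flow_diff[OF assms(1,2)] _ assms(4)] assms(3) by simp

text \<open>The integral of the squared negative part starts at 0 and cannot increase.\<close>

lemma flow_nonneg:
  assumes u: "flow u" and 0: "AE x in lborel. 0 \<le> u 0 x" and t: "0 \<le> t"
  shows "AE x in lborel. 0 \<le> u t x"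
proof -
  have "(\<integral>x. (min 0 (u t x))\<^sup>2 / 2 \<partial>lborel) \<le> (\<integral>x. (min 0 (u 0 x))\<^sup>2 / 2 \<partial>lborel)"
  proof (rule flow_decay[OF u, of UNIV _ "\<lambda>x. min 0 x" 1])
    show "min 0 a * (b - a) \<le> (min 0 b)\<^sup>2 / 2 - (min 0 a)\<^sup>2 / 2" for a b :: real
      using zero_le_power2[of "a - b"] zero_le_power2[of a] mult_nonpos_nonneg[of a b]
      by (auto simp: min_def power2_eq_square algebra_simps)
    show "(\<lambda>x::real. (min 0 x)\<^sup>2 / 2) \<in> borel_measurable borel" by measurable
    show "min 0 \<in> borel_measurable (borel :: real measure)" by measurable
  qed (use t in auto)
  also have "(\<integral>x. (min 0 (u 0 x))\<^sup>2 / 2 \<partial>lborel) = 0"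
    using 0 by (intro integral_eq_zero_AE) (auto elim: eventually_mono)
  finally have "L2_inner (\<lambda>x. min 0 (u t x)) (\<lambda>x. min 0 (u t x)) \<le> 0"
    by (simp add: L2_inner_def power2_eq_square)
  moreover have "(\<lambda>x. min 0 (u t x)) \<in> Lp_space 2"
    using flow_borel[OF u t] by (intro L2_dominated[OF flow_L2[OF u t], of _ 1]) auto
  ultimately have "AE x in lborel. min 0 (u t x) = 0" by (rule L2_norm_zero_AE[rotated])
  then show ?thesis by eventually_elim (auto simp: min_def split: if_splits)
qed

text \<open>The same argument for the squared excess over \<open>M\<close>; with
  \<open>0 \<le> M\<close> this convex function and its derivative vanish at 0, as decay
  requires.\<close>

lemma flow_le_const:
  assumes u: "flow u" and 0: "AE x in lborel. u 0 x \<le> M" and M: "0 \<le> M" and t: "0 \<le> t"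
  shows "AE x in lborel. u t x \<le> M"
proof -
  have "(\<integral>x. (max 0 (u t x - M))\<^sup>2 / 2 \<partial>lborel) \<le> (\<integral>x. (max 0 (u 0 x - M))\<^sup>2 / 2 \<partial>lborel)"
  proof (rule flow_decay[OF u, of UNIV _ "\<lambda>x. max 0 (x - M)" 1])
    show "max 0 (a - M) * (b - a) \<le> (max 0 (b - M))\<^sup>2 / 2 - (max 0 (a - M))\<^sup>2 / 2" for a b :: real
    proof -
      have *: "max 0 c * (d - c) \<le> (max 0 d)\<^sup>2 / 2 - (max 0 c)\<^sup>2 / 2" for c d :: real
      proof -
        have "0 \<le> c * c" "2 * (c * d) \<le> c * c + d * d" "0 \<le> c \<Longrightarrow> d < 0 \<Longrightarrow> c * d \<le> 0"
          using sum_squares_bound[of c d] mult_nonneg_nonpos[of c d]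
          by (auto simp: power2_eq_square)
        then show ?thesis
          by (auto simp: max_def power2_eq_square right_diff_distrib;
              use \<open>0 \<le> c * c\<close> in linarith)
      qed
      show ?thesis using *[of "a - M" "b - M"] by simp
    qed
    show "(\<lambda>x. (max 0 (x - M))\<^sup>2 / 2) \<in> borel_measurable borel" by measurable
    show "(\<lambda>x. max 0 (x - M)) \<in> borel_measurable borel" by measurable
  qed (use t M in auto)
  also have "(\<integral>x. (max 0 (u 0 x - M))\<^sup>2 / 2 \<partial>lborel) = 0"
    using 0 by (intro integral_eq_zero_AE) (auto elim!: eventually_mono)
  finally have "L2_inner (\<lambda>x. max 0 (u t x - M)) (\<lambda>x. max 0 (u t x - M)) \<le> 0"
    by (simp add: L2_inner_def power2_eq_square)
  moreover have "(\<lambda>x. max 0 (u t x - M)) \<in> Lp_space 2"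
    using flow_borel[OF u t] M by (intro L2_dominated[OF flow_L2[OF u t], of _ 1]) auto
  ultimately have "AE x in lborel. max 0 (u t x - M) = 0" by (rule L2_norm_zero_AE[rotated])
  then show ?thesis by eventually_elim (auto simp: max_def split: if_splits)
qed

end

section \<open>The semigroup\<close>

lemma L2_tendsto_mono: "L2_tendsto u f F \<Longrightarrow> F' \<le> F \<Longrightarrow> L2_tendsto u f F'"
  using L2_tendsto_compose[of u f F "\<lambda>x. x" F'] by (simp add: filterlim_def)

text \<open>The constant 1 is not in \<open>L\<^sup>2\<close>, but indicators of balls are; monotone
  convergence removes them after a duality argument.\<close>

lemma nn_integral_ball_bound:
  fixes g :: "real^'n \<Rightarrow> real"
  assumes [measurable]: "g \<in> borel_measurable borel"
    and bound: "\<And>n. (\<integral>\<^sup>+x. ennreal (g x * indicator (ball 0 (real n)) x) \<partial>lborel) \<le> C"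
  shows "(\<integral>\<^sup>+x. ennreal (g x) \<partial>lborel) \<le> C"
proof -
  have [measurable]: "ball (0::real^'n) r \<in> sets borel" for r by simp
  let ?f = "\<lambda>n x. ennreal (g x) * indicator (ball 0 (real n)) x"
  have inc: "incseq ?f"
    by (auto simp: incseq_def le_fun_def indicator_def)
  have "(SUP n. ?f n x) = ennreal (g x)" for x
  proof (rule antisym)
    show "(SUP n. ?f n x) \<le> ennreal (g x)" by (rule SUP_least) (auto simp: indicator_def)
    obtain n :: nat where "norm x < real n" using reals_Archimedean2 by blast
    then have "ennreal (g x) = ?f n x" by simp
    also have "\<dots> \<le> (SUP n. ?f n x)" by (rule SUP_upper) simp
    finally show "ennreal (g x) \<le> (SUP n. ?f n x)" .
  qed
  then have "(\<integral>\<^sup>+x. ennreal (g x) \<partial>lborel) = (\<integral>\<^sup>+x. (SUP n. ?f n x) \<partial>lborel)" by simp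
  also have "\<dots> = (SUP n. \<integral>\<^sup>+x. ?f n x \<partial>lborel)"
    by (rule nn_integral_monotone_convergence_SUP[OF inc]) measurable
  also have "\<dots> \<le> C"
  proof (rule SUP_least)
    fix n
    have "?f n x = ennreal (g x * indicator (ball 0 (real n)) x)" for x
      by (simp add: indicator_def)
    then show "(\<integral>\<^sup>+x. ?f n x \<partial>lborel) \<le> C" using bound by simp
  qed
  finally show ?thesis .
qed

lemma L2_indicator_ball: "(indicator (ball 0 r) :: real^'n \<Rightarrow> real) \<in> Lp_space 2"
proof -
  have "integrable lborel (indicator (ball 0 r) :: real^'n \<Rightarrow> real)"
    by (intro integrable_real_indicator emeasure_lborel_ball_finite) auto
  moreover have "(indicator (ball 0 r) x :: real)\<^sup>2 = indicator (ball 0 r) x" for x :: "real^'n"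
    by (simp add: indicator_def)
  ultimately show ?thesis by (simp add: Lp_space_2_iff)
qed

locale levy_sg = levy J for J :: "real^'n \<Rightarrow> real^'n \<Rightarrow> real" +
  fixes S :: "real \<Rightarrow> (real^'n \<Rightarrow> real) \<Rightarrow> (real^'n \<Rightarrow> real)"
  assumes semigroup: "levy_semigroup J S"
begin

lemma S_flow: "f \<in> Lp_space 2 \<Longrightarrow> flow (\<lambda>t. S t f)"
  using semigroup levy_solution_flow by (auto simp: levy_semigroup_def)

lemma S_0: "f \<in> Lp_space 2 \<Longrightarrow> AE x in lborel. S 0 f x = f x"
  using semigroup by (auto simp: levy_semigroup_def levy_solution_def)

lemma S_L2: "f \<in> Lp_space 2 \<Longrightarrow> 0 \<le> t \<Longrightarrow> S t f \<in> Lp_space 2"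
  by (rule flow_L2[OF S_flow])

lemma S_borel: "f \<in> Lp_space 2 \<Longrightarrow> 0 \<le> t \<Longrightarrow> S t f \<in> borel_measurable lborel"
  by (rule L2_borel[OF S_L2])

lemma S_space: "f \<in> Lp_space 2 \<Longrightarrow> 0 < t \<Longrightarrow> S t f \<in> levy_space J"
  using flow_space[OF S_flow] by simp

lemma S_unique:
  assumes "flow u" "f \<in> Lp_space 2" "AE x in lborel. u 0 x = f x" "0 \<le> t"
  shows "AE x in lborel. u t x = S t f x"
  using assms(3) S_0[OF assms(2)]
  by (intro flow_unique[OF assms(1) S_flow[OF assms(2)] _ assms(4)]) (auto elim: AE_mp)

lemma S_add:
  assumes f: "f \<in> Lp_space 2" and g: "g \<in> Lp_space 2" and t: "0 \<le> t"
  shows "AE x in lborel. S t (\<lambda>x. f x + g x) x = S t f x + S t g x"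
proof -
  have "AE x in lborel. S 0 f x + S 0 g x = f x + g x"
    using S_0[OF f] S_0[OF g] by eventually_elim simp
  from S_unique[OF flow_add[OF S_flow[OF f] S_flow[OF g]] L2_add[OF f g] this t]
  show ?thesis by eventually_elim simp
qed

lemma S_scale:
  assumes f: "f \<in> Lp_space 2" and t: "0 \<le> t"
  shows "AE x in lborel. S t (\<lambda>x. c * f x) x = c * S t f x"
proof -
  have "AE x in lborel. c * S 0 f x = c * f x"
    using S_0[OF f] by eventually_elim simp
  from S_unique[OF flow_scale[OF S_flow[OF f]] L2_scale[OF f] this t]
  show ?thesis by eventually_elim simp
qed

lemma S_diff:
  assumes f: "f \<in> Lp_space 2" and g: "g \<in> Lp_space 2" and t: "0 \<le> t"
  shows "AE x in lborel. S t (\<lambda>x. f x - g x) x = S t f x - S t g x"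
proof -
  have "AE x in lborel. S 0 f x - S 0 g x = f x - g x"
    using S_0[OF f] S_0[OF g] by eventually_elim simp
  from S_unique[OF flow_diff[OF S_flow[OF f] S_flow[OF g]] L2_diff[OF f g] this t]
  show ?thesis by eventually_elim simp
qed

lemma S_semigroup:
  assumes f: "f \<in> Lp_space 2" and "0 \<le> s" "0 \<le> t"
  shows "AE x in lborel. S t (S s f) x = S (t + s) f x"
proof -
  have "AE x in lborel. S (t + s) f x = S t (S s f) x"
    using S_unique[OF flow_shift[OF S_flow[OF f] assms(2)] S_L2[OF f assms(2)] _ assms(3)] by simp
  then show ?thesis by eventually_elim simp
qed

lemma S_nonneg:
  assumes f: "f \<in> Lp_space 2" and "AE x in lborel. 0 \<le> f x" and t: "0 \<le> t"
  shows "AE x in lborel. 0 \<le> S t f x"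
proof (rule flow_nonneg[OF S_flow[OF f] _ t])
  show "AE x in lborel. 0 \<le> S 0 f x"
    using assms(2) S_0[OF f] by eventually_elim simp
qed

lemma S_mono:
  assumes f: "f \<in> Lp_space 2" and g: "g \<in> Lp_space 2" and le: "AE x in lborel. f x \<le> g x"
    and t: "0 \<le> t"
  shows "AE x in lborel. S t f x \<le> S t g x"
proof -
  have "AE x in lborel. 0 \<le> S t (\<lambda>x. g x - f x) x"
    using le by (intro S_nonneg L2_diff f g t) auto
  then show ?thesis using S_diff[OF g f t] by eventually_elim simp
qed

lemma S_abs_le:
  assumes f: "f \<in> Lp_space 2" and t: "0 \<le> t"
  shows "AE x in lborel. \<bar>S t f x\<bar> \<le> S t (\<lambda>x. \<bar>f x\<bar>) x"
proof -
  have "AE x in lborel. S t f x \<le> S t (\<lambda>x. \<bar>f x\<bar>) x"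
    by (intro S_mono f L2_abs t) auto
  moreover have "AE x in lborel. S t (\<lambda>x. -1 * f x) x \<le> S t (\<lambda>x. \<bar>f x\<bar>) x"
    by (intro S_mono f L2_abs L2_scale t) (auto simp: abs_ge_minus_self)
  ultimately show ?thesis using S_scale[OF f t, of "-1"] by eventually_elim simp
qed

lemma S_le_const:
  assumes f: "f \<in> Lp_space 2" and le: "AE x in lborel. f x \<le> M" and "0 \<le> M" "0 \<le> t"
  shows "AE x in lborel. S t f x \<le> M"
proof (rule flow_le_const[OF S_flow[OF f] _ assms(3,4)])
  show "AE x in lborel. S 0 f x \<le> M"
    using assms(2) S_0[OF f] by eventually_elim simp
qed

text \<open>\<open>Z\<close> moves from one side of the identity to the other. The first factor
  contributes \<open>- levy_form\<close>, the second, which runs backwards in time, contributes the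
  same value with the opposite sign, so \<open>Z\<close> is constant.\<close>

lemma S_symmetric:
  assumes f: "f \<in> Lp_space 2" and g: "g \<in> Lp_space 2" and t: "0 \<le> t"
  shows "L2_inner (S t f) g = L2_inner f (S t g)"
proof -
  define Z where "Z = (\<lambda>s. L2_inner (S s f) (S (t - s) g))"
  have Z0: "Z 0 = L2_inner f (S t g)"
    unfolding Z_def using S_0[OF f] S_borel[OF f] S_borel[OF g t] L2_borel[OF f]
    by (intro L2_inner_cong_AE) auto
  have Zt: "Z t = L2_inner (S t f) g"
    unfolding Z_def using S_0[OF g] S_borel[OF g] S_borel[OF f t] L2_borel[OF g]
    by (intro L2_inner_cong_AE) auto
  have "Z t = Z 0" if "0 < t"
  proof (rule DERIV_isconst_end[OF that])
    show "continuous_on {0..t} Z"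
      unfolding continuous_on_def Z_def
    proof (intro ballI L2_tendsto_inner)
      fix s assume s: "s \<in> {0..t}"
      show "L2_tendsto (\<lambda>s. S s f) (S s f) (at s within {0..t})"
        using s by (intro L2_tendsto_mono[OF flow_tendsto0[OF S_flow[OF f]] at_le]) auto
      show "L2_tendsto (\<lambda>s. S (t - s) g) (S (t - s) g) (at s within {0..t})"
      proof (rule L2_tendsto_compose)
        show "L2_tendsto (\<lambda>s. S s g) (S (t - s) g) (at (t - s) within {0..})"
          using s flow_tendsto0[OF S_flow[OF g], of "t - s"] by simp
        show "filterlim (\<lambda>s. t - s) (at (t - s) within {0..}) (at s within {0..t})"
          unfolding filterlim_at by (auto simp: eventually_at_filter intro!: tendsto_intros)
      qed
    qed
  next
    fix s :: real assume s: "0 < s" "s < t"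
    then have ts: "0 < t - s" by simp
    obtain v1 where v1: "v1 \<in> Lp_space 2" "L2_tendsto (\<lambda>r x. (S r f x - S s f x) / (r - s)) v1 (at s)"
      "\<And>g. g \<in> levy_space J \<Longrightarrow> L2_inner v1 g = - levy_form J (S s f) g"
      using flow_deriv[OF S_flow[OF f] s(1)] by blast
    obtain v2 where v2: "v2 \<in> Lp_space 2"
      "L2_tendsto (\<lambda>r x. (S r g x - S (t - s) g x) / (r - (t - s))) v2 (at (t - s))"
      "\<And>h. h \<in> levy_space J \<Longrightarrow> L2_inner v2 h = - levy_form J (S (t - s) g) h"
      using flow_deriv[OF S_flow[OF g] ts] by blast
    have lim: "filterlim (\<lambda>r. t - r) (at (t - s)) (at s)"
      unfolding filterlim_at by (auto simp: eventually_at_filter intro!: tendsto_intros)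
    have "L2_tendsto (\<lambda>r x. -1 * ((S (t - r) g x - S (t - s) g x) / ((t - r) - (t - s))))
        (\<lambda>x. -1 * v2 x) (at s)"
      using L2_tendsto_scale[OF L2_tendsto_compose[OF v2(2) lim]] .
    moreover have "-1 * ((S (t - r) g x - S (t - s) g x) / ((t - r) - (t - s))) =
        (S (t - r) g x - S (t - s) g x) / (r - s)" for r x
    proof -
      have "t - r - (t - s) = - (r - s)" by simp
      then show ?thesis by (simp only: divide_minus_right)
    qed
    ultimately have q2: "L2_tendsto (\<lambda>r x. (S (t - r) g x - S (t - s) g x) / (r - s))
        (\<lambda>x. -1 * v2 x) (at s)" by simp
    have "(Z has_real_derivative
        (L2_inner v1 (S (t - s) g) + L2_inner (S s f) (\<lambda>x. -1 * v2 x))) (at s)"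
      unfolding Z_def
    proof (rule L2_has_derivative_inner[OF _ _ v1(2) q2])
      show "L2_tendsto (\<lambda>s. S s f) (S s f) (at s)" using flow_tendsto[OF S_flow[OF f] s(1)] .
      show "L2_tendsto (\<lambda>s. S (t - s) g) (S (t - s) g) (at s)"
        using L2_tendsto_compose[OF flow_tendsto[OF S_flow[OF g] ts] lim] .
    qed
    moreover have "L2_inner v1 (S (t - s) g) + L2_inner (S s f) (\<lambda>x. -1 * v2 x) = 0"
      using v1(3)[OF S_space[OF g ts]] v2(3)[OF S_space[OF f s(1)]]
        L2_inner_commute[of v2 "S s f"] levy_form_commute[of "S s f" "S (t - s) g"]
      by (simp only: L2_inner_scale_right)
    ultimately show "(Z has_real_derivative 0) (at s)" by simp
  qed
  then show ?thesis using Z0 Zt t by (cases "t = 0") auto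
qed

lemma S_inner_half:
  assumes f: "f \<in> Lp_space 2" and t: "0 \<le> t"
  shows "L2_inner (S t f) f = L2_inner (S (t / 2) f) (S (t / 2) f)"
proof -
  have t2: "0 \<le> t / 2" using t by simp
  have "L2_inner (S t f) f = L2_inner (S (t / 2) (S (t / 2) f)) f"
    using S_semigroup[OF f t2 t2] S_borel[OF f t] S_borel[OF S_L2[OF f t2] t2] L2_borel[OF f]
    by (intro L2_inner_cong_AE) auto
  also have "\<dots> = L2_inner (S (t / 2) f) (S (t / 2) f)"
    by (rule S_symmetric[OF S_L2[OF f t2] f t2])
  finally show ?thesis .
qed

section \<open>Behaviour for small times, injectivity and integrability\<close>

lemma S_tendsto_0:
  assumes f: "f \<in> Lp_space 2"
  shows "L2_tendsto (\<lambda>t. S t f) f (at 0 within {0..})"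
proof (rule L2_tendsto_cong_AE[OF flow_tendsto0[OF S_flow[OF f], of 0]])
  have "\<forall>\<^sub>F s in at 0 within {0::real..}. s \<in> {0..}" by (auto simp: eventually_at_filter)
  then show "\<forall>\<^sub>F s in at 0 within {0..}. S s f \<in> borel_measurable lborel \<and> (AE x in lborel. S s f x = S s f x)"
    by eventually_elim (use S_borel[OF f] in auto)
  show "AE x in lborel. f x = S 0 f x" using S_0[OF f] by eventually_elim simp
qed (use L2_borel[OF f] in auto)

lemma S_tendsto_dyadic:
  assumes f: "f \<in> Lp_space 2" and t: "0 < t"
  shows "L2_tendsto (\<lambda>n. S (t / 2 ^ n) f) f sequentially"
proof (rule L2_tendsto_compose[OF S_tendsto_0[OF f]])
  have "(\<lambda>n. t * (1 / 2) ^ n) \<longlonglongrightarrow> t * 0"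
    by (intro tendsto_intros LIMSEQ_power_zero) simp
  then have "(\<lambda>n. t / 2 ^ n) \<longlonglongrightarrow> 0" by (simp add: power_divide)
  then show "filterlim (\<lambda>n. t / 2 ^ n) (at 0 within {0..}) sequentially"
    unfolding filterlim_at using t by auto
qed

text \<open>If \<open>S t f\<close> vanishes then so does <S t f, f>, which is the squared norm of
  \<open>S (t / 2) f\<close>. Repeated halving drives the time to 0, where strong continuity returns
  \<open>f\<close>.\<close>

lemma S_injective:
  assumes f: "f \<in> Lp_space 2" and t: "0 \<le> t" and 0: "AE x in lborel. S t f x = 0"
  shows "AE x in lborel. f x = 0"
proof (cases "t = 0")
  case True
  then show ?thesis using 0 S_0[OF f] by (auto elim: AE_mp)
next
  case False
  then have t: "0 < t" using t by simp
  have inner0: "L2_inner g w = 0" if "AE x in lborel. g x = 0" "g \<in> Lp_space 2" "w \<in> Lp_space 2"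
    for g w :: "real^'n \<Rightarrow> real"
  proof -
    have "L2_inner g w = L2_inner (\<lambda>x. 0) w"
      using L2_borel[OF that(2)] L2_borel[OF that(3)] by (intro L2_inner_cong_AE that(1)) auto
    then show ?thesis by (simp add: L2_inner_def)
  qed
  have "AE x in lborel. S (t / 2 ^ n) f x = 0" for n
  proof (induction n)
    case (Suc n)
    have nn: "0 \<le> t / 2 ^ n" "0 \<le> t / 2 ^ Suc n" using t by auto
    have "L2_inner (S (t / 2 ^ n) f) f = 0" by (rule inner0[OF Suc S_L2[OF f nn(1)] f])
    then have "L2_inner (S (t / 2 ^ Suc n) f) (S (t / 2 ^ Suc n) f) \<le> 0"
      using S_inner_half[OF f nn(1)] by (simp add: mult.commute)
    then show ?case by (rule L2_norm_zero_AE[OF S_L2[OF f nn(2)]])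
  qed (use 0 in auto)
  then have "L2_inner (S (t / 2 ^ n) f) f = 0" for n
    using S_L2[OF f, of "t / 2 ^ n"] t by (intro inner0 f) auto
  moreover have "(\<lambda>n. L2_inner (S (t / 2 ^ n) f) f) \<longlonglongrightarrow> L2_inner f f"
    by (intro L2_tendsto_inner S_tendsto_dyadic f t L2_tendsto_const)
  ultimately have "L2_inner f f = 0" by (simp add: LIMSEQ_const_iff)
  then show ?thesis using L2_norm_zero_AE[OF f] by simp
qed

text \<open>With \<open>\<phi> t = \<langle>S t f, f\<rangle>\<close> and \<open>\<phi> (2 t) = \<parallel>S t f\<parallel>\<^sup>2\<close>, the form inequality
  \<open>2 \<E>(u, f) \<le> \<E>(u, u) + \<E>(f, f)\<close> says that \<open>\<phi> t - \<phi> (2 t) / 4 + t \<E>(f, f) / 2\<close> is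
  nondecreasing. Iterating the resulting estimate over \<open>2\<^sup>n h\<close> removes the loss.\<close>

lemma S_inner_lower_bound:
  assumes f: "f \<in> levy_space J" and h: "0 \<le> h"
  shows "L2_inner f f - h * levy_form J f f \<le> L2_inner (S h f) f"
proof -
  have fL: "f \<in> Lp_space 2" using f by (rule levy_space_L2)
  let ?E = "levy_form J f f"
  define \<phi> where "\<phi> = (\<lambda>t. L2_inner (S t f) f)"
  define D where "D = (\<lambda>t. \<phi> t - L2_inner (S t f) (S t f) / 4 + t * ?E / 2)"
  have tends: "L2_tendsto (\<lambda>t. S t f) (S t f) (at t within {0..})" if "0 \<le> t" for t
    using flow_tendsto0[OF S_flow[OF fL] that] .
  have \<phi>0: "\<phi> 0 = L2_inner f f"
    unfolding \<phi>_def using S_0[OF fL] S_borel[OF fL, of 0] L2_borel[OF fL]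
    by (intro L2_inner_cong_AE) auto
  have \<phi>2: "L2_inner (S t f) (S t f) = \<phi> (2 * t)" if "0 \<le> t" for t
    using S_inner_half[OF fL, of "2 * t"] that by (simp add: \<phi>_def)
  have step: "\<phi> 0 - \<phi> r \<le> (\<phi> 0 - \<phi> (2 * r)) / 4 + r * ?E / 2" if r: "0 \<le> r" for r
  proof -
    have "D 0 \<le> D r"
    proof (rule DERIV_nonneg_imp_increasing_open[OF r])
      fix t assume t: "0 < t" "t < r"
      obtain v where v: "v \<in> Lp_space 2" "L2_tendsto (\<lambda>s x. (S s f x - S t f x) / (s - t)) v (at t)"
        "\<And>g. g \<in> levy_space J \<Longrightarrow> L2_inner v g = - levy_form J (S t f) g"
        using flow_deriv[OF S_flow[OF fL] t(1)] by blast
      have St: "L2_tendsto (\<lambda>t. S t f) (S t f) (at t)" using flow_tendsto[OF S_flow[OF fL] t(1)] .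
      have c0: "L2_tendsto (\<lambda>s x. (f x - f x) / (s - t)) (\<lambda>x. 0) (at t)"
        using L2_tendsto_const[of "\<lambda>x. 0"] by (simp add: Lp_space_2_iff)
      have d1: "(\<phi> has_real_derivative L2_inner v f + L2_inner (S t f) (\<lambda>x. 0)) (at t)"
        unfolding \<phi>_def
        by (rule L2_has_derivative_inner[of "\<lambda>t. S t f" t UNIV "\<lambda>_. f", OF St L2_tendsto_const[OF fL] v(2) c0])
      have d2: "((\<lambda>t. L2_inner (S t f) (S t f)) has_real_derivative
          L2_inner v (S t f) + L2_inner (S t f) v) (at t)"
        by (rule L2_has_derivative_inner[OF St St v(2) v(2)])
      have Sp: "S t f \<in> levy_space J" using S_space[OF fL t(1)] .
      have "(D has_real_derivative (L2_inner v f + L2_inner (S t f) (\<lambda>x. 0))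
          - (L2_inner v (S t f) + L2_inner (S t f) v) / 4 + 1 * ?E / 2) (at t)"
        unfolding D_def
        by (intro DERIV_add DERIV_diff d1 DERIV_cdivide d2 DERIV_cmult_right DERIV_ident)
      moreover have "0 \<le> (L2_inner v f + L2_inner (S t f) (\<lambda>x. 0))
          - (L2_inner v (S t f) + L2_inner (S t f) v) / 4 + 1 * ?E / 2"
      proof -
        have "L2_inner (S t f) v = L2_inner v (S t f)" by (rule L2_inner_commute)
        moreover have "L2_inner (S t f) (\<lambda>x. 0) = 0" by (simp add: L2_inner_def)
        ultimately show ?thesis
          using levy_form_le_AM[OF Sp f] v(3)[OF f] v(3)[OF Sp] by simp
      qed
      ultimately show "\<exists>y. (D has_real_derivative y) (at t) \<and> 0 \<le> y" by blast
    next
      show "continuous_on {0..r} D"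
        unfolding continuous_on_def D_def \<phi>_def
        by (intro ballI tendsto_intros L2_tendsto_inner L2_tendsto_const fL L2_tendsto_mono[OF tends at_le])
          auto
    qed
    then show ?thesis using \<phi>2[of 0] \<phi>2[OF r] by (simp add: D_def field_simps)
  qed
  \<comment> \<open>Subtracting the linear term absorbs the energy: \<open>step\<close> becomes
    \<open>a r \<le> a (2 * r) / 4\<close> without remainder. Since \<open>a\<close> is bounded
    above by \<open>\<phi> 0\<close>, the factors 1/4 force \<open>a h \<le> 0\<close>.\<close>
  define a where "a = (\<lambda>r. \<phi> 0 - \<phi> r - r * ?E)"
  have a: "a r \<le> a (2 * r) / 4" if "0 \<le> r" for r
    using step[OF that] by (simp add: a_def field_simps)
  have iter: "a h \<le> a (2 ^ n * h) / 4 ^ n" for n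
  proof (induction n)
    case (Suc n)
    have "a (2 ^ n * h) / 4 ^ n \<le> (a (2 * (2 ^ n * h)) / 4) / 4 ^ n"
      using a[of "2 ^ n * h"] h by (intro divide_right_mono) auto
    then show ?case using Suc by (simp add: mult.assoc)
  qed simp
  have "a r \<le> \<phi> 0" if "0 \<le> r" for r
    using \<phi>2[of "r / 2"] that L2_inner_self_nonneg[of "S (r / 2) f"]
      mult_nonneg_nonneg[OF that levy_form_self_nonneg[of f]]
    by (simp add: a_def)
  then have "a h \<le> \<phi> 0 / 4 ^ n" for n
    using iter[of n] h by (meson divide_right_mono mult_nonneg_nonneg order_trans zero_le_numeral zero_le_power)
  then have bd: "a h \<le> \<phi> 0 * (1 / 4) ^ n" for n by (simp add: power_divide)
  have "(\<lambda>n. \<phi> 0 * (1 / 4) ^ n) \<longlonglongrightarrow> \<phi> 0 * 0"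
    by (intro tendsto_intros LIMSEQ_power_zero) simp
  then have "a h \<le> \<phi> 0 * 0" using bd by (intro LIMSEQ_le_const) auto
  then show ?thesis by (simp add: a_def \<phi>0) (simp add: \<phi>_def)
qed

text \<open>Duality with the bound by constants: testing \<open>S t f\<close> against the indicator
  of a ball moves the semigroup onto the indicator, where it stays below 1.\<close>

lemma S_integrable:
  assumes f: "f \<in> Lp_space 2" and int: "integrable lborel f" and nonneg: "AE x in lborel. 0 \<le> f x"
    and t: "0 \<le> t"
  shows "integrable lborel (S t f)"
proof -
  note [measurable] = S_borel[OF f t]
  have S0: "AE x in lborel. 0 \<le> S t f x" by (rule S_nonneg[OF f nonneg t])
  have "(\<integral>\<^sup>+x. ennreal (S t f x) \<partial>lborel) \<le> ennreal (\<integral>x. f x \<partial>lborel)"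
  proof (rule nn_integral_ball_bound)
    show "S t f \<in> borel_measurable borel" using S_borel[OF f t] by simp
    fix n :: nat
    let ?g = "indicator (ball 0 (real n)) :: real^'n \<Rightarrow> real"
    have g: "?g \<in> Lp_space 2" by (rule L2_indicator_ball)
    have g1: "AE x in lborel. S t ?g x \<le> 1" by (rule S_le_const[OF g _ _ t]) (auto simp: indicator_def)
    have "(\<integral>\<^sup>+x. ennreal (S t f x * ?g x) \<partial>lborel) = ennreal (L2_inner (S t f) ?g)"
      unfolding L2_inner_def
      using S0 by (intro nn_integral_eq_integral L2_integrable_mult S_L2 f g t) (auto elim: eventually_mono)
    also have "L2_inner (S t f) ?g = L2_inner f (S t ?g)" by (rule S_symmetric[OF f g t])
    also have "\<dots> \<le> (\<integral>x. f x \<partial>lborel)"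
      unfolding L2_inner_def
    proof (rule integral_mono_AE[OF L2_integrable_mult[OF f S_L2[OF g t]] int])
      show "AE x in lborel. f x * S t ?g x \<le> f x"
        using nonneg g1 by eventually_elim (simp add: mult_left_le)
    qed
    finally show "(\<integral>\<^sup>+x. ennreal (S t f x * ?g x) \<partial>lborel) \<le> ennreal (\<integral>x. f x \<partial>lborel)"
      by (simp add: ennreal_leI)
  qed
  then have "(\<integral>\<^sup>+x. ennreal (S t f x) \<partial>lborel) < \<infinity>"
    using ennreal_less_top order_le_less_trans by fastforce
  moreover have "(\<integral>\<^sup>+x. ennreal (norm (S t f x)) \<partial>lborel) = (\<integral>\<^sup>+x. ennreal (S t f x) \<partial>lborel)"
    using S0 by (intro nn_integral_cong_AE) (auto elim: eventually_mono)
  ultimately show ?thesis using S_borel[OF f t] by (simp add: integrable_iff_bounded)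
qed

end

section \<open>From smoothing to the logarithmic Sobolev inequality\<close>

lemma Lp_norm_2_powr: "0 < a \<Longrightarrow> Lp_norm 2 f powr a = (\<integral>x. (f x)\<^sup>2 \<partial>lborel) powr (a / 2)"
  by (simp add: Lp_norm_2 powr_half_sqrt[symmetric] powr_powr)

text \<open>A class stable under powers with exponent at least 1. The bounds hold at every point, so
  inequalities between powers need no exceptional sets.\<close>

definition bounded_L2 :: "((real^'n) \<Rightarrow> real) set" where
  "bounded_L2 = {f \<in> Lp_space 2. \<exists>M. \<forall>x. 0 \<le> f x \<and> f x \<le> M}"

lemma bounded_L2_L2: "f \<in> bounded_L2 \<Longrightarrow> f \<in> Lp_space 2"
  by (simp add: bounded_L2_def)

lemma bounded_L2_nonneg: "f \<in> bounded_L2 \<Longrightarrow> 0 \<le> f x"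
  by (auto simp: bounded_L2_def)

lemma bounded_L2_powr_L2:
  assumes f: "f \<in> bounded_L2" and a: "1 \<le> a"
  shows "(\<lambda>x. f x powr a) \<in> Lp_space 2"
proof -
  obtain M where M: "\<And>x. 0 \<le> f x \<and> f x \<le> M" using f by (auto simp: bounded_L2_def)
  note [measurable] = L2_borel[OF bounded_L2_L2[OF f]]
  show ?thesis
  proof (rule L2_dominated[OF bounded_L2_L2[OF f], of _ "M powr (a - 1)"])
    show "(\<lambda>x. f x powr a) \<in> borel_measurable lborel" by measurable
    have "f x powr a \<le> M powr (a - 1) * f x" for x
    proof -
      have "f x powr a = f x powr (a - 1) * f x powr 1" by (simp only: powr_add[symmetric]) simp
      also have "\<dots> \<le> M powr (a - 1) * f x" using M[of x] a by (auto intro!: mult_right_mono powr_mono2)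
      finally show ?thesis .
    qed
    then show "AE x in lborel. \<bar>f x powr a\<bar> \<le> M powr (a - 1) * \<bar>f x\<bar>"
      using M by auto
  qed
qed

text \<open>From \<open>ln y \<le> y\<close> at y = sqrt x or y = 1 / sqrt x: the logarithm is at
  most 2 sqrt x or 2 / sqrt x in absolute value. A right-hand side linear in \<open>x\<close> is
  what turns an integrable \<open>f\<close> into a square-integrable \<open>f ln f\<close>.\<close>

lemma x_ln_x_bound:
  fixes x :: real
  assumes "0 \<le> x" "x \<le> M"
  shows "(x * ln x)\<^sup>2 \<le> (4 + 4 * M\<^sup>2) * x"
proof (cases "x = 0")
  case False
  then have x: "0 < x" using assms by simp
  have s: "0 < sqrt x" "sqrt x * sqrt x = x" using x by auto
  have ln: "ln x = 2 * ln (sqrt x)" using x by (simp add: ln_sqrt)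
  show ?thesis
  proof (cases "1 \<le> x")
    case True
    have "ln x \<le> 2 * sqrt x" using ln_bound[OF s(1)] ln by simp
    then have "(ln x)\<^sup>2 \<le> (2 * sqrt x)\<^sup>2" using True by (intro power_mono) auto
    then have "x\<^sup>2 * (ln x)\<^sup>2 \<le> x\<^sup>2 * (4 * x)" using s by (intro mult_left_mono) (auto simp: power_mult_distrib)
    also have "\<dots> \<le> M\<^sup>2 * (4 * x)" using assms x by (intro mult_right_mono power_mono) auto
    also have "\<dots> \<le> (4 + 4 * M\<^sup>2) * x" using x by (simp add: algebra_simps)
    finally show ?thesis by (simp add: power_mult_distrib)
  next
    case False
    have "- ln x = 2 * ln (1 / sqrt x)" using s by (simp add: ln ln_div)
    also have "\<dots> \<le> 2 * (1 / sqrt x)" using ln_bound[of "1 / sqrt x"] s by simp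
    finally have "(- ln x)\<^sup>2 \<le> (2 * (1 / sqrt x))\<^sup>2"
      using False x by (intro power_mono) auto
    then have "x\<^sup>2 * (ln x)\<^sup>2 \<le> x\<^sup>2 * (4 / x)"
      using x by (intro mult_left_mono) (auto simp: power_mult_distrib power_divide)
    also have "\<dots> = 4 * x" using x by (simp add: power2_eq_square)
    also have "\<dots> \<le> (4 + 4 * M\<^sup>2) * x" using x by (simp add: algebra_simps)
    finally show ?thesis by (simp add: power_mult_distrib)
  qed
qed simp

lemma x_ln_x_L2:
  assumes f: "f \<in> bounded_L2" "integrable lborel f"
  shows "(\<lambda>x. f x * ln (f x)) \<in> Lp_space 2"
proof -
  obtain M where M: "\<And>x. 0 \<le> f x \<and> f x \<le> M" using f by (auto simp: bounded_L2_def)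
  note [measurable] = L2_borel[OF bounded_L2_L2[OF f(1)]]
  have "integrable lborel (\<lambda>x. (f x * ln (f x))\<^sup>2)"
  proof (rule Bochner_Integration.integrable_bound)
    show "integrable lborel (\<lambda>x. (4 + 4 * M\<^sup>2) * f x)" using f by simp
    show "AE x in lborel. norm ((f x * ln (f x))\<^sup>2) \<le> norm ((4 + 4 * M\<^sup>2) * f x)"
      using M x_ln_x_bound by (intro AE_I2) (auto intro: order_trans[OF _ abs_ge_self])
  qed measurable
  moreover have "(\<lambda>x. f x * ln (f x)) \<in> borel_measurable lborel" by measurable
  ultimately show ?thesis by (simp add: Lp_space_2_iff)
qed

text \<open>An inequality holding almost everywhere for each weight has one common null set only for
  countably many weights. Right continuity in \<open>l\<close> extends it from the rationals to a
  weight depending on the point.\<close>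

lemma weighted_bound_all_reals:
  fixes z A F :: real
  assumes "\<And>l. l \<in> \<rat> \<Longrightarrow> 0 < l \<Longrightarrow> z \<le> (l * A + F / l) / 2" and l: "0 < l"
  shows "z \<le> (l * A + F / l) / 2"
proof (rule ccontr)
  assume "\<not> ?thesis"
  then have "(l * A + F / l) / 2 < z" by simp
  moreover have "((\<lambda>l. (l * A + F / l) / 2) \<longlongrightarrow> (l * A + F / l) / 2) (at_right l)"
    using l by (intro tendsto_intros) auto
  ultimately have "\<forall>\<^sub>F r in at_right l. (r * A + F / r) / 2 < z"
    by (rule order_tendstoD(2)[rotated])
  then obtain b where b: "l < b" "\<And>r. l < r \<Longrightarrow> r < b \<Longrightarrow> (r * A + F / r) / 2 < z"
    by (auto simp: eventually_at_right[OF less_add_one])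
  obtain r where "r \<in> \<rat>" "l < r" "r < b" using Rats_dense_in_real[OF b(1)] by blast
  then show False using assms(1)[of r] b(2)[of r] l by simp
qed

context levy_sg
begin

text \<open>The positivity-preserving substitute for complex interpolation: \<open>f powr ((1 + a) / 2)\<close> is the
  geometric mean of \<open>f powr a\<close> and \<open>f\<close>, hence the infimum of weighted arithmetic
  means, and the optimal weight may be chosen pointwise after applying the semigroup.\<close>

lemma S_geometric_mean:
  assumes f: "f \<in> bounded_L2" and a: "1 \<le> a" and t: "0 \<le> t"
  shows "L2_inner (S t (\<lambda>x. f x powr ((1 + a) / 2))) (\<lambda>x. f x powr ((1 + a) / 2))
      \<le> L2_inner (S t (\<lambda>x. f x powr a)) f"
proof -
  let ?g = "\<lambda>x. f x powr ((1 + a) / 2)" and ?h = "\<lambda>x. f x powr a"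
  have fL: "f \<in> Lp_space 2" and f0: "\<And>x. 0 \<le> f x" using f by (auto simp: bounded_L2_def)
  have gL: "?g \<in> Lp_space 2" by (rule bounded_L2_powr_L2[OF f]) (use a in simp)
  have hL: "?h \<in> Lp_space 2" by (rule bounded_L2_powr_L2[OF f a])
  have geo: "f x powr ((1 + a) / 2) \<le> l / 2 * f x powr a + 1 / (2 * l) * f x" if l: "0 < l" for l x
  proof -
    have eq: "f x powr ((1 + a) / 2) = (l * f x powr a) powr (1/2) * (f x / l) powr (1/2)"
    proof -
      have "(l * f x powr a) powr (1/2) * (f x / l) powr (1/2) = (f x powr a * f x powr 1) powr (1/2)"
        using l f0[of x] by (simp add: powr_mult[symmetric])
      also have "\<dots> = f x powr ((1 + a) / 2)"
        by (simp only: powr_add[symmetric] powr_powr) (simp add: add.commute)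
      finally show ?thesis by simp
    qed
    have "(l * f x powr a) powr (1/2) * (f x / l) powr (1/2) \<le> (1/2) * (l * f x powr a) + (1/2) * (f x / l)"
    proof (cases "f x = 0")
      case False
      then show ?thesis using l f0[of x] by (intro Youngs_inequality_0) auto
    qed simp
    then show ?thesis unfolding eq by simp
  qed
  have AEq: "AE x in lborel. S t ?g x \<le> (l * S t ?h x + S t f x / l) / 2" if l: "0 < l" for l
  proof -
    have 1: "(\<lambda>x. l / 2 * f x powr a) \<in> Lp_space 2" "(\<lambda>x. 1 / (2 * l) * f x) \<in> Lp_space 2"
      by (intro L2_scale hL fL)+
    have "AE x in lborel. S t ?g x \<le> S t (\<lambda>x. l / 2 * f x powr a + 1 / (2 * l) * f x) x"
      by (intro S_mono gL L2_add 1 t AE_I2 geo l)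
    then show ?thesis
      using S_add[OF 1 t] S_scale[OF hL t, of "l / 2"] S_scale[OF fL t, of "1 / (2 * l)"]
      by eventually_elim (simp add: field_simps)
  qed
  have "AE x in lborel. \<forall>l\<in>{l\<in>\<rat>. 0 < l}. S t ?g x \<le> (l * S t ?h x + S t f x / l) / 2"
    using AEq by (intro AE_ball_countable[THEN iffD2] countable_subset[OF _ countable_rat]) auto
  moreover have "AE x in lborel. 0 \<le> S t ?h x" "AE x in lborel. 0 \<le> S t f x"
    using f0 by (intro S_nonneg hL fL t; simp)+
  ultimately have "AE x in lborel. S t ?g x * ?g x \<le> (S t ?h x * f x + S t f x * ?h x) / 2"
  proof eventually_elim
    case (elim x)
    show ?case
    proof (cases "f x = 0")
      case False
      then have fx: "0 < f x" using f0[of x] by simp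
      \<comment> \<open>For this weight \<open>l * f x powr a\<close> and \<open>f x / l\<close>
        both equal \<open>f x powr ((1 + a) / 2)\<close>, the case of equality between the two
        means.\<close>
      define l where "l = f x powr ((1 - a) / 2)"
      have l: "0 < l" using fx by (simp add: l_def)
      have le: "S t ?g x \<le> (l * S t ?h x + S t f x / l) / 2"
        by (rule weighted_bound_all_reals[OF _ l]) (use elim(1) in auto)
      have "l * ?g x = f x powr 1"
        unfolding l_def powr_add[symmetric] by (simp add: add_divide_distrib[symmetric])
      then have 1: "l * ?g x = f x" using fx by simp
      have "?g x / l = f x powr ((1 + a) / 2 - (1 - a) / 2)" by (simp add: l_def powr_diff)
      then have 2: "?g x / l = ?h x" by (simp add: diff_divide_distrib[symmetric])
      have "S t ?g x * ?g x \<le> (l * S t ?h x + S t f x / l) / 2 * ?g x"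
        by (rule mult_right_mono[OF le]) simp
      also have "\<dots> = (S t ?h x * (l * ?g x) + S t f x * (?g x / l)) / 2"
        by (simp add: algebra_simps)
      finally show ?thesis unfolding 1 2 .
    qed simp
  qed
  then have "L2_inner (S t ?g) ?g \<le> (\<integral>x. (S t ?h x * f x + S t f x * ?h x) / 2 \<partial>lborel)"
    unfolding L2_inner_def
    by (intro integral_mono_AE) (auto intro!: L2_integrable_mult S_L2 gL hL fL t)
  also have "\<dots> = (L2_inner (S t ?h) f + L2_inner (S t f) ?h) / 2"
    by (simp add: L2_inner_def L2_integrable_mult S_L2 hL fL t)
  also have "L2_inner (S t f) ?h = L2_inner (S t ?h) f"
    using S_symmetric[OF fL hL t] L2_inner_commute[of f] by simp
  finally show ?thesis by simp
qed

text \<open>With g = f^a this is ||S t g||_2 <= K ||g||_r for r = 2 / a, on nonnegative functions.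
  Writing it through \<open>f\<close> keeps the norm of \<open>f\<close> fixed while the exponent
  varies.\<close>

definition smoothing :: "real \<Rightarrow> real \<Rightarrow> real \<Rightarrow> bool" where
  "smoothing t a K \<longleftrightarrow> (\<forall>f\<in>bounded_L2.
      Lp_norm 2 (S t (\<lambda>x. f x powr a)) \<le> K * Lp_norm 2 f powr a)"

text \<open>For g = f^((1+a)/2), the square of ||S (t/2) g|| is <S t g, g>, at most <S t (f^a), f>
  by the geometric-mean estimate, hence at most ||S t (f^a)|| ||f||. The hypothesis bounds this by K
  ||f||^(a+1), and the square root halves the exponent of \<open>K\<close>.\<close>

lemma smoothing_half:
  assumes sm: "smoothing t a K" and a: "1 \<le> a" and t: "0 \<le> t" and K: "0 \<le> K"
  shows "smoothing (t / 2) ((1 + a) / 2) (sqrt K)"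
  unfolding smoothing_def
proof
  fix f :: "real^'n \<Rightarrow> real" assume f: "f \<in> bounded_L2"
  let ?g = "\<lambda>x. f x powr ((1 + a) / 2)" and ?h = "\<lambda>x. f x powr a"
  have fL: "f \<in> Lp_space 2" using f by (rule bounded_L2_L2)
  have gL: "?g \<in> Lp_space 2" by (rule bounded_L2_powr_L2[OF f]) (use a in simp)
  have hL: "?h \<in> Lp_space 2" by (rule bounded_L2_powr_L2[OF f a])
  have "(Lp_norm 2 (S (t / 2) ?g))\<^sup>2 = L2_inner (S t ?g) ?g"
    unfolding Lp_norm_2_sq by (rule S_inner_half[OF gL t, symmetric])
  also have "\<dots> \<le> L2_inner (S t ?h) f" by (rule S_geometric_mean[OF f a t])
  also have "\<dots> \<le> Lp_norm 2 (S t ?h) * Lp_norm 2 f"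
    using L2_Cauchy_Schwarz[OF S_L2[OF hL t] fL] by linarith
  also have "\<dots> \<le> K * Lp_norm 2 f powr a * Lp_norm 2 f"
    using sm f by (intro mult_right_mono) (auto simp: smoothing_def)
  also have "\<dots> = K * Lp_norm 2 f powr (a + 1)" by (simp add: powr_add)
  also have "\<dots> = (sqrt K * Lp_norm 2 f powr ((1 + a) / 2))\<^sup>2"
  proof -
    have "(Lp_norm 2 f powr ((1 + a) / 2))\<^sup>2 = Lp_norm 2 f powr (a + 1)"
      unfolding power2_eq_square powr_add[symmetric] by (simp add: add.commute)
    then show ?thesis using K by (simp add: power_mult_distrib)
  qed
  finally show "Lp_norm 2 (S (t / 2) ?g) \<le> sqrt K * Lp_norm 2 f powr ((1 + a) / 2)"
    by (rule power2_le_imp_le) (use K in simp)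
qed

lemma smoothing_dyadic:
  assumes sm: "smoothing t (1 + c) K" and c: "0 \<le> c" and t: "0 \<le> t" and K: "0 \<le> K"
  shows "smoothing (t / 2 ^ n) (1 + c / 2 ^ n) (K powr (1 / 2 ^ n))"
proof (induction n)
  case 0
  then show ?case using sm K by simp
next
  case (Suc n)
  have "smoothing (t / 2 ^ n / 2) ((1 + (1 + c / 2 ^ n)) / 2) (sqrt (K powr (1 / 2 ^ n)))"
    using c t K by (intro smoothing_half Suc) auto
  moreover have "sqrt (K powr (1 / 2 ^ n)) = K powr (1 / 2 ^ Suc n)"
    by (simp add: powr_half_sqrt[symmetric] powr_powr mult.commute)
  moreover have "(1 + (1 + c / 2 ^ n)) / 2 = 1 + c / 2 ^ Suc n" by (simp add: field_simps)
  moreover have "t / 2 ^ n / 2 = t / 2 ^ Suc n" by (simp add: field_simps)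
  ultimately show ?case by (simp only:)
qed

text \<open>\<open>main\<close> compares a lower and an upper bound for <S (s t) f, f^(1+sc)> with s
  = 1 / 2^n. Below, f^(1+sc) is replaced by f + sc f ln f, which is legitimate because S f is
  nonnegative, and <S (s t) f, f> by its linear lower bound. Above stand symmetry, Cauchy-Schwarz
  and \<open>smoothing_dyadic\<close>. Both sides agree at s = 0, so their slopes compare.\<close>

lemma entropy_bound_of_smoothing:
  assumes sm: "smoothing t (1 + c) B" and c: "0 < c" and t: "0 < t" and B: "0 \<le> B"
    and f: "f \<in> bounded_L2" "integrable lborel f" "f \<in> levy_space J" and N: "0 < Lp_norm 2 f"
  shows "0 < B"
    and "c * L2_inner f (\<lambda>x. f x * ln (f x))
      \<le> (Lp_norm 2 f)\<^sup>2 * (ln B + c * ln (Lp_norm 2 f)) + t * levy_form J f f"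
proof -
  define N where "N = Lp_norm 2 f"
  define s :: "nat \<Rightarrow> real" where "s = (\<lambda>n. 1 / 2 ^ n)"
  let ?l = "\<lambda>x. f x * ln (f x)" and ?E = "levy_form J f f"
  define X where "X = (\<lambda>n. L2_inner (S (t / 2 ^ n) f) ?l)"
  have N0: "0 < N" using N by (simp add: N_def)
  have fL: "f \<in> Lp_space 2" using f(1) by (rule bounded_L2_L2)
  have f0: "0 \<le> f x" for x using bounded_L2_nonneg[OF f(1)] .
  have lL: "?l \<in> Lp_space 2" by (rule x_ln_x_L2[OF f(1,2)])
  have s0: "0 < s n" for n by (simp add: s_def)
  have "(\<lambda>n. (1 / 2) ^ n) \<longlonglongrightarrow> (0::real)" by (intro LIMSEQ_power_zero) simp
  then have slim: "s \<longlonglongrightarrow> 0" by (simp add: s_def power_divide)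
  have Xlim: "X \<longlonglongrightarrow> L2_inner f ?l"
    unfolding X_def by (intro L2_tendsto_inner S_tendsto_dyadic L2_tendsto_const fL lL t)
  have main: "N\<^sup>2 - s n * t * ?E + s n * c * X n \<le> B powr s n * N powr (2 + s n * c)" for n
  proof -
    let ?t = "t / 2 ^ n" and ?a = "1 + s n * c"
    have t0: "0 \<le> ?t" using t by simp
    have a1: "1 \<le> ?a" using s0[of n] c by simp
    have gL: "(\<lambda>x. f x powr ?a) \<in> Lp_space 2" by (rule bounded_L2_powr_L2[OF f(1) a1])
    have SL: "S ?t f \<in> Lp_space 2" by (rule S_L2[OF fL t0])
    have pt: "f x + s n * c * ?l x \<le> f x powr ?a" for x
    proof (cases "f x = 0")
      case False
      then have fx: "0 < f x" using f0[of x] by simp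
      have "f x * (1 + s n * c * ln (f x)) \<le> f x * exp (s n * c * ln (f x))"
        using fx by (intro mult_left_mono exp_ge_add_one_self) auto
      also have "\<dots> = f x powr ?a" using fx by (simp add: powr_add powr_def[of _ "s n * c"])
      finally show ?thesis by (simp add: algebra_simps)
    qed simp
    have "N\<^sup>2 - s n * t * ?E \<le> L2_inner (S ?t f) f"
      using S_inner_lower_bound[OF f(3) t0] by (simp add: N_def Lp_norm_2_sq s_def)
    then have "N\<^sup>2 - s n * t * ?E + s n * c * X n \<le> L2_inner (S ?t f) f + s n * c * X n" by simp
    also have "\<dots> = L2_inner (S ?t f) (\<lambda>x. f x + (s n * c) * ?l x)"
      unfolding X_def L2_inner_add_right[OF fL L2_scale[OF lL] SL] L2_inner_scale_right ..
    also have "\<dots> \<le> L2_inner (S ?t f) (\<lambda>x. f x powr ?a)"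
      unfolding L2_inner_def
    proof (rule integral_mono_AE)
      have "AE x in lborel. 0 \<le> S ?t f x" using f0 by (intro S_nonneg fL t0) auto
      then show "AE x in lborel. S ?t f x * (f x + s n * c * ?l x) \<le> S ?t f x * f x powr ?a"
        by eventually_elim (intro mult_left_mono pt)
    qed (intro L2_integrable_mult SL gL L2_add fL L2_scale lL)+
    also have "\<dots> = L2_inner f (S ?t (\<lambda>x. f x powr ?a))" by (rule S_symmetric[OF fL gL t0])
    also have "\<dots> \<le> N * Lp_norm 2 (S ?t (\<lambda>x. f x powr ?a))"
      using L2_Cauchy_Schwarz[OF fL S_L2[OF gL t0]] by (simp add: N_def)
    also have "\<dots> \<le> N * (B powr s n * N powr ?a)"
    proof (rule mult_left_mono)
      have "smoothing ?t (1 + c / 2 ^ n) (B powr (1 / 2 ^ n))"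
        using c t B by (intro smoothing_dyadic sm) auto
      then show "Lp_norm 2 (S ?t (\<lambda>x. f x powr ?a)) \<le> B powr s n * N powr ?a"
        using f(1) by (simp add: smoothing_def N_def s_def)
    qed (use N0 in simp)
    also have "\<dots> = B powr s n * N powr (2 + s n * c)"
    proof -
      have "N powr (2 + s n * c) = N powr 1 * N powr ?a" by (simp only: powr_add[symmetric]) simp
      then show ?thesis using N0 by simp
    qed
    finally show ?thesis .
  qed
  \<comment> \<open>For \<open>B = 0\<close> the right side of \<open>main\<close> would vanish
    identically, while the left side tends to \<open>N\<^sup>2\<close>.\<close>
  show B0: "0 < B"
  proof (rule ccontr)
    assume "\<not> 0 < B"
    then have "B = 0" using B by simp
    then have "N\<^sup>2 - s n * t * ?E + s n * c * X n \<le> 0" for n using main[of n] by simp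
    moreover have "(\<lambda>n. N\<^sup>2 - s n * t * ?E + s n * c * X n) \<longlonglongrightarrow> N\<^sup>2 - 0 * t * ?E + 0 * c * L2_inner f ?l"
      by (intro tendsto_intros slim Xlim)
    ultimately have "N\<^sup>2 - 0 * t * ?E + 0 * c * L2_inner f ?l \<le> 0"
      by (intro LIMSEQ_le_const2) auto
    then show False using N0 by simp
  qed
  \<comment> \<open>The right side of \<open>main\<close> is
    \<open>N\<^sup>2 * exp (k * s n)\<close>, so \<open>k\<close> is its logarithmic slope at
    0.\<close>
  define k where "k = ln B + c * ln N"
  have "((\<lambda>h. exp (k * h)) has_real_derivative k) (at 0)"
    by (auto intro!: derivative_eq_intros)
  then have "((\<lambda>h. (exp (k * h) - 1) / h) \<longlongrightarrow> k) (at 0)"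
    by (simp add: has_field_derivative_iff)
  moreover have "filterlim s (at 0) sequentially"
    unfolding filterlim_at using slim s0 by (auto simp: less_imp_neq[symmetric])
  ultimately have elim: "(\<lambda>n. (exp (k * s n) - 1) / s n) \<longlonglongrightarrow> k" by (rule filterlim_compose)
  have quot: "c * X n - t * ?E \<le> N\<^sup>2 * ((exp (k * s n) - 1) / s n)" for n
  proof -
    have "exp (k * s n) = B powr s n * N powr (s n * c)"
      using B0 N0 unfolding k_def powr_def by (simp add: exp_add[symmetric] algebra_simps)
    then have "B powr s n * N powr (2 + s n * c) = N\<^sup>2 * exp (k * s n)"
      using N0 by (simp add: powr_add)
    then have "s n * (c * X n - t * ?E) \<le> N\<^sup>2 * (exp (k * s n) - 1)"
      using main[of n] by (simp add: algebra_simps)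
    then show ?thesis using s0[of n] by (simp add: field_simps)
  qed
  have "c * L2_inner f ?l - t * ?E \<le> N\<^sup>2 * k"
  proof (rule LIMSEQ_le)
    show "(\<lambda>n. c * X n - t * ?E) \<longlonglongrightarrow> c * L2_inner f ?l - t * ?E" by (intro tendsto_intros Xlim)
    show "(\<lambda>n. N\<^sup>2 * ((exp (k * s n) - 1) / s n)) \<longlonglongrightarrow> N\<^sup>2 * k" by (intro tendsto_intros elim)
  qed (use quot in auto)
  then show "c * L2_inner f ?l \<le> (Lp_norm 2 f)\<^sup>2 * (ln B + c * ln (Lp_norm 2 f)) + t * ?E"
    by (simp add: k_def N_def)
qed

text \<open>Duality through S t S t: the square of ||S t g||_2 equals <S t (S t g), g>, and Hoelder
  together with the hypothesis for the initial value S t g leaves one factor ||S t g||_2 to cancel.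
  The exponent 2 - 2/q is 2 divided by the conjugate exponent of \<open>q\<close>, so that g raised
  to the latter is f^2.\<close>

lemma smoothing_of_supercontractive:
  assumes S: "supercontractive_with S B" and q: "2 < q" and t: "0 < t"
  shows "smoothing t (1 + (1 - 2 / q)) (B t q)"
  unfolding smoothing_def
proof
  fix f :: "real^'n \<Rightarrow> real" assume f: "f \<in> bounded_L2"
  let ?a = "1 + (1 - 2 / q)" and ?p = "q / (q - 1)"
  let ?g = "\<lambda>x. f x powr ?a"
  have q': "2 / q \<le> 1" using q by simp
  have gL: "?g \<in> Lp_space 2" by (rule bounded_L2_powr_L2[OF f]) (use q' in simp)
  have fL: "f \<in> Lp_space 2" and f0: "\<And>x. 0 \<le> f x" using f by (auto simp: bounded_L2_def)
  have B0: "0 \<le> B t q" using S t q by (auto simp: supercontractive_with_def)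
  have SL: "S t ?g \<in> Lp_space 2" using S_L2[OF gL] t by simp
  let ?N = "Lp_norm 2 (S t ?g)"
  have Sq: "S t (S t ?g) \<in> Lp_space q" "Lp_norm q (S t (S t ?g)) \<le> B t q * ?N"
    using S t q SL by (auto simp: supercontractive_with_def)
  have ap: "?a * ?p = 2" using q by (simp add: field_simps)
  then have gp: "\<bar>?g x\<bar> powr ?p = (f x)\<^sup>2" for x using f0[of x] by (simp add: powr_powr)
  have gLp: "?g \<in> Lp_space ?p"
    unfolding Lp_space_def mem_Collect_eq gp using fL L2_borel[OF gL] by (auto simp: Lp_space_2_iff)
  have gn: "Lp_norm ?p ?g = Lp_norm 2 f powr ?a"
  proof -
    have "1 / ?p = ?a / 2" using q by (simp add: field_simps)
    moreover have "0 < ?a" using q' by simp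
    ultimately show ?thesis unfolding Lp_norm_def[of ?p] gp using Lp_norm_2_powr by metis
  qed
  have "?N\<^sup>2 = L2_inner (S t (S t ?g)) ?g"
    unfolding Lp_norm_2_sq using S_symmetric[OF SL gL] t by simp
  also have "\<dots> \<le> (\<integral>x. \<bar>S t (S t ?g) x * ?g x\<bar> \<partial>lborel)"
    unfolding L2_inner_def using integral_abs_bound abs_ge_self order_trans by blast
  also have "\<dots> \<le> Lp_norm q (S t (S t ?g)) * Lp_norm ?p ?g"
  proof (rule Holder_inequality(2)[OF _ _ _ Sq(1) gLp])
    show "1 / q + 1 / ?p = 1" using q by (simp add: field_simps)
  qed (use q in auto)
  also have "\<dots> \<le> B t q * ?N * Lp_norm 2 f powr ?a"
    unfolding gn by (intro mult_right_mono Sq) simp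
  finally have "?N * ?N \<le> (B t q * Lp_norm 2 f powr ?a) * ?N" by (simp add: power2_eq_square ac_simps)
  then show "?N \<le> B t q * Lp_norm 2 f powr ?a"
    using B0 Lp_norm_nonneg[of 2 "S t ?g"] by (cases "?N = 0") (auto simp: mult_le_cancel_right less_le)
qed

text \<open>The endpoint where \<open>q\<close> is infinite: the conjugate exponent is 1, hence g =
  f^2, and the uniform bound on S t (S t g) replaces Hoelder.\<close>

lemma smoothing_of_bounded:
  assumes bd: "\<And>u. u \<in> Lp_space 2 \<Longrightarrow> AE x in lborel. \<bar>S t u x\<bar> \<le> K * Lp_norm 2 u"
    and t: "0 < t" and K: "0 \<le> K"
  shows "smoothing t (1 + 1) K"
  unfolding smoothing_def
proof
  fix f :: "real^'n \<Rightarrow> real" assume f: "f \<in> bounded_L2"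
  let ?g = "\<lambda>x. f x powr (1 + 1)"
  have gL: "?g \<in> Lp_space 2" by (rule bounded_L2_powr_L2[OF f]) simp
  have fL: "f \<in> Lp_space 2" and f0: "\<And>x. 0 \<le> f x" using f by (auto simp: bounded_L2_def)
  have SL: "S t ?g \<in> Lp_space 2" using S_L2[OF gL] t by simp
  have SSL: "S t (S t ?g) \<in> Lp_space 2" using S_L2[OF SL] t by simp
  let ?N = "Lp_norm 2 (S t ?g)"
  have gf: "?g x = (f x)\<^sup>2" for x using f0[of x] by simp
  have "?N\<^sup>2 = L2_inner (S t (S t ?g)) ?g"
    unfolding Lp_norm_2_sq using S_symmetric[OF SL gL] t by simp
  also have "\<dots> \<le> (\<integral>x. (K * ?N) * (f x)\<^sup>2 \<partial>lborel)"
    unfolding L2_inner_def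
  proof (rule integral_mono_AE[OF L2_integrable_mult[OF SSL gL]])
    show "integrable lborel (\<lambda>x. K * ?N * (f x)\<^sup>2)" using fL by (simp add: Lp_space_2_iff)
    show "AE x in lborel. S t (S t ?g) x * ?g x \<le> K * ?N * (f x)\<^sup>2"
      using bd[OF SL] unfolding gf by eventually_elim (auto intro!: mult_right_mono)
  qed
  also have "\<dots> = K * ?N * Lp_norm 2 f powr (1 + 1)"
    using Lp_norm_2_powr[of 2 f] by simp
  finally have "?N * ?N \<le> (K * Lp_norm 2 f powr (1 + 1)) * ?N" by (simp only: power2_eq_square ac_simps)
  then show "?N \<le> K * Lp_norm 2 f powr (1 + 1)"
    using K Lp_norm_nonneg[of 2 "S t ?g"] by (cases "?N = 0") (auto simp: mult_le_cancel_right less_le)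
qed

end

section \<open>Entropy of squares and removal of the boundedness assumption\<close>

lemma Phi_sq: "Phi (x\<^sup>2) = 2 * (x * (x * ln x))" if "0 \<le> x" for x :: real
  using that by (cases "x = 0") (auto simp: Phi_def ln_mult power2_eq_square)

text \<open>This is where integrability of \<open>f\<close> enters: the negative part of
  \<open>Phi (f\<^sup>2)\<close> is integrable, so the entropy is never a difference of two
  infinities. The bound is \<open>ln y \<le> y\<close> at y = 1 / |x|.\<close>

lemma neg_Phi_sq_le: "max 0 (- Phi (x\<^sup>2)) \<le> 2 * \<bar>x\<bar>" for x :: real
proof (cases "x = 0")
  case False
  then have x: "0 < \<bar>x\<bar>" by simp
  have "- ln \<bar>x\<bar> = ln (1 / \<bar>x\<bar>)" using x by (simp add: ln_div)
  also have "\<dots> \<le> 1 / \<bar>x\<bar>" using x by (intro ln_bound) simp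
  finally have "\<bar>x\<bar> * (\<bar>x\<bar> * - ln \<bar>x\<bar>) \<le> \<bar>x\<bar> * (\<bar>x\<bar> * (1 / \<bar>x\<bar>))"
    using x by (intro mult_left_mono) auto
  also have "\<dots> = \<bar>x\<bar>" using x by simp
  finally have "- (2 * (\<bar>x\<bar> * (\<bar>x\<bar> * ln \<bar>x\<bar>))) \<le> 2 * \<bar>x\<bar>" by simp
  then have "- Phi (\<bar>x\<bar>\<^sup>2) \<le> 2 * \<bar>x\<bar>" using Phi_sq[of "\<bar>x\<bar>"] by simp
  then show ?thesis by simp
qed (simp add: Phi_def)

lemma Phi_measurable [measurable]: "Phi \<in> borel_measurable borel"
  unfolding Phi_def[abs_def] by measurable

lemma Phi_mono_ge_1: "1 \<le> x \<Longrightarrow> x \<le> y \<Longrightarrow> Phi x \<le> Phi y"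
  by (auto simp: Phi_def intro!: mult_mono)

lemma Phi_nonneg: "1 \<le> x \<Longrightarrow> 0 \<le> Phi x"
  by (simp add: Phi_def)

lemma Phi_nonpos: "0 \<le> x \<Longrightarrow> x \<le> 1 \<Longrightarrow> Phi x \<le> 0"
  by (cases "x = 0") (auto simp: Phi_def mult_nonneg_nonpos)

lemma Ent_sq_real:
  fixes f :: "real^'n \<Rightarrow> real"
  assumes "integrable lborel (\<lambda>x. max 0 (Phi ((f x)\<^sup>2)))" "integrable lborel (\<lambda>x. max 0 (- Phi ((f x)\<^sup>2)))"
  shows "Ent (\<lambda>x. (f x)\<^sup>2) = ereal ((\<integral>x. Phi ((f x)\<^sup>2) \<partial>lborel) - Phi ((Lp_norm 2 f)\<^sup>2))"
proof -
  have "(\<integral>x. Phi ((f x)\<^sup>2) \<partial>lborel) = (\<integral>x. max 0 (Phi ((f x)\<^sup>2)) - max 0 (- Phi ((f x)\<^sup>2)) \<partial>lborel)"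
    by (intro Bochner_Integration.integral_cong) auto
  also have "\<dots> = (\<integral>x. max 0 (Phi ((f x)\<^sup>2)) \<partial>lborel) - (\<integral>x. max 0 (- Phi ((f x)\<^sup>2)) \<partial>lborel)"
    using assms by simp
  finally have 1: "(\<integral>x. Phi ((f x)\<^sup>2) \<partial>lborel) = \<dots>" .
  have "ext_integral lborel (\<lambda>x. Phi \<bar>(f x)\<^sup>2\<bar>) = ereal (\<integral>x. Phi ((f x)\<^sup>2) \<partial>lborel)"
    unfolding 1 ext_integral_def abs_power2
    using assms by (simp add: nn_integral_eq_integral enn2ereal_ennreal integral_nonneg_AE)
  then show ?thesis unfolding Ent_def by (simp add: Lp_norm_2)
qed

lemma Lp_1_iff: "f \<in> Lp_space 1 \<longleftrightarrow> f \<in> borel_measurable lborel \<and> integrable lborel f"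
  by (auto simp: Lp_space_def integrable_abs_iff)

context levy
begin

text \<open>Truncation of |f| from above. It does not increase the energy, converges in norm, and
  makes the positive parts of \<open>Phi\<close> increase to their limit; monotone convergence
  therefore yields finiteness of the entropy along with the inequality.\<close>

lemma log_sobolev_of_bounded:
  assumes bd: "\<And>f. f \<in> bounded_L2 \<Longrightarrow> integrable lborel f \<Longrightarrow> f \<in> levy_space J \<Longrightarrow> 0 < Lp_norm 2 f \<Longrightarrow>
      2 * L2_inner f (\<lambda>x. f x * ln (f x))
        \<le> (Lp_norm 2 f)\<^sup>2 * (2 * b + 2 * ln (Lp_norm 2 f)) + 2 * \<epsilon> * levy_form J f f"
    and \<epsilon>: "0 \<le> \<epsilon>"
  shows "log_sobolev J b \<epsilon>"
  unfolding log_sobolev_def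
proof
  fix f :: "real^'n \<Rightarrow> real" assume "f \<in> Lp_space 1 \<inter> levy_space J"
  then have fi: "integrable lborel f" and fS: "f \<in> levy_space J" by (auto simp: Lp_1_iff)
  have fL: "f \<in> Lp_space 2" using fS by (rule levy_space_L2)
  note [measurable] = L2_borel[OF fL]
  let ?E = "levy_form J f f"
  define N where "N = Lp_norm 2 f"
  \<comment> \<open>The level is \<open>Suc n\<close> so that it is at least 1: above 1 the function
    \<open>Phi\<close> is nonnegative and increasing, hence truncation leaves the negative part
    \<open>nn\<close> unchanged.\<close>
  define fn where "fn = (\<lambda>n x. min \<bar>f x\<bar> (real (Suc n)))"
  define nn where "nn = (\<integral>x. max 0 (- Phi ((f x)\<^sup>2)) \<partial>lborel)"
  have negi: "integrable lborel (\<lambda>x. max 0 (- Phi ((f x)\<^sup>2)))"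
    by (rule Bochner_Integration.integrable_bound[of _ "\<lambda>x. 2 * \<bar>f x\<bar>"])
      (use fi neg_Phi_sq_le in auto)
  have E0: "0 \<le> ?E" by (rule levy_form_self_nonneg)
  have rhs: "ereal (2 * b * (Lp_norm 2 f)\<^sup>2) + ereal (2 * \<epsilon>) * enn2ereal (levy_energy J f)
      = ereal (2 * b * N\<^sup>2 + 2 * \<epsilon> * ?E)"
    using E0 by (simp add: levy_energy_eq_form[OF fS] enn2ereal_ennreal N_def)
  have fnb: "fn n \<in> bounded_L2" for n
  proof -
    have [measurable]: "fn n \<in> borel_measurable lborel" unfolding fn_def by measurable
    have "fn n \<in> Lp_space 2" by (rule L2_dominated[OF fL, of _ 1]) (auto simp: fn_def)
    then show ?thesis unfolding bounded_L2_def by (auto simp: fn_def intro!: exI[of _ "real (Suc n)"])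
  qed
  have fnL: "fn n \<in> Lp_space 2" for n using fnb by (rule bounded_L2_L2)
  have fni: "integrable lborel (fn n)" for n
    by (rule Bochner_Integration.integrable_bound[OF fi])
      (use L2_borel[OF fnL] in \<open>auto simp: fn_def\<close>)
  have lip: "\<bar>min \<bar>a\<bar> (real (Suc n)) - min \<bar>b\<bar> (real (Suc n))\<bar> \<le> 1 * \<bar>a - b\<bar>" for a b n
    by (auto simp: min_def)
  have fnS: "fn n \<in> levy_space J" for n
    unfolding fn_def by (rule levy_space_Lipschitz[OF fS, of _ UNIV 1]) (use lip in auto)
  have fnE: "levy_form J (fn n) (fn n) \<le> ?E" for n
  proof -
    have "(fn n x - fn n y) * (fn n x - fn n y) \<le> 1 * ((f x - f y) * (f x - f y))" for x y
      using power_mono[OF lip[of "f x" n "f y"], of 2] by (simp add: fn_def power2_eq_square)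
    from levy_form_le[OF fnS fnS fS fS this] show ?thesis by simp
  qed
  have pn: "(\<integral>\<^sup>+x. ennreal (max 0 (Phi ((fn n x)\<^sup>2))) \<partial>lborel)
      = ennreal (nn + 2 * L2_inner (fn n) (\<lambda>x. fn n x * ln (fn n x)))"
    and pn0: "0 \<le> nn + 2 * L2_inner (fn n) (\<lambda>x. fn n x * ln (fn n x))" for n
  proof -
    have neg: "max 0 (- Phi ((fn n x)\<^sup>2)) = max 0 (- Phi ((f x)\<^sup>2))" for x
    proof (cases "\<bar>f x\<bar> \<le> real (Suc n)")
      case False
      then have "1 \<le> \<bar>f x\<bar>" "1 \<le> fn n x" by (auto simp: fn_def)
      then have "1 \<le> \<bar>f x\<bar>\<^sup>2" "1 \<le> (fn n x)\<^sup>2" by (simp_all only: one_le_power)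
      then have "0 \<le> Phi ((f x)\<^sup>2)" "0 \<le> Phi ((fn n x)\<^sup>2)" by (simp_all add: Phi_nonneg)
      then show ?thesis by simp
    qed (simp add: fn_def)
    have i: "integrable lborel (\<lambda>x. 2 * (fn n x * (fn n x * ln (fn n x))))"
      by (intro integrable_mult_right L2_integrable_mult fnL x_ln_x_L2 fnb fni)
    have eq: "max 0 (Phi ((fn n x)\<^sup>2))
        = 2 * (fn n x * (fn n x * ln (fn n x))) + max 0 (- Phi ((f x)\<^sup>2))" for x
      using Phi_sq[OF bounded_L2_nonneg[OF fnb], of n x] neg[of x] by (auto simp: max_def split: if_splits)
    have "(\<integral>\<^sup>+x. ennreal (max 0 (Phi ((fn n x)\<^sup>2))) \<partial>lborel)
        = ennreal (\<integral>x. max 0 (Phi ((fn n x)\<^sup>2)) \<partial>lborel)"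
      using i negi by (intro nn_integral_eq_integral) (simp add: eq, simp)
    moreover have r: "(\<integral>x. max 0 (Phi ((fn n x)\<^sup>2)) \<partial>lborel)
        = nn + 2 * L2_inner (fn n) (\<lambda>x. fn n x * ln (fn n x))"
      unfolding eq using i negi by (simp add: nn_def L2_inner_def)
    ultimately show "(\<integral>\<^sup>+x. ennreal (max 0 (Phi ((fn n x)\<^sup>2))) \<partial>lborel)
        = ennreal (nn + 2 * L2_inner (fn n) (\<lambda>x. fn n x * ln (fn n x)))" by simp
    show "0 \<le> nn + 2 * L2_inner (fn n) (\<lambda>x. fn n x * ln (fn n x))"
      unfolding r[symmetric] by (intro integral_nonneg_AE) auto
  qed
  have Plim: "(\<lambda>n. \<integral>\<^sup>+x. ennreal (max 0 (Phi ((fn n x)\<^sup>2))) \<partial>lborel)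
      \<longlonglongrightarrow> (\<integral>\<^sup>+x. ennreal (max 0 (Phi ((f x)\<^sup>2))) \<partial>lborel)"
  proof (rule nn_integral_LIMSEQ)
    show "incseq (\<lambda>n x. ennreal (max 0 (Phi ((fn n x)\<^sup>2))))"
    proof (intro incseq_SucI le_funI ennreal_leI)
      fix n x
      show "max 0 (Phi ((fn n x)\<^sup>2)) \<le> max 0 (Phi ((fn (Suc n) x)\<^sup>2))"
      proof (cases "1 \<le> (fn n x)\<^sup>2")
        case True
        have "(fn n x)\<^sup>2 \<le> (fn (Suc n) x)\<^sup>2" by (intro power_mono) (auto simp: fn_def)
        then show ?thesis by (intro max.mono Phi_mono_ge_1 True) auto
      next
        case False
        then show ?thesis using Phi_nonpos[of "(fn n x)\<^sup>2"] by auto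
      qed
    qed
    show "(\<lambda>x. ennreal (max 0 (Phi ((fn n x)\<^sup>2)))) \<in> borel_measurable lborel" for n
      using L2_borel[OF fnL] by measurable
    show "(\<lambda>n. ennreal (max 0 (Phi ((fn n x)\<^sup>2)))) \<longlonglongrightarrow> ennreal (max 0 (Phi ((f x)\<^sup>2)))" for x
    proof (rule tendsto_eventually)
      obtain m :: nat where "\<bar>f x\<bar> < real m" using reals_Archimedean2 by blast
      then show "\<forall>\<^sub>F n in sequentially. ennreal (max 0 (Phi ((fn n x)\<^sup>2))) = ennreal (max 0 (Phi ((f x)\<^sup>2)))"
        unfolding eventually_sequentially fn_def by (intro exI[of _ m]) (auto simp: min_def)
    qed
  qed
  have Nlim: "(\<lambda>n. (Lp_norm 2 (fn n))\<^sup>2) \<longlonglongrightarrow> N\<^sup>2"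
    unfolding Lp_norm_2_sq L2_inner_def N_def
  proof (rule integral_dominated_convergence)
    show "integrable lborel (\<lambda>x. f x * f x)" by (intro L2_integrable_mult fL)
    show "AE x in lborel. (\<lambda>n. fn n x * fn n x) \<longlonglongrightarrow> f x * f x"
    proof (rule AE_I2, rule tendsto_eventually)
      fix x
      obtain m :: nat where "\<bar>f x\<bar> < real m" using reals_Archimedean2 by blast
      then show "\<forall>\<^sub>F n in sequentially. fn n x * fn n x = f x * f x"
        unfolding eventually_sequentially fn_def by (intro exI[of _ m]) (auto simp: min_def)
    qed
    show "AE x in lborel. norm (fn n x * fn n x) \<le> f x * f x" for n
    proof (rule AE_I2)
      fix x
      have "(fn n x)\<^sup>2 \<le> \<bar>f x\<bar>\<^sup>2" by (intro power_mono) (auto simp: fn_def)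
      then show "norm (fn n x * fn n x) \<le> f x * f x" by (simp add: power2_eq_square)
    qed
  qed (use L2_borel[OF fnL] in measurable)
  show "Ent (\<lambda>x. (f x)\<^sup>2) \<le> ereal (2 * b * (Lp_norm 2 f)\<^sup>2) + ereal (2 * \<epsilon>) * enn2ereal (levy_energy J f)"
  \<comment> \<open>The logarithm in \<open>Phi\<close> passes to the limit only at a positive
    \<open>N\<close>. If \<open>N\<close> is 0, then \<open>f\<close> vanishes almost everywhere and
    the entropy is 0.\<close>
  proof (cases "N = 0")
    case True
    then have f0: "AE x in lborel. f x = 0" using Lp_norm_zero_AE[OF fL] by (simp add: N_def)
    have a0: "AE x in lborel. Phi ((f x)\<^sup>2) = 0" using f0 by eventually_elim (simp add: Phi_def)
    have posi: "integrable lborel (\<lambda>x. max 0 (Phi ((f x)\<^sup>2)))"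
      by (rule Bochner_Integration.integrable_bound[OF fi])
        (auto intro: AE_mp[OF a0])
    have "(\<integral>x. Phi ((f x)\<^sup>2) \<partial>lborel) = 0" using a0 by (rule integral_eq_zero_AE)
    then show ?thesis
      unfolding rhs Ent_sq_real[OF posi negi] using True \<epsilon> E0 by (simp add: N_def Phi_def)
  next
    case False
    then have N0: "0 < N" by (simp add: N_def less_le)
    \<comment> \<open>Bound for the integral of the positive part when the squared norm is
      \<open>y\<close>; the energy of the truncation has already been replaced by that of
      \<open>f\<close>.\<close>
    define R where "R = (\<lambda>y. nn + 2 * b * y + Phi y + 2 * \<epsilon> * ?E)"
    have Rlim0: "(\<lambda>n. R ((Lp_norm 2 (fn n))\<^sup>2)) \<longlonglongrightarrow> R (N\<^sup>2)"
      unfolding R_def Phi_def using N0 by (intro tendsto_intros Nlim) auto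
    from this have Rlim: "(\<lambda>n. ennreal (R ((Lp_norm 2 (fn n))\<^sup>2))) \<longlonglongrightarrow> ennreal (R (N\<^sup>2))"
      by (rule tendsto_ennrealI)
    have "\<forall>\<^sub>F n in sequentially. 0 < (Lp_norm 2 (fn n))\<^sup>2"
      using N0 by (intro order_tendstoD(1)[OF Nlim]) simp
    then have ev: "\<forall>\<^sub>F n in sequentially. nn + 2 * L2_inner (fn n) (\<lambda>x. fn n x * ln (fn n x))
        \<le> R ((Lp_norm 2 (fn n))\<^sup>2)"
    proof eventually_elim
      case (elim n)
      then have Nn: "0 < Lp_norm 2 (fn n)" by (simp add: less_le)
      have "Phi ((Lp_norm 2 (fn n))\<^sup>2) = (Lp_norm 2 (fn n))\<^sup>2 * (2 * ln (Lp_norm 2 (fn n)))"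
        using Nn by (simp add: Phi_def ln_realpow)
      moreover have "2 * \<epsilon> * levy_form J (fn n) (fn n) \<le> 2 * \<epsilon> * ?E"
        using \<epsilon> fnE by (intro mult_left_mono) auto
      ultimately show ?case
        using bd[OF fnb fni fnS Nn] by (simp add: R_def algebra_simps)
    qed
    have "\<forall>\<^sub>F n in sequentially. 0 \<le> R ((Lp_norm 2 (fn n))\<^sup>2)"
      using ev by eventually_elim (use pn0 order_trans in blast)
    then have R0: "0 \<le> R (N\<^sup>2)" using tendsto_lowerbound[OF Rlim0] by simp
    have "\<forall>\<^sub>F n in sequentially. (\<integral>\<^sup>+x. ennreal (max 0 (Phi ((fn n x)\<^sup>2))) \<partial>lborel)
        \<le> ennreal (R ((Lp_norm 2 (fn n))\<^sup>2))"
      using ev unfolding pn by eventually_elim (rule ennreal_leI)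
    then have Ple: "(\<integral>\<^sup>+x. ennreal (max 0 (Phi ((f x)\<^sup>2))) \<partial>lborel) \<le> ennreal (R (N\<^sup>2))"
      using tendsto_le[OF _ Rlim Plim] by simp
    then have "(\<integral>\<^sup>+x. ennreal (max 0 (Phi ((f x)\<^sup>2))) \<partial>lborel) < \<infinity>"
      using ennreal_less_top order_le_less_trans by fastforce
    then have posi: "integrable lborel (\<lambda>x. max 0 (Phi ((f x)\<^sup>2)))"
      by (intro integrableI_nonneg) auto
    have "ennreal (\<integral>x. max 0 (Phi ((f x)\<^sup>2)) \<partial>lborel) \<le> ennreal (R (N\<^sup>2))"
      using Ple posi by (subst (asm) nn_integral_eq_integral) auto
    then have le: "(\<integral>x. max 0 (Phi ((f x)\<^sup>2)) \<partial>lborel) \<le> R (N\<^sup>2)"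
      using R0 by simp
    have "(\<integral>x. Phi ((f x)\<^sup>2) \<partial>lborel) = (\<integral>x. max 0 (Phi ((f x)\<^sup>2)) - max 0 (- Phi ((f x)\<^sup>2)) \<partial>lborel)"
      by (intro Bochner_Integration.integral_cong) auto
    also have "\<dots> = (\<integral>x. max 0 (Phi ((f x)\<^sup>2)) \<partial>lborel) - nn"
      using posi negi by (simp add: nn_def)
    finally show ?thesis
      unfolding rhs Ent_sq_real[OF posi negi] using le by (simp add: R_def N_def)
  qed
qed

end

text \<open>Chebyshev with growing exponents: for \<open>C < D\<close> the set where |v| is at least
  \<open>D\<close> has measure at most (C/D)^n for all n >= 2, hence measure 0.\<close>

lemma Lp_norm_bound_imp_AE_bound:
  fixes v :: "real^'n \<Rightarrow> real"
  assumes v: "\<And>q. 2 \<le> q \<Longrightarrow> v \<in> Lp_space q" "\<And>q. 2 \<le> q \<Longrightarrow> Lp_norm q v \<le> C"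
  shows "AE x in lborel. \<bar>v x\<bar> \<le> C"
proof -
  have C: "0 \<le> C" using v(2)[of 2] Lp_norm_nonneg[of 2 v] by linarith
  have vL: "v \<in> Lp_space 2" using v(1) by simp
  note [measurable] = L2_borel[OF vL]
  have level: "AE x in lborel. \<bar>v x\<bar> < D" if D: "C < D" for D
  proof -
    define A where "A = {x. D \<le> \<bar>v x\<bar>}"
    have [measurable]: "A \<in> sets lborel" unfolding A_def by measurable
    have D0: "0 < D" using C D by simp
    have ind: "D powr q * indicator A x \<le> \<bar>v x\<bar> powr q" if "2 \<le> q" for q x
      using D0 that by (auto simp: A_def indicator_def intro!: powr_mono2)
    have fin: "integrable lborel (indicator A :: _ \<Rightarrow> real)"
    proof (rule Bochner_Integration.integrable_bound)
      show "integrable lborel (\<lambda>x. \<bar>v x\<bar> powr 2 / D powr 2)"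
        using vL by (intro integrable_divide) (auto simp: Lp_space_def)
      show "AE x in lborel. norm (indicator A x :: real) \<le> norm (\<bar>v x\<bar> powr 2 / D powr 2)"
        using ind[of 2] D0 by (intro AE_I2) (simp add: field_simps)
    qed measurable
    define m where "m = (\<integral>x. indicator A x \<partial>lborel :: real)"
    have m0: "0 \<le> m" by (simp add: m_def)
    have bd: "m \<le> (C / D) ^ n" if n: "2 \<le> n" for n :: nat
    proof -
      have q: "2 \<le> real n" using n by simp
      have "D powr n * m = (\<integral>x. D powr n * indicator A x \<partial>lborel)" by (simp add: m_def)
      also have "\<dots> \<le> (\<integral>x. \<bar>v x\<bar> powr n \<partial>lborel)"
        using v(1)[OF q] fin ind[OF q] by (intro integral_mono) (auto simp: Lp_space_def)
      also have "\<dots> = Lp_norm n v powr n" using q by (subst Lp_norm_powr) auto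
      also have "\<dots> \<le> C powr n" using v(2)[OF q] q by (intro powr_mono2) auto
      also have "C powr n = C ^ n" using C n by (simp add: powr_realpow')
      finally show ?thesis using D0 by (simp add: powr_realpow field_simps)
    qed
    have "(\<lambda>n. (C / D) ^ n) \<longlonglongrightarrow> 0" using C D D0 by (intro LIMSEQ_power_zero) simp
    then have "m \<le> 0" using bd by (intro LIMSEQ_le_const) auto
    then have "m = 0" using m0 by simp
    then have "AE x in lborel. indicator A x = (0::real)"
      using fin by (subst (asm) m_def, subst (asm) integral_nonneg_eq_0_iff_AE) auto
    then show ?thesis by eventually_elim (auto simp: A_def indicator_def split: if_splits)
  qed
  have "AE x in lborel. \<forall>n::nat. \<bar>v x\<bar> < C + 1 / Suc n"
    by (intro AE_all_countable[THEN iffD2] allI level) simp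
  then show ?thesis
  proof eventually_elim
    case (elim x)
    show ?case
    proof (rule field_le_epsilon)
      fix e :: real assume "0 < e"
      then obtain n :: nat where "1 / Suc n < e" using nat_approx_posE by auto
      then show "\<bar>v x\<bar> \<le> C + e" using elim[rule_format, of n] by simp
    qed
  qed
qed

section \<open>Logarithmic Sobolev inequalities from smoothing\<close>

context levy_sg
begin

text \<open>The time \<open>\<epsilon> * c\<close> anticipates the multiplication by 2 / c, which
  turns the energy coefficient into 2 \<epsilon> and \<open>ln B\<close> into 2 ln B / c.\<close>

lemma log_sobolev_of_smoothing:
  assumes sm: "smoothing (\<epsilon> * c) (1 + c) B" and c: "0 < c" and \<epsilon>: "0 < \<epsilon>" and B: "0 \<le> B"
  shows "log_sobolev J (inverse c * ln B) \<epsilon>"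
proof (rule log_sobolev_of_bounded)
  fix f :: "real^'n \<Rightarrow> real"
  assume f: "f \<in> bounded_L2" "integrable lborel f" "f \<in> levy_space J" and N: "0 < Lp_norm 2 f"
  let ?N = "Lp_norm 2 f"
  have "c * L2_inner f (\<lambda>x. f x * ln (f x)) \<le> ?N\<^sup>2 * (ln B + c * ln ?N) + \<epsilon> * c * levy_form J f f"
    using c \<epsilon> by (intro entropy_bound_of_smoothing[OF sm] f N B) auto
  then have "2 / c * (c * L2_inner f (\<lambda>x. f x * ln (f x)))
      \<le> 2 / c * (?N\<^sup>2 * (ln B + c * ln ?N) + \<epsilon> * c * levy_form J f f)"
    using c by (intro mult_left_mono) auto
  then show "2 * L2_inner f (\<lambda>x. f x * ln (f x))
        \<le> ?N\<^sup>2 * (2 * (inverse c * ln B) + 2 * ln ?N) + 2 * \<epsilon> * levy_form J f f"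
    using c by (simp add: field_simps)
qed (use \<epsilon> in simp)

lemma supercontractive_log_sobolev:
  assumes S: "supercontractive_with S B" and q: "2 < q" and \<epsilon>: "0 < \<epsilon>"
  shows "log_sobolev J (inverse (1 - 2 / q) * ln (B (\<epsilon> * (1 - 2 / q)) q)) \<epsilon>"
proof -
  have c: "0 < 1 - 2 / q" using q by simp
  then have t: "0 < \<epsilon> * (1 - 2 / q)" using \<epsilon> by simp
  show ?thesis
    using S t q c by (intro log_sobolev_of_smoothing smoothing_of_supercontractive \<epsilon>)
      (auto simp: supercontractive_with_def)
qed

lemma ultracontractive_bound:
  assumes S: "ultracontractive_with S B" and t: "0 < t" and u: "u \<in> Lp_space 2"
  shows "AE x in lborel. \<bar>S t u x\<bar> \<le> (SUP q\<in>{2..}. B t q) * Lp_norm 2 u"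
proof (rule Lp_norm_bound_imp_AE_bound)
  fix q :: real assume q: "2 \<le> q"
  show "S t u \<in> Lp_space q" using S t u q
    by (auto simp: ultracontractive_with_def supercontractive_with_def)
  have "B t q \<le> (SUP q\<in>{2..}. B t q)"
    using S t q by (intro cSUP_upper) (auto simp: ultracontractive_with_def)
  then have "B t q * Lp_norm 2 u \<le> (SUP q\<in>{2..}. B t q) * Lp_norm 2 u"
    by (intro mult_right_mono) auto
  moreover have "Lp_norm q (S t u) \<le> B t q * Lp_norm 2 u"
    using S t u q by (auto simp: ultracontractive_with_def supercontractive_with_def)
  ultimately show "Lp_norm q (S t u) \<le> (SUP q\<in>{2..}. B t q) * Lp_norm 2 u" by linarith
qed

lemma ultracontractive_log_sobolev:
  assumes S: "ultracontractive_with S B" and \<epsilon>: "0 < \<epsilon>"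
  shows "log_sobolev J (ln (SUP q\<in>{2..}. B \<epsilon> q)) \<epsilon>"
proof -
  have "B \<epsilon> 2 \<le> (SUP q\<in>{2..}. B \<epsilon> q)"
    using S \<epsilon> by (intro cSUP_upper) (auto simp: ultracontractive_with_def)
  moreover have "0 \<le> B \<epsilon> 2"
    using S \<epsilon> by (auto simp: ultracontractive_with_def supercontractive_with_def)
  ultimately have K: "0 \<le> (SUP q\<in>{2..}. B \<epsilon> q)" by simp
  have "log_sobolev J (inverse 1 * ln (SUP q\<in>{2..}. B \<epsilon> q)) \<epsilon>"
    using smoothing_of_bounded[OF ultracontractive_bound[OF S \<epsilon>] \<epsilon> K]
    by (intro log_sobolev_of_smoothing \<epsilon> K) auto
  then show ?thesis by simp
qed

end

section \<open>From the logarithmic Sobolev inequality to smoothing\<close>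

text \<open>Young's inequality for the product of \<open>x powr (p - 1)\<close> and
  \<open>y\<close>, multiplied by \<open>p\<close>, is the supporting line of the power function and
  needs no derivative at 0.\<close>

lemma powr_tangent:
  fixes x y p :: real
  assumes "1 \<le> p" "0 \<le> x" "0 \<le> y"
  shows "p * x powr (p - 1) * (y - x) \<le> y powr p - x powr p"
proof (cases "p = 1 \<or> x = 0")
  case True
  then show ?thesis using assms by (cases "x = 0") auto
next
  case False
  then have p: "1 < p" and x: "0 < x" using assms by auto
  have "x powr (p - 1) * y \<le> (x powr (p - 1)) powr (p / (p - 1)) / (p / (p - 1)) + y powr p / p"
    using p assms by (intro Youngs_inequality) (auto simp: field_simps)
  also have "(x powr (p - 1)) powr (p / (p - 1)) = x powr p" using p by (simp add: powr_powr)
  finally have "p * (x powr (p - 1) * y) \<le> p * (x powr p / (p / (p - 1)) + y powr p / p)"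
    using p by (intro mult_left_mono) auto
  also have "\<dots> = (p - 1) * x powr p + y powr p" using p by (simp add: field_simps)
  finally have "p * x powr (p - 1) * y \<le> (p - 1) * x powr p + y powr p" by simp
  moreover have "x powr (p - 1) * x = x powr p"
  proof -
    have "x powr (p - 1) * x powr 1 = x powr p" by (simp only: powr_add[symmetric]) simp
    then show ?thesis using x by simp
  qed
  then have "p * x powr (p - 1) * x = p * x powr p" by simp
  ultimately show ?thesis unfolding right_diff_distrib left_diff_distrib by linarith
qed

text \<open>Convexity in the exponent, from exp z >= 1 + z. Only the power at \<open>a\<close>
  appears on the right, so \<open>b\<close> may vary.\<close>

lemma powr_diff_le:
  fixes x a b :: real
  assumes "0 \<le> x"
  shows "x powr a - x powr b \<le> (a - b) * (x powr a * ln x)"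
proof (cases "x = 0")
  case False
  then have x: "0 < x" using assms by simp
  have "x powr a * (1 + (b - a) * ln x) \<le> x powr a * exp ((b - a) * ln x)"
    by (intro mult_left_mono exp_ge_add_one_self) auto
  also have "\<dots> = x powr a * x powr (b - a)" using x by (simp add: powr_def)
  also have "\<dots> = x powr b" by (simp only: powr_add[symmetric]) simp
  finally show ?thesis by (simp add: algebra_simps)
qed simp

text \<open>Powers of \<open>x\<close> with exponents between \<open>r\<close> and \<open>P\<close>
  are at most \<open>M powr (P - r) * x powr r\<close>. Thus differences of powers are dominated by
  one function; for r = 1 it is a multiple of |x ln x|.\<close>

lemma powr_Lipschitz_exponent:
  fixes x a b :: real
  assumes x: "0 \<le> x" "x \<le> M" and M: "1 \<le> M" and a: "r \<le> a" "a \<le> P" and b: "r \<le> b" "b \<le> P"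
  shows "\<bar>x powr a - x powr b\<bar> \<le> \<bar>a - b\<bar> * (M powr (P - r) * (x powr r * \<bar>ln x\<bar>))"
proof -
  have le: "x powr c \<le> M powr (P - r) * x powr r" if "r \<le> c" "c \<le> P" for c
  proof -
    have "x powr c = x powr (c - r) * x powr r" by (simp only: powr_add[symmetric]) simp
    also have "\<dots> \<le> M powr (c - r) * x powr r" using x that by (intro mult_right_mono powr_mono2) auto
    also have "\<dots> \<le> M powr (P - r) * x powr r" using M that by (intro mult_right_mono powr_mono) auto
    finally show ?thesis .
  qed
  have one: "x powr c - x powr d \<le> \<bar>a - b\<bar> * (M powr (P - r) * (x powr r * \<bar>ln x\<bar>))"
    if "r \<le> c" "c \<le> P" "\<bar>c - d\<bar> = \<bar>a - b\<bar>" for c d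
  proof -
    have "x powr c - x powr d \<le> (c - d) * (x powr c * ln x)" by (rule powr_diff_le[OF x(1)])
    also have "\<dots> \<le> \<bar>c - d\<bar> * (x powr c * \<bar>ln x\<bar>)"
      by (rule order_trans[OF abs_ge_self]) (simp add: abs_mult)
    also have "\<dots> \<le> \<bar>c - d\<bar> * (M powr (P - r) * x powr r * \<bar>ln x\<bar>)"
      using le[OF that(1,2)] by (intro mult_left_mono mult_right_mono) auto
    finally show ?thesis using that(3) by (simp add: mult.assoc)
  qed
  show ?thesis using one[of a b] one[of b a] a b by (auto simp: abs_le_iff abs_minus_commute)
qed

lemma powr_Lipschitz:
  fixes a b r :: real
  assumes r: "1 \<le> r" and a: "0 \<le> a" "a \<le> M" and b: "0 \<le> b" "b \<le> M"
  shows "\<bar>a powr r - b powr r\<bar> \<le> r * M powr (r - 1) * \<bar>a - b\<bar>"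
proof -
  have *: "c powr r - d powr r \<le> r * M powr (r - 1) * \<bar>c - d\<bar>"
    if "0 \<le> c" "c \<le> M" "0 \<le> d" for c d
  proof -
    have "c powr r - d powr r \<le> r * c powr (r - 1) * (c - d)"
      using powr_tangent[OF r that(1,3)] by (simp add: right_diff_distrib)
    also have "\<dots> \<le> r * c powr (r - 1) * \<bar>c - d\<bar>" using r by (intro mult_left_mono) auto
    also have "\<dots> \<le> r * M powr (r - 1) * \<bar>c - d\<bar>"
      using r that by (intro mult_right_mono mult_left_mono powr_mono2) auto
    finally show ?thesis .
  qed
  show ?thesis using *[of a b] *[of b a] a b by (auto simp: abs_le_iff abs_minus_commute)
qed

text \<open>The integrals of \<open>x powr (p / 2 - 1)\<close> and its square over \<open>{b..a}\<close> are compared by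
  Cauchy-Schwarz, in the form that \<open>(x powr (p / 2 - 1) - l)\<^sup>2\<close> has a nonnegative
  integral for the optimal \<open>l\<close>.\<close>

lemma Stroock_Varopoulos:
  fixes a b p :: real
  assumes p: "2 \<le> p" and "0 \<le> a" "0 \<le> b"
  shows "2 / p * (a powr (p / 2) - b powr (p / 2))\<^sup>2 \<le> (a - b) * (a powr (p - 1) - b powr (p - 1))"
proof -
  have *: "2 / p * (a powr (p / 2) - b powr (p / 2))\<^sup>2 \<le> (a - b) * (a powr (p - 1) - b powr (p - 1))"
    if ba: "b < a" and b: "0 \<le> b" for a b :: real
  proof -
    define \<Delta> where "\<Delta> = a powr (p / 2) - b powr (p / 2)"
    \<comment> \<open>The mean of \<open>x powr (p / 2 - 1)\<close> over {b..a}; \<open>k\<close>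
      below is the antiderivative of the squared deviation from it.\<close>
    define l where "l = 2 / p * \<Delta> / (a - b)"
    define k where "k = (\<lambda>x. x powr (p - 1) / (p - 1) - 2 * l * (2 / p * x powr (p / 2)) + l\<^sup>2 * x)"
    have "k b \<le> k a"
    proof (rule DERIV_nonneg_imp_increasing_open[of b a k])
      fix x assume "b < x" "x < a"
      then have x: "0 < x" using b by simp
      have "(k has_real_derivative
          ((p - 1) * x powr (p - 1 - 1) / (p - 1) - 2 * l * (2 / p * (p / 2 * x powr (p / 2 - 1))) + l\<^sup>2 * 1)) (at x)"
        unfolding k_def
        by (intro DERIV_add DERIV_diff DERIV_cdivide DERIV_cmult DERIV_ident has_real_derivative_powr x)
      moreover have "(p - 1) * x powr (p - 1 - 1) / (p - 1) - 2 * l * (2 / p * (p / 2 * x powr (p / 2 - 1))) + l\<^sup>2 * 1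
          = (x powr (p / 2 - 1) - l)\<^sup>2"
      proof -
        have "x powr (p - 1 - 1) = (x powr (p / 2 - 1))\<^sup>2"
          unfolding power2_eq_square powr_add[symmetric] by simp
        then show ?thesis using p by (simp add: power2_diff)
      qed
      ultimately show "\<exists>y. (k has_real_derivative y) (at x) \<and> 0 \<le> y" by (metis zero_le_power2)
    next
      show "continuous_on {b..a} k"
        unfolding k_def using b p by (intro continuous_intros continuous_on_powr') auto
    qed (use ba in simp)
    then have "2 * l * (2 / p * \<Delta>) - l\<^sup>2 * (a - b) \<le> (a powr (p - 1) - b powr (p - 1)) / (p - 1)"
      by (simp add: k_def \<Delta>_def diff_divide_distrib algebra_simps)
    moreover have "2 / p * \<Delta> = l * (a - b)" using ba by (simp add: l_def)
    ultimately have "2 * l * (l * (a - b)) - l\<^sup>2 * (a - b) \<le> (a powr (p - 1) - b powr (p - 1)) / (p - 1)"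
      by (simp only:)
    then have "l\<^sup>2 * (a - b) \<le> (a powr (p - 1) - b powr (p - 1)) / (p - 1)"
      by (simp add: power2_eq_square)
    then have "(p - 1) * (a - b) * (l\<^sup>2 * (a - b))
        \<le> (p - 1) * (a - b) * ((a powr (p - 1) - b powr (p - 1)) / (p - 1))"
      using p ba by (intro mult_left_mono) auto
    then have 1: "(p - 1) * (l * (a - b))\<^sup>2 \<le> (a - b) * (a powr (p - 1) - b powr (p - 1))"
      using p by (simp add: power2_eq_square ac_simps)
    \<comment> \<open>The comparison yields the constant (p - 1) (2/p)^2, which for p >= 2 is at
      least 2/p. The simpler constant makes the energy term scale exactly with the exponent
      later.\<close>
    have "2 / p * \<Delta>\<^sup>2 \<le> (p - 1) * (2 / p * \<Delta>)\<^sup>2"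
    proof -
      have "2 / p \<le> (p - 1) * (2 / p)\<^sup>2" using p by (simp add: power2_eq_square field_simps)
      then show ?thesis
        unfolding power_mult_distrib mult.assoc[symmetric] by (rule mult_right_mono) simp
    qed
    also have "2 / p * \<Delta> = l * (a - b)" using ba by (simp add: l_def)
    also note 1
    finally show ?thesis by (simp add: \<Delta>_def)
  qed
  consider "b < a" | "a = b" | "a < b" by linarith
  then show ?thesis
  proof cases
    case 3
    from *[OF 3 assms(2)] show ?thesis by (simp add: power2_commute algebra_simps)
  qed (use * assms in auto)
qed

text \<open>For a slope \<open>\<eta>\<close>, consider the points \<open>s\<close> from which
  \<open>D b \<le> D s + \<eta> * (b - s)\<close>. The condition on the right, upper semicontinuity,
  puts the infimum into this set; the condition on the left would push it further down unless it is
  \<open>a\<close>. This suits a function for which only one-sided increments are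
  controlled.\<close>

lemma left_Dini_nonpos_imp_le:
  fixes D :: "real \<Rightarrow> real"
  assumes ab: "a \<le> b"
    and left: "\<And>s \<eta>. a < s \<Longrightarrow> s \<le> b \<Longrightarrow> 0 < \<eta> \<Longrightarrow> \<forall>\<^sub>F r in at_left s. D s - D r \<le> \<eta> * (s - r)"
    and right: "\<And>s \<eta>. a \<le> s \<Longrightarrow> s < b \<Longrightarrow> 0 < \<eta> \<Longrightarrow> \<forall>\<^sub>F r in at_right s. D r \<le> D s + \<eta>"
  shows "D b \<le> D a"
proof -
  have main: "D b \<le> D a + \<eta> * (b - a)" if \<eta>: "0 < \<eta>" for \<eta>
  proof -
    define A where "A = {s\<in>{a..b}. D b \<le> D s + \<eta> * (b - s)}"
    define s where "s = Inf A"
    have bA: "b \<in> A" using ab by (simp add: A_def)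
    have bdd: "bdd_below A" by (auto simp: A_def intro: bdd_belowI[of _ a])
    have as: "a \<le> s" unfolding s_def using bA by (intro cInf_greatest) (auto simp: A_def)
    have sb: "s \<le> b" unfolding s_def by (rule cInf_lower[OF bA bdd])
    have sA: "s \<in> A"
    proof (rule ccontr)
      assume sn: "s \<notin> A"
      then have sb': "s < b" using bA sb by (cases "s = b") auto
      have "D b \<le> D s + \<eta> * (b - s)"
      proof (rule field_le_epsilon)
        fix e :: real assume e: "0 < e"
        obtain c where c: "s < c" "\<And>r. s < r \<Longrightarrow> r < c \<Longrightarrow> D r \<le> D s + e"
          using right[OF as sb' e] by (auto simp: eventually_at_right[OF sb'])
        obtain r where r: "r \<in> A" "r < c"
          using c(1) bA unfolding s_def by (metis cInf_less_iff empty_iff bdd)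
        have "s \<le> r" unfolding s_def by (rule cInf_lower[OF r(1) bdd])
        then have sr: "s < r" using r(1) sn by (cases "s = r") auto
        then have "D r \<le> D s + e" using c(2) r(2) by simp
        moreover have "D b \<le> D r + \<eta> * (b - r)" using r(1) by (simp add: A_def)
        moreover have "\<eta> * (b - r) \<le> \<eta> * (b - s)" using \<eta> sr by (intro mult_left_mono) auto
        ultimately show "D b \<le> D s + \<eta> * (b - s) + e" by linarith
      qed
      then show False using sn as sb by (simp add: A_def)
    qed
    have "s = a"
    proof (rule ccontr)
      assume "s \<noteq> a"
      then have as': "a < s" using as by simp
      obtain c where c: "c < s" "\<And>r. c < r \<Longrightarrow> r < s \<Longrightarrow> D s - D r \<le> \<eta> * (s - r)"
        using left[OF as' sb \<eta>] by (auto simp: eventually_at_left[OF as'])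
      define r where "r = (max a c + s) / 2"
      have r: "a < r" "c < r" "r < s" using as' c(1) by (auto simp: r_def max_def)
      have "D b \<le> D s + \<eta> * (b - s)" using sA by (simp add: A_def)
      also have "\<dots> \<le> D r + \<eta> * (s - r) + \<eta> * (b - s)" using c(2)[OF r(2,3)] by simp
      also have "\<dots> = D r + \<eta> * (b - r)" by (simp add: algebra_simps)
      finally have "r \<in> A" using r sb by (simp add: A_def)
      then have "s \<le> r" unfolding s_def by (rule cInf_lower[OF _ bdd])
      then show False using r by simp
    qed
    then show ?thesis using sA by (simp add: A_def)
  qed
  show ?thesis
  proof (rule field_le_epsilon)
    fix e :: real assume e: "0 < e"
    show "D b \<le> D a + e"
    proof (cases "a = b")
      case False
      then show ?thesis using main[of "e / (b - a)"] ab e by simp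
    qed (use e in simp)
  qed
qed

section \<open>Powers of bounded solutions and the moving exponent\<close>

lemma bounded_powr_integrable:
  fixes f :: "real^'n \<Rightarrow> real"
  assumes "integrable lborel f" "\<And>x. 0 \<le> f x \<and> f x \<le> M" "1 \<le> p"
  shows "integrable lborel (\<lambda>x. f x powr p)"
proof (rule Bochner_Integration.integrable_bound)
  show "integrable lborel (\<lambda>x. M powr (p - 1) * f x)" using assms by simp
  have [measurable]: "f \<in> borel_measurable lborel" using assms(1) by (rule borel_measurable_integrable)
  show "(\<lambda>x. f x powr p) \<in> borel_measurable lborel" by measurable
  have "f x powr p \<le> M powr (p - 1) * f x" for x
  proof -
    have "f x powr p = f x powr (p - 1) * f x powr 1" by (simp only: powr_add[symmetric]) simp
    also have "\<dots> \<le> M powr (p - 1) * f x" using assms(2)[of x] assms(3) by (auto intro!: mult_right_mono powr_mono2)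
    finally show ?thesis .
  qed
  then show "AE x in lborel. norm (f x powr p) \<le> norm (M powr (p - 1) * f x)"
    by (auto intro: order_trans[OF _ abs_ge_self])
qed

context levy
begin

lemma log_sobolev_bounded:
  assumes ls: "log_sobolev J b \<epsilon>" and f: "f \<in> bounded_L2" "integrable lborel f" "f \<in> levy_space J"
  shows "2 * L2_inner f (\<lambda>x. f x * ln (f x))
      \<le> Phi ((Lp_norm 2 f)\<^sup>2) + 2 * b * (Lp_norm 2 f)\<^sup>2 + 2 * \<epsilon> * levy_form J f f"
proof -
  have i: "integrable lborel (\<lambda>x. 2 * (f x * (f x * ln (f x))))"
    by (intro integrable_mult_right L2_integrable_mult bounded_L2_L2 x_ln_x_L2 f)
  have eq: "Phi ((f x)\<^sup>2) = 2 * (f x * (f x * ln (f x)))" for x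
    by (rule Phi_sq[OF bounded_L2_nonneg[OF f(1)]])
  have "Ent (\<lambda>x. (f x)\<^sup>2) = ereal ((\<integral>x. Phi ((f x)\<^sup>2) \<partial>lborel) - Phi ((Lp_norm 2 f)\<^sup>2))"
    using i by (intro Ent_sq_real) (auto simp: eq intro!: integrable_max)
  moreover have "Ent (\<lambda>x. (f x)\<^sup>2)
      \<le> ereal (2 * b * (Lp_norm 2 f)\<^sup>2) + ereal (2 * \<epsilon>) * enn2ereal (levy_energy J f)"
    using ls f L2_borel[OF bounded_L2_L2[OF f(1)]] by (auto simp: log_sobolev_def Lp_1_iff)
  moreover have "enn2ereal (levy_energy J f) = ereal (levy_form J f f)"
    using levy_form_self_nonneg[of f] by (simp add: levy_energy_eq_form[OF f(3)] enn2ereal_ennreal)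
  moreover have "(\<integral>x. Phi ((f x)\<^sup>2) \<partial>lborel) = 2 * L2_inner f (\<lambda>x. f x * ln (f x))"
    unfolding eq by (simp add: L2_inner_def)
  ultimately show ?thesis by simp
qed

text \<open>For \<open>2 \<le> p\<close> the derivative p x^(p-1) is Lipschitz on {0..M}, so decay
  of convex functionals applies on that range.\<close>

lemma flow_powr_decay:
  assumes w: "flow w" "\<And>t x. 0 \<le> t \<Longrightarrow> 0 \<le> w t x \<and> w t x \<le> M" and p: "2 \<le> p" and st: "0 \<le> s" "s \<le> t"
  shows "(\<integral>x. w t x powr p \<partial>lborel) \<le> (\<integral>x. w s x powr p \<partial>lborel)"
proof (rule flow_decay[OF w(1), of "{0..M}" "\<lambda>x. x powr p" "\<lambda>x. p * x powr (p - 1)" "p * ((p - 1) * M powr (p - 1 - 1))"])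
  show "0 \<in> {0..M}" using w(2)[of 0] by (auto intro: order_trans)
  show "p * a powr (p - 1) * (b - a) \<le> b powr p - a powr p" if "a \<in> {0..M}" "b \<in> {0..M}" for a b
    using powr_tangent[of p a b] p that by simp
  show "\<bar>p * a powr (p - 1) - p * b powr (p - 1)\<bar> \<le> p * ((p - 1) * M powr (p - 1 - 1)) * \<bar>a - b\<bar>"
    if "a \<in> {0..M}" "b \<in> {0..M}" for a b
  proof -
    have "p * \<bar>a powr (p - 1) - b powr (p - 1)\<bar> \<le> p * ((p - 1) * M powr (p - 1 - 1) * \<bar>a - b\<bar>)"
      using that p by (intro mult_left_mono powr_Lipschitz) auto
    then show ?thesis using p by (simp add: right_diff_distrib[symmetric] abs_mult mult.assoc)
  qed
qed (use w(2) st in auto)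

end

lemma L2_norm_le:
  assumes "f \<in> Lp_space 2" "g \<in> borel_measurable lborel" "\<And>x. \<bar>g x\<bar> \<le> K * \<bar>f x\<bar>" "0 \<le> K"
  shows "Lp_norm 2 g \<le> K * Lp_norm 2 f"
proof -
  have g: "g \<in> Lp_space 2" using assms by (intro L2_dominated[OF assms(1)]) auto
  have "(\<integral>x. (g x)\<^sup>2 \<partial>lborel) \<le> (\<integral>x. K\<^sup>2 * (f x)\<^sup>2 \<partial>lborel)"
  proof (rule integral_mono)
    show "(g x)\<^sup>2 \<le> K\<^sup>2 * (f x)\<^sup>2" for x
      using power_mono[OF assms(3)[of x] abs_ge_zero, of 2] by (simp add: power_mult_distrib)
  qed (use assms(1) g in \<open>auto simp: Lp_space_2_iff\<close>)
  also have "\<dots> = K\<^sup>2 * (\<integral>x. (f x)\<^sup>2 \<partial>lborel)" by simp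
  finally have "sqrt (\<integral>x. (g x)\<^sup>2 \<partial>lborel) \<le> sqrt (K\<^sup>2 * (\<integral>x. (f x)\<^sup>2 \<partial>lborel))"
    by (rule real_sqrt_le_mono)
  then show ?thesis using assms(4) by (simp add: Lp_norm_2 real_sqrt_mult)
qed

text \<open>The clipped representative of a solution with bounded, nonnegative, integrable data.
  \<open>1 \<le> M\<close> makes powers of \<open>M\<close> increase with the exponent.\<close>

locale bounded_flow = levy J for J :: "real^'n \<Rightarrow> real^'n \<Rightarrow> real" +
  fixes w :: "real \<Rightarrow> real^'n \<Rightarrow> real" and M :: real
  assumes flow_w: "flow w" and M: "1 \<le> M"
    and range_w: "\<And>t x. 0 \<le> t \<Longrightarrow> 0 \<le> w t x \<and> w t x \<le> M"
    and integrable_w: "\<And>t. 0 \<le> t \<Longrightarrow> integrable lborel (w t)"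
begin

lemma w_bounded_L2: "0 \<le> t \<Longrightarrow> w t \<in> bounded_L2"
  using range_w flow_L2[OF flow_w] by (auto simp: bounded_L2_def)

lemma w_powr_integrable: "0 \<le> t \<Longrightarrow> 1 \<le> p \<Longrightarrow> integrable lborel (\<lambda>x. w t x powr p)"
  using bounded_powr_integrable[OF integrable_w range_w] by simp

lemma w_powr_L2: "0 \<le> t \<Longrightarrow> 1 \<le> p \<Longrightarrow> (\<lambda>x. w t x powr p) \<in> Lp_space 2"
  by (intro bounded_L2_powr_L2 w_bounded_L2)

lemma w_ln_w_L2: "0 \<le> t \<Longrightarrow> (\<lambda>x. w t x * ln (w t x)) \<in> Lp_space 2"
  by (intro x_ln_x_L2 w_bounded_L2 integrable_w)

lemma w_powr_ln_integrable:
  assumes "0 \<le> t" "2 \<le> p"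
  shows "integrable lborel (\<lambda>x. w t x powr p * ln (w t x))"
proof -
  have eq: "w t x powr p * ln (w t x) = w t x powr (p - 1) * (w t x * ln (w t x))" for x
  proof -
    have "w t x powr p = w t x powr (p - 1) * w t x powr 1" by (simp only: powr_add[symmetric]) simp
    then show ?thesis using range_w[OF assms(1), of x] by simp
  qed
  show ?thesis
    unfolding eq using assms by (intro L2_integrable_mult w_powr_L2 w_ln_w_L2) auto
qed

lemma w_powr_space:
  assumes "0 < t" "1 \<le> p"
  shows "(\<lambda>x. w t x powr p) \<in> levy_space J"
proof (rule levy_space_Lipschitz[OF flow_space[OF flow_w assms(1)], of _ "{0..M}" "p * M powr (p - 1)"])
  show "\<bar>a powr p - b powr p\<bar> \<le> p * M powr (p - 1) * \<bar>a - b\<bar>" if "a \<in> {0..M}" "b \<in> {0..M}" for a b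
    using powr_Lipschitz[OF assms(2)] that by simp
qed (use range_w assms M in auto)

text \<open>Once \<open>e s\<close> is below \<open>a + 1\<close>, the difference is dominated by |e
  s - a| times a fixed multiple of |w ln w|, which lies in \<open>L\<^sup>2\<close>.\<close>

lemma w_powr_exponent_tendsto:
  assumes t: "0 \<le> t" and a: "1 \<le> a" and e: "(e \<longlongrightarrow> a) F" "\<forall>\<^sub>F s in F. 1 \<le> e s"
  shows "L2_tendsto (\<lambda>s x. w t x powr e s) (\<lambda>x. w t x powr a) F"
  unfolding L2_tendsto_def
proof (intro conjI)
  let ?l = "\<lambda>x. w t x * ln (w t x)"
  let ?C = "M powr (a + 1 - 1) * Lp_norm 2 ?l"
  show "\<forall>\<^sub>F s in F. (\<lambda>x. w t x powr e s) \<in> Lp_space 2"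
    using e(2) by eventually_elim (rule w_powr_L2[OF t])
  show "(\<lambda>x. w t x powr a) \<in> Lp_space 2" by (rule w_powr_L2[OF t a])
  have "((\<lambda>s. \<bar>e s - a\<bar> * ?C) \<longlongrightarrow> \<bar>a - a\<bar> * ?C) F"
    by (intro tendsto_intros e)
  then have lim: "((\<lambda>s. \<bar>e s - a\<bar> * ?C) \<longlongrightarrow> 0) F" by simp
  show "((\<lambda>s. Lp_norm 2 (\<lambda>x. w t x powr e s - w t x powr a)) \<longlongrightarrow> 0) F"
  proof (rule Lim_null_comparison[OF _ lim])
    have "\<forall>\<^sub>F s in F. e s < a + 1" by (rule order_tendstoD(2)[OF e(1)]) simp
    with e(2) show "\<forall>\<^sub>F s in F. norm (Lp_norm 2 (\<lambda>x. w t x powr e s - w t x powr a)) \<le> \<bar>e s - a\<bar> * ?C"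
    proof eventually_elim
      case (elim s)
      note [measurable] = flow_borel[OF flow_w t]
      have "Lp_norm 2 (\<lambda>x. w t x powr e s - w t x powr a) \<le> (\<bar>e s - a\<bar> * M powr (a + 1 - 1)) * Lp_norm 2 ?l"
      proof (rule L2_norm_le[OF w_ln_w_L2[OF t]])
        show "\<bar>w t x powr e s - w t x powr a\<bar> \<le> \<bar>e s - a\<bar> * M powr (a + 1 - 1) * \<bar>?l x\<bar>" for x
          using powr_Lipschitz_exponent[of "w t x" M 1 "e s" "a + 1" a] range_w[OF t, of x] M a elim
          by (simp add: abs_mult mult.assoc)
      qed auto
      then show ?case by (simp add: mult.assoc)
    qed
  qed
qed

lemma w_powr_integral_tendsto:
  assumes t: "0 \<le> t" and a: "2 \<le> a" and e: "(e \<longlongrightarrow> a) F" "\<forall>\<^sub>F s in F. 2 \<le> e s"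
  shows "((\<lambda>s. \<integral>x. w t x powr e s \<partial>lborel) \<longlongrightarrow> (\<integral>x. w t x powr a \<partial>lborel)) F"
proof -
  have split: "w t x powr (b - 1) * w t x = w t x powr b" for b x
  proof -
    have "w t x powr (b - 1) * w t x powr 1 = w t x powr b" by (simp only: powr_add[symmetric]) simp
    then show ?thesis using range_w[OF t, of x] by simp
  qed
  have "((\<lambda>s. e s - 1) \<longlongrightarrow> a - 1) F" by (intro tendsto_intros e)
  moreover have "\<forall>\<^sub>F s in F. 1 \<le> e s - 1" using e(2) by eventually_elim simp
  ultimately have "L2_tendsto (\<lambda>s x. w t x powr (e s - 1)) (\<lambda>x. w t x powr (a - 1)) F"
    using a by (intro w_powr_exponent_tendsto t) auto
  from L2_tendsto_inner[OF this L2_tendsto_const[OF flow_L2[OF flow_w t]]]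
  show ?thesis by (simp add: L2_inner_def split)
qed

text \<open>Convexity in the base and in the exponent gives a one-sided estimate whose limit involves
  only the function at the fixed time \<open>s\<close>.\<close>

lemma powr_integral_left_estimate:
  assumes s: "0 < s" and p: "p s = P" "2 \<le> P" "(p has_real_derivative p') (at s)"
    and p_le: "\<And>r. 0 \<le> r \<Longrightarrow> r < s \<Longrightarrow> 2 \<le> p r \<and> p r \<le> P"
    and R: "p' * (\<integral>x. w s x powr P * ln (w s x) \<partial>lborel)
        - P * levy_form J (w s) (\<lambda>x. w s x powr (P - 1)) < R"
  shows "\<forall>\<^sub>F r in at_left s. (\<integral>x. w s x powr P \<partial>lborel) - (\<integral>x. w r x powr p r \<partial>lborel) \<le> R * (s - r)"
proof -
  let ?A = "\<integral>x. w s x powr P * ln (w s x) \<partial>lborel"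
  let ?q = "\<lambda>r x. (w r x - w s x) / (r - s)"
  obtain v where v: "v \<in> Lp_space 2" "L2_tendsto ?q v (at s)"
    "\<And>g. g \<in> levy_space J \<Longrightarrow> L2_inner v g = - levy_form J (w s) g"
    using flow_deriv[OF flow_w s] by blast
  have le: "at_left s \<le> at s" by (rule at_le) simp
  have ev: "\<forall>\<^sub>F r in at_left s. 0 < r \<and> r < s"
    using s by (auto simp: eventually_at_left[OF s])
  have ptend: "(p \<longlongrightarrow> P) (at_left s)"
    using DERIV_isCont[OF p(3)] p(1) by (auto simp: isCont_def intro: tendsto_mono[OF le])
  have pge: "\<forall>\<^sub>F r in at_left s. 2 \<le> p r"
    using ev by eventually_elim (use p_le in auto)
  have pq: "((\<lambda>r. (p r - P) / (r - s)) \<longlongrightarrow> p') (at_left s)"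
    using p(1,3) by (auto simp: has_field_derivative_iff intro: tendsto_mono[OF le])
  have wq: "L2_tendsto ?q v (at_left s)" by (rule L2_tendsto_mono[OF v(2) le])
  have we: "L2_tendsto (\<lambda>r x. w s x powr (p r - 1)) (\<lambda>x. w s x powr (P - 1)) (at_left s)"
  proof (rule w_powr_exponent_tendsto)
    show "((\<lambda>r. p r - 1) \<longlongrightarrow> P - 1) (at_left s)" by (intro tendsto_intros ptend)
    show "\<forall>\<^sub>F r in at_left s. 1 \<le> p r - 1" using pge by eventually_elim simp
  qed (use s p in auto)
  have "((\<lambda>r. (p r - P) / (r - s) * ?A + p r * L2_inner (\<lambda>x. w s x powr (p r - 1)) (?q r))
      \<longlongrightarrow> p' * ?A + P * L2_inner (\<lambda>x. w s x powr (P - 1)) v) (at_left s)"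
    by (intro tendsto_intros pq ptend L2_tendsto_inner we wq)
  moreover have "p' * ?A + P * L2_inner (\<lambda>x. w s x powr (P - 1)) v < R"
    using R v(3)[OF w_powr_space[OF s, of "P - 1"]] p(2) L2_inner_commute[of v] by simp
  ultimately have "\<forall>\<^sub>F r in at_left s.
      (p r - P) / (r - s) * ?A + p r * L2_inner (\<lambda>x. w s x powr (p r - 1)) (?q r) < R"
    by (rule order_tendstoD(2))
  with ev show ?thesis
  proof eventually_elim
    case (elim r)
    then have r: "0 \<le> r" "r < s" by auto
    have pr: "2 \<le> p r" "p r \<le> P" using p_le[OF r] by auto
    \<comment> \<open>First the exponent moves from \<open>P\<close> to \<open>p r\<close> with base
      \<open>w s x\<close>, then the base moves to \<open>w r x\<close> with exponent
      \<open>p r\<close>. Both tangents are taken at \<open>w s x\<close>.\<close>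
    have pt: "w s x powr P - w r x powr p r
        \<le> (P - p r) * (w s x powr P * ln (w s x)) + p r * (w s x powr (p r - 1) * (w s x - w r x))" for x
      using powr_diff_le[of "w s x" P "p r"] powr_tangent[of "p r" "w s x" "w r x"]
        range_w[of s x] range_w[of r x] s r pr by (simp add: algebra_simps)
    have d: "(\<lambda>x. w s x - w r x) \<in> Lp_space 2"
      using s r by (intro L2_diff flow_L2[OF flow_w]) auto
    have i1: "integrable lborel (\<lambda>x. w s x powr P * ln (w s x))"
      using s p(2) by (intro w_powr_ln_integrable) auto
    have i2: "integrable lborel (\<lambda>x. w s x powr (p r - 1) * (w s x - w r x))"
      using s pr by (intro L2_integrable_mult d w_powr_L2) auto
    have i3: "integrable lborel (\<lambda>x. w s x powr P)" "integrable lborel (\<lambda>x. w r x powr p r)"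
      using s r p pr by (auto intro!: w_powr_integrable)
    have "(\<integral>x. w s x powr P \<partial>lborel) - (\<integral>x. w r x powr p r \<partial>lborel)
        = (\<integral>x. w s x powr P - w r x powr p r \<partial>lborel)"
      using i3 by simp
    also have "\<dots> \<le> (\<integral>x. (P - p r) * (w s x powr P * ln (w s x))
        + p r * (w s x powr (p r - 1) * (w s x - w r x)) \<partial>lborel)"
      using i1 i2 i3 pt by (intro integral_mono) auto
    also have "\<dots> = (P - p r) * ?A + p r * L2_inner (\<lambda>x. w s x powr (p r - 1)) (\<lambda>x. w s x - w r x)"
      using i1 i2 by (simp add: L2_inner_def)
    also have "\<dots> = ((p r - P) / (r - s) * ?A
        + p r * L2_inner (\<lambda>x. w s x powr (p r - 1)) (?q r)) * (s - r)"
    proof -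
      have eq: "L2_inner (\<lambda>x. w s x powr (p r - 1)) (\<lambda>x. w s x - w r x)
          = L2_inner (\<lambda>x. w s x powr (p r - 1)) (\<lambda>x. (s - r) * ?q r x)"
      proof -
        have "w s x - w r x = (s - r) * ?q r x" for x using r by (simp add: field_simps)
        then show ?thesis by simp
      qed
      have "(p r - P) / (r - s) * (s - r) = P - p r" using r by (simp add: field_simps)
      then have "((p r - P) / (r - s) * a + b) * (s - r) = (P - p r) * a + (s - r) * b" for a b
        by (metis distrib_right mult.assoc mult.commute)
      then show ?thesis unfolding eq L2_inner_scale_right by simp
    qed
    also have "\<dots> \<le> R * (s - r)" using elim(2) r by (intro mult_right_mono) auto
    finally show ?case .
  qed
qed

text \<open>The logarithmic Sobolev inequality for w^(P/2), whose square is w^P. The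
  Stroock-Varopoulos inequality replaces its energy by the form E(w, w^(P-1)) that occurs in the
  time derivative.\<close>

lemma powr_entropy_estimate:
  assumes s: "0 < s" and P: "2 \<le> P" and ls: "log_sobolev J b \<epsilon>" and \<epsilon>: "0 \<le> \<epsilon>"
  defines "Y \<equiv> \<integral>x. w s x powr P \<partial>lborel"
  shows "P * (\<integral>x. w s x powr P * ln (w s x) \<partial>lborel)
      \<le> Phi Y + 2 * b * Y + \<epsilon> * P * levy_form J (w s) (\<lambda>x. w s x powr (P - 1))"
proof -
  let ?f = "\<lambda>x. w s x powr (P / 2)"
  have s0: "0 \<le> s" using s by simp
  have f0: "0 \<le> w s x" for x using range_w[OF s0] by simp
  have sq: "(?f x)\<^sup>2 = w s x powr P" for x
    unfolding power2_eq_square powr_add[symmetric] by simp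
  have bd: "?f \<in> bounded_L2"
  proof -
    have "?f x \<le> M powr (P / 2)" for x using range_w[OF s0, of x] P by (intro powr_mono2) auto
    then show ?thesis using w_powr_L2[OF s0, of "P / 2"] P by (auto simp: bounded_L2_def)
  qed
  have fS: "?f \<in> levy_space J" using P by (intro w_powr_space s) auto
  have N: "(Lp_norm 2 ?f)\<^sup>2 = Y" by (simp add: Lp_norm_2 sq Y_def)
  have ln: "?f x * (?f x * ln (?f x)) = P / 2 * (w s x powr P * ln (w s x))" for x
    by (simp add: sq[symmetric] power2_eq_square)
  have "2 * L2_inner ?f (\<lambda>x. ?f x * ln (?f x)) \<le> Phi Y + 2 * b * Y + 2 * \<epsilon> * levy_form J ?f ?f"
    using log_sobolev_bounded[OF ls bd w_powr_integrable[OF s0] fS] P N by simp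
  moreover have "2 * L2_inner ?f (\<lambda>x. ?f x * ln (?f x)) = P * (\<integral>x. w s x powr P * ln (w s x) \<partial>lborel)"
    unfolding L2_inner_def ln by simp
  moreover have "2 * \<epsilon> * levy_form J ?f ?f \<le> \<epsilon> * P * levy_form J (w s) (\<lambda>x. w s x powr (P - 1))"
  proof -
    have "(?f x - ?f y) * (?f x - ?f y) \<le> P / 2 * ((w s x - w s y) * (w s x powr (P - 1) - w s y powr (P - 1)))"
      for x y
      using Stroock_Varopoulos[OF P f0 f0, of x y] P by (simp add: power2_eq_square field_simps)
    then have "levy_form J ?f ?f \<le> P / 2 * levy_form J (w s) (\<lambda>x. w s x powr (P - 1))"
      using P by (intro levy_form_le fS flow_space[OF flow_w s] w_powr_space s) auto
    then have "2 * \<epsilon> * levy_form J ?f ?f \<le> 2 * \<epsilon> * (P / 2 * levy_form J (w s) (\<lambda>x. w s x powr (P - 1)))"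
      using \<epsilon> by (intro mult_left_mono) auto
    then show ?thesis by simp
  qed
  ultimately show ?thesis by linarith
qed

text \<open>The exponent \<open>p r = 2 t / (t - r)\<close> at time \<open>r\<close> satisfies \<open>p r / p' r = t - r\<close>, so that the
  logarithmic Sobolev inequality with \<open>\<epsilon> = t - r\<close> absorbs the energy term and contributes
  \<open>\<beta> (t - r) / t\<close> to the derivative of \<open>ln \<parallel>w r\<parallel>\<^bsub>p r\<^esub>\<close>.\<close>

lemma hypercontractive_estimate:
  assumes ls: "\<And>\<epsilon>. 0 < \<epsilon> \<Longrightarrow> log_sobolev J (\<beta> \<epsilon>) \<epsilon>"
    and F: "\<And>x. 0 < x \<Longrightarrow> (F has_real_derivative \<beta> x) (at x)"
    and t: "0 < t" and q: "2 \<le> q"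
    and pos: "\<And>r. 0 \<le> r \<Longrightarrow> 0 < L2_inner (w r) (w r)"
  shows "Lp_norm q (w t) \<le> exp ((F t - F (2 * t / q)) / t) * Lp_norm 2 (w 0)"
proof -
  define p where "p = (\<lambda>r. 2 * t / (t - r))"
  define Y where "Y = (\<lambda>r. \<integral>x. w r x powr p r \<partial>lborel)"
  \<comment> \<open>Since 1 / p r = (t - r) / (2 t), the first summand is 2 t times the logarithm of
    the norm with exponent \<open>p r\<close>; the second cancels the allowed growth rate.
    Monotonicity of \<open>D\<close> is thus the estimate in integrated form.\<close>
  define D where "D = (\<lambda>r. (t - r) * ln (Y r) + 2 * F (t - r))"
  \<comment> \<open>The time at which the moving exponent reaches \<open>q\<close>. From
    \<open>\<sigma>\<close> to \<open>t\<close> the exponent stays fixed and plain decay is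
    used.\<close>
  define \<sigma> where "\<sigma> = t - 2 * t / q"
  have \<sigma>: "0 \<le> \<sigma>" "\<sigma> < t" using t q by (auto simp: \<sigma>_def field_simps)
  have p2: "2 \<le> p r" if "0 \<le> r" "r < t" for r using that t by (simp add: p_def field_simps)
  have pd: "(p has_real_derivative 2 * t / (t - r)\<^sup>2) (at r)" if "r < t" for r
    unfolding p_def using that
    by (auto intro!: derivative_eq_intros simp: power2_eq_square)
  have Ypos: "0 < Y r" if r: "0 \<le> r" "r < t" for r
  proof (rule ccontr)
    assume "\<not> 0 < Y r"
    moreover have i: "integrable lborel (\<lambda>x. w r x powr p r)"
      using r p2[OF r] by (intro w_powr_integrable) auto
    ultimately have "Y r = 0" unfolding Y_def
      by (metis antisym_conv2 integral_nonneg_AE AE_I2 powr_ge_zero)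
    then have "AE x in lborel. w r x powr p r = 0"
      using i unfolding Y_def by (subst (asm) integral_nonneg_eq_0_iff_AE) auto
    then have "AE x in lborel. w r x * w r x = 0" by eventually_elim simp
    then have "L2_inner (w r) (w r) = 0" unfolding L2_inner_def by (rule integral_eq_zero_AE)
    then show False using pos[OF r(1)] by simp
  qed
  have "D \<sigma> \<le> D 0"
  proof (rule left_Dini_nonpos_imp_le[OF \<sigma>(1)])
    fix s \<eta> :: real assume s: "0 < s" "s \<le> \<sigma>" and \<eta>: "0 < \<eta>"
    have st: "s < t" using s \<sigma> by simp
    let ?P = "p s" and ?b = "\<beta> (t - s)" and ?Y = "Y s"
    let ?A = "\<integral>x. w s x powr p s * ln (w s x) \<partial>lborel"
    let ?E = "levy_form J (w s) (\<lambda>x. w s x powr (p s - 1))"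
    have P2: "2 \<le> ?P" using p2 s st by simp
    have Y0: "0 < ?Y" using Ypos s st by simp
    \<comment> \<open>Slack making the inequality for \<open>R\<close> strict, scaled so as to
      contribute exactly \<open>\<eta> / 2\<close> to the derivative of \<open>g\<close>
      below.\<close>
    define \<eta>' where "\<eta>' = \<eta> / 2 * ?Y / (t - s)"
    define L where "L = (Phi ?Y + 2 * ?b * ?Y) / (t - s)"
    define R where "R = L + \<eta>'"
    have \<eta>': "0 < \<eta>'" using \<eta> Y0 st by (simp add: \<eta>'_def)
    have "2 * t / (t - s)\<^sup>2 * ?A - ?P * ?E \<le> L"
    proof -
      have ent: "?P * ?A \<le> Phi ?Y + 2 * ?b * ?Y + (t - s) * ?P * ?E"
        using powr_entropy_estimate[OF s(1) P2 ls[of "t - s"]] st by (simp add: Y_def)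
      have "2 * t / (t - s)\<^sup>2 * ?A = (?P * ?A) / (t - s)" by (simp add: p_def power2_eq_square)
      also have "\<dots> \<le> (Phi ?Y + 2 * ?b * ?Y + (t - s) * ?P * ?E) / (t - s)"
        using ent st by (intro divide_right_mono) auto
      also have "\<dots> = L + ?P * ?E" using st by (simp add: L_def add_divide_distrib)
      finally show ?thesis by simp
    qed
    then have R: "2 * t / (t - s)\<^sup>2 * ?A - ?P * ?E < R" using \<eta>' by (simp add: R_def)
    have est: "\<forall>\<^sub>F r in at_left s. Y s - Y r \<le> R * (s - r)"
      unfolding Y_def
    proof (rule powr_integral_left_estimate[OF s(1) refl P2 pd[OF st] _ R])
      show "2 \<le> p r \<and> p r \<le> p s" if "0 \<le> r" "r < s" for r
        using that st t p2[of r] by (auto simp: p_def intro!: divide_left_mono)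
    qed
    \<comment> \<open>A function differentiable at \<open>s\<close> that lies below \<open>D\<close>
      just to the left of \<open>s\<close> and agrees with it at \<open>s\<close>. Its slope there
      is \<open>\<eta> / 2\<close>, which controls the left increments of \<open>D\<close>.\<close>
    define g where "g = (\<lambda>r. (t - r) * ln (?Y - R * (s - r)) + 2 * F (t - r))"
    have "(g has_real_derivative ((t - s) * R / ?Y - ln ?Y - 2 * ?b)) (at s)"
    proof -
      have "((\<lambda>r. t - r) has_real_derivative -1) (at s)" by (auto intro!: derivative_eq_intros)
      from DERIV_chain2[OF F this] st
      have dF: "((\<lambda>r. F (t - r)) has_real_derivative ?b * -1) (at s)" by simp
      show ?thesis
        unfolding g_def using Y0 by (auto intro!: derivative_eq_intros dF simp: field_simps)
    qed
    moreover have "(t - s) * R / ?Y - ln ?Y - 2 * ?b = \<eta> / 2"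
    proof -
      have "(t - s) * L = Phi ?Y + 2 * ?b * ?Y" "(t - s) * \<eta>' = \<eta> / 2 * ?Y"
        unfolding L_def \<eta>'_def times_divide_eq_right[of "t - s"]
        by (rule nonzero_mult_div_cancel_left, use st in simp)+
      then have "(t - s) * R = (ln ?Y + 2 * ?b + \<eta> / 2) * ?Y"
        by (simp add: R_def Phi_def algebra_simps)
      then show ?thesis using Y0 by simp
    qed
    ultimately have gd: "((\<lambda>r. (g r - g s) / (r - s)) \<longlongrightarrow> \<eta> / 2) (at_left s)"
      by (auto simp: has_field_derivative_iff intro: tendsto_mono[OF at_le])
    have gev: "\<forall>\<^sub>F r in at_left s. (g r - g s) / (r - s) < \<eta>"
      by (rule order_tendstoD(2)[OF gd]) (use \<eta> in simp)
    have "((\<lambda>r. ?Y - R * (s - r)) \<longlongrightarrow> ?Y - R * (s - s)) (at_left s)"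
      by (intro tendsto_intros)
    then have pev: "\<forall>\<^sub>F r in at_left s. 0 < ?Y - R * (s - r)"
      by (rule order_tendstoD(1)) (use Y0 in simp)
    have ev: "\<forall>\<^sub>F r in at_left s. r < s" by (auto simp: eventually_at_filter)
    from est gev pev ev show "\<forall>\<^sub>F r in at_left s. D s - D r \<le> \<eta> * (s - r)"
    proof eventually_elim
      case (elim r)
      have "ln (?Y - R * (s - r)) \<le> ln (Y r)" using elim by (intro ln_mono) auto
      then have "(t - r) * ln (?Y - R * (s - r)) \<le> (t - r) * ln (Y r)"
        using elim st by (intro mult_left_mono) auto
      then have "g r \<le> D r" by (simp add: g_def D_def)
      moreover have "g s = D s" by (simp add: g_def D_def)
      moreover have "g s - g r \<le> \<eta> * (s - r)"
      proof -
        have "(g s - g r) / (s - r) < \<eta>"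
          using elim(2) minus_divide_divide[of "g r - g s" "r - s"] by simp
        then show ?thesis using elim(4) by (simp add: field_simps)
      qed
      ultimately show ?case by simp
    qed
  next
    fix s \<eta> :: real assume s: "0 \<le> s" "s < \<sigma>" and \<eta>: "0 < \<eta>"
    have st: "s < t" using s \<sigma> by simp
    have Y0: "0 < Y s" using Ypos s st by simp
    \<comment> \<open>Freezing the solution at time \<open>s\<close> gives a majorant of
      \<open>D\<close> on the right, by decay at the exponent \<open>p r\<close>. It is continuous
      because only the exponent varies.\<close>
    let ?h = "\<lambda>r. (t - r) * ln (\<integral>x. w s x powr p r \<partial>lborel) + 2 * F (t - r)"
    have ev: "\<forall>\<^sub>F r in at_right s. s < r \<and> r < t"
      using st by (auto simp: eventually_at_right[OF st])
    have "(p \<longlongrightarrow> p s) (at s)" using DERIV_isCont[OF pd[OF st]] by (simp add: isCont_def)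
    then have pl: "(p \<longlongrightarrow> p s) (at_right s)" by (rule tendsto_mono[OF at_le, rotated]) simp
    have "((\<lambda>r. \<integral>x. w s x powr p r \<partial>lborel) \<longlongrightarrow> (\<integral>x. w s x powr p s \<partial>lborel)) (at_right s)"
    proof (rule w_powr_integral_tendsto[OF s(1) p2 pl])
      show "\<forall>\<^sub>F r in at_right s. 2 \<le> p r" using ev by eventually_elim (use p2 s in auto)
    qed (use s st in auto)
    then have Yl: "((\<lambda>r. \<integral>x. w s x powr p r \<partial>lborel) \<longlongrightarrow> Y s) (at_right s)" by (simp add: Y_def)
    have "isCont F (t - s)" using F[of "t - s"] st by (intro DERIV_isCont) auto
    then have Fl: "((\<lambda>r. F (t - r)) \<longlongrightarrow> F (t - s)) (at_right s)"
      by (rule isCont_tendsto_compose) (intro tendsto_intros)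
    have "(?h \<longlongrightarrow> (t - s) * ln (Y s) + 2 * F (t - s)) (at_right s)"
      using Y0 by (intro tendsto_intros Fl Yl) auto
    then have "(?h \<longlongrightarrow> D s) (at_right s)" by (simp add: D_def)
    then have "\<forall>\<^sub>F r in at_right s. ?h r < D s + \<eta>"
      by (rule order_tendstoD(2)) (use \<eta> in simp)
    with ev show "\<forall>\<^sub>F r in at_right s. D r \<le> D s + \<eta>"
    proof eventually_elim
      case (elim r)
      have "Y r \<le> (\<integral>x. w s x powr p r \<partial>lborel)"
        unfolding Y_def using elim s p2[of r] by (intro flow_powr_decay[OF flow_w range_w]) auto
      then have "ln (Y r) \<le> ln (\<integral>x. w s x powr p r \<partial>lborel)"
        using Ypos[of r] elim s by (intro ln_mono) auto
      then have "D r \<le> ?h r" unfolding D_def using elim by (intro add_right_mono mult_left_mono) auto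
      then show ?case using elim by simp
    qed
  qed
  then have "2 * t / q * ln (Y \<sigma>) + 2 * F (2 * t / q) \<le> t * ln (Y 0) + 2 * F t"
    by (simp add: D_def \<sigma>_def)
  then have lnle: "1 / q * ln (Y \<sigma>) \<le> 1 / 2 * ln (Y 0) + (F t - F (2 * t / q)) / t"
    using t q by (simp add: field_simps)
  have p\<sigma>: "p \<sigma> = q" and p0: "p 0 = 2" using t q by (auto simp: p_def \<sigma>_def)
  have "Lp_norm q (w t) \<le> Y \<sigma> powr (1 / q)"
  proof -
    have "(\<integral>x. w t x powr q \<partial>lborel) \<le> (\<integral>x. w \<sigma> x powr q \<partial>lborel)"
      using \<sigma> by (intro flow_powr_decay[OF flow_w range_w q]) auto
    moreover have "\<bar>w t x\<bar> = w t x" for x using range_w[of t x] t by simp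
    ultimately show ?thesis
      unfolding Lp_norm_def Y_def p\<sigma> using q by (auto intro!: powr_mono2)
  qed
  also have "\<dots> = exp (1 / q * ln (Y \<sigma>))" using Ypos[OF \<sigma>] by (simp add: powr_def)
  also have "\<dots> \<le> exp (1 / 2 * ln (Y 0) + (F t - F (2 * t / q)) / t)" using lnle by simp
  also have "\<dots> = exp ((F t - F (2 * t / q)) / t) * Y 0 powr (1 / 2)"
    using Ypos[of 0] t by (simp add: exp_add powr_def)
  also have "Y 0 powr (1 / 2) = Lp_norm 2 (w 0)"
    using range_w[of 0] by (simp add: Lp_norm_def Y_def p0)
  finally show ?thesis .
qed

end

text \<open>\<open>\<beta>\<close> may fail to be integrable at 0, so no base point there is
  available; only increments of \<open>F\<close> between positive points will matter.\<close>

lemma antiderivative_on_positive: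
  fixes \<beta> :: "real \<Rightarrow> real"
  assumes "continuous_on {0<..} \<beta>"
  obtains F where "\<And>x. 0 < x \<Longrightarrow> (F has_real_derivative \<beta> x) (at x)"
proof -
  have "isCont \<beta> x" if "0 < x" for x
    using assms that by (simp add: continuous_on_eq_continuous_at)
  then have "\<exists>F. \<forall>x::real. 0 < ereal x \<longrightarrow> ereal x < \<infinity> \<longrightarrow> (F has_vector_derivative \<beta> x) (at x)"
    by (intro einterval_antiderivative) auto
  then show ?thesis using that by (auto simp: has_real_derivative_iff_has_vector_derivative)
qed

text \<open>In \<open>ereal\<close>, infinity minus anything is infinity, so a mean below infinity
  means that the positive part of \<open>\<beta>\<close> is integrable on (0, t). Its integral
  bounds every increment, even if the negative part diverges.\<close>

lemma antiderivative_increment_le: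
  fixes \<beta> :: "real \<Rightarrow> real"
  assumes cont: "continuous_on {0<..} \<beta>"
    and F: "\<And>x. 0 < x \<Longrightarrow> (F has_real_derivative \<beta> x) (at x)"
    and mean: "beta_mean \<beta> t < \<infinity>" and t: "0 < t"
  obtains C where "\<And>a. 0 < a \<Longrightarrow> a \<le> t \<Longrightarrow> F t - F a \<le> C"
proof -
  let ?P = "\<integral>\<^sup>+ s. ennreal (max 0 (indicator {0<..<t} s * \<beta> s)) \<partial>lborel"
  have "?P \<noteq> \<infinity>"
  proof
    assume "?P = \<infinity>"
    then have "beta_mean \<beta> t = \<infinity>"
      using t by (simp add: beta_mean_def ext_integral_def)
    then show False using mean by simp
  qed
  then obtain C where C: "?P = ennreal C" "0 \<le> C" by (cases ?P) auto
  have "F t - F a \<le> C" if a: "0 < a" "a \<le> t" for a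
  proof -
    let ?g = "\<lambda>s. \<beta> s * indicator {a..t} s"
    have "has_bochner_integral lborel ?g (F t - F a)"
      using F a cont by (intro has_bochner_integral_FTC_Icc_real)
        (auto simp: continuous_on_eq_continuous_at)
    then have gi: "integrable lborel ?g" and g: "(\<integral>s. ?g s \<partial>lborel) = F t - F a"
      by (auto simp: has_bochner_integral_iff)
    have gm: "integrable lborel (\<lambda>s. max 0 (?g s))" using gi by simp
    have "F t - F a \<le> (\<integral>s. max 0 (?g s) \<partial>lborel)"
      unfolding g[symmetric] using gi gm by (intro integral_mono) auto
    then have "ennreal (F t - F a) \<le> ennreal (\<integral>s. max 0 (?g s) \<partial>lborel)" by (rule ennreal_leI)
    also have "\<dots> = (\<integral>\<^sup>+s. ennreal (max 0 (?g s)) \<partial>lborel)"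
      using gm by (intro nn_integral_eq_integral[symmetric]) auto
    also have "\<dots> \<le> ?P"
      \<comment> \<open>The endpoint \<open>t\<close> lies in {a..t} but not in the open interval;
        it is a null set.\<close>
      using AE_lborel_singleton[of t] a
      by (intro nn_integral_mono_AE) (auto elim!: eventually_mono intro!: ennreal_leI simp: indicator_def)
    finally show ?thesis using C by simp
  qed
  then show ?thesis by (rule that)
qed

section \<open>Extension to arbitrary initial data\<close>

context levy_sg
begin

lemma S_contraction:
  assumes f: "f \<in> Lp_space 2" and t: "0 \<le> t"
  shows "L2_inner (S t f) (S t f) \<le> L2_inner f f"
proof -
  have "L2_inner (S 0 f) (S 0 f) = L2_inner f f"
    using S_0[OF f] S_borel[OF f, of 0] L2_borel[OF f] by (intro L2_inner_cong_AE) auto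
  then show ?thesis using flow_norm_antimono[OF S_flow[OF f] order_refl t] by simp
qed

text \<open>The bound is stated for the nonnegative integral so that Fatou's lemma can be applied to
  it without first proving integrability of the limit.\<close>

lemma S_hypercontractive_bounded:
  assumes ls: "\<And>\<epsilon>. 0 < \<epsilon> \<Longrightarrow> log_sobolev J (\<beta> \<epsilon>) \<epsilon>"
    and F: "\<And>x. 0 < x \<Longrightarrow> (F has_real_derivative \<beta> x) (at x)"
    and t: "0 < t" and q: "2 \<le> q" and f: "f \<in> bounded_L2" "integrable lborel f"
  shows "(\<integral>\<^sup>+x. ennreal (\<bar>S t f x\<bar> powr q) \<partial>lborel)
      \<le> ennreal ((exp ((F t - F (2 * t / q)) / t) * Lp_norm 2 f) powr q)"
proof (cases "Lp_norm 2 f = 0")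
  case True
  have fL: "f \<in> Lp_space 2" using f(1) by (rule bounded_L2_L2)
  have "L2_inner f f = 0" unfolding Lp_norm_2_sq[symmetric] using True by simp
  then have "L2_inner (S t f) (S t f) \<le> 0" using S_contraction[OF fL, of t] t by simp
  then have "AE x in lborel. S t f x = 0" using S_L2[OF fL, of t] t by (intro L2_norm_zero_AE) auto
  then have "(\<integral>\<^sup>+x. ennreal (\<bar>S t f x\<bar> powr q) \<partial>lborel) = (\<integral>\<^sup>+x. 0 \<partial>(lborel :: (real^'n) measure))"
    by (intro nn_integral_cong_AE) (auto elim: eventually_mono)
  then show ?thesis by simp
next
  case False
  have fL: "f \<in> Lp_space 2" using f(1) by (rule bounded_L2_L2)
  have f0: "0 \<le> f x" for x using bounded_L2_nonneg[OF f(1)] .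
  obtain M0 where M0: "\<And>x. f x \<le> M0" using f(1) by (auto simp: bounded_L2_def)
  define M where "M = max 1 M0"
  \<comment> \<open>Positivity and the bound by constants make this clipping invisible almost
    everywhere.\<close>
  define w where "w = (\<lambda>r x. max 0 (min M (S r f x)))"
  have wS: "AE x in lborel. w r x = S r f x" if r: "0 \<le> r" for r
  proof -
    have "AE x in lborel. 0 \<le> S r f x" using f0 by (intro S_nonneg fL r) auto
    moreover have "AE x in lborel. S r f x \<le> M"
      using M0 by (intro S_le_const fL r) (auto simp: M_def intro: le_max_iff_disj[THEN iffD2])
    ultimately show ?thesis by eventually_elim (auto simp: w_def)
  qed
  have wm: "w r \<in> borel_measurable lborel" if "0 \<le> r" for r
    unfolding w_def using S_borel[OF fL that] by measurable
  interpret w: bounded_flow J w M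
  proof unfold_locales
    show "flow w" by (rule flow_cong_AE[OF S_flow[OF fL] wm wS])
    show "1 \<le> M" by (simp add: M_def)
    then show "0 \<le> w r x \<and> w r x \<le> M" for r x by (auto simp: w_def)
    show "integrable lborel (w r)" if "0 \<le> r" for r
    proof -
      have "integrable lborel (S r f)" using f0 by (intro S_integrable fL f(2) that) auto
      moreover have "integrable lborel (w r) \<longleftrightarrow> integrable lborel (S r f)"
        using wm[OF that] S_borel[OF fL that] wS[OF that] by (intro integrable_cong_AE) auto
      ultimately show ?thesis by simp
    qed
  qed
  have w0: "AE x in lborel. w 0 x = f x"
    using wS[of 0] S_0[OF fL] by (auto elim: AE_mp)
  \<comment> \<open>Nonzero data stay nonzero by injectivity of the semigroup.\<close>
  have "0 < L2_inner (w r) (w r)" if r: "0 \<le> r" for r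
  proof (rule ccontr)
    assume "\<not> 0 < L2_inner (w r) (w r)"
    then have "AE x in lborel. w r x = 0"
      using flow_L2[OF w.flow_w r] by (intro L2_norm_zero_AE) auto
    then have "AE x in lborel. S r f x = 0" using wS[OF r] by eventually_elim simp
    then have "AE x in lborel. f x = 0" by (rule S_injective[OF fL r])
    then have "(\<integral>x. (f x)\<^sup>2 \<partial>lborel) = 0" by (intro integral_eq_zero_AE) (auto elim: eventually_mono)
    then show False using False by (simp add: Lp_norm_2)
  qed
  from w.hypercontractive_estimate[OF ls F t q this]
  have bd: "Lp_norm q (w t) \<le> exp ((F t - F (2 * t / q)) / t) * Lp_norm 2 (w 0)" by simp
  have t0: "0 \<le> t" using t by simp
  have "Lp_norm 2 (w 0) = Lp_norm 2 f"
    using w0 wm[of 0] L2_borel[OF fL] by (intro Lp_norm_cong_AE) auto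
  with bd have "Lp_norm q (w t) powr q \<le> (exp ((F t - F (2 * t / q)) / t) * Lp_norm 2 f) powr q"
    using q by (intro powr_mono2) auto
  then have le: "(\<integral>x. \<bar>w t x\<bar> powr q \<partial>lborel) \<le> (exp ((F t - F (2 * t / q)) / t) * Lp_norm 2 f) powr q"
    using q by (simp add: Lp_norm_powr)
  have "\<bar>w t x\<bar> = w t x" for x by (simp add: w_def)
  then have i: "integrable lborel (\<lambda>x. \<bar>w t x\<bar> powr q)"
    using w.w_powr_integrable[OF t0, of q] q by simp
  have "(\<integral>\<^sup>+x. ennreal (\<bar>S t f x\<bar> powr q) \<partial>lborel) = (\<integral>\<^sup>+x. ennreal (\<bar>w t x\<bar> powr q) \<partial>lborel)"
    using wS[OF t0] by (intro nn_integral_cong_AE) (auto elim: eventually_mono)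
  also have "\<dots> = ennreal (\<integral>x. \<bar>w t x\<bar> powr q \<partial>lborel)"
    using i by (intro nn_integral_eq_integral) auto
  also have "\<dots> \<le> ennreal ((exp ((F t - F (2 * t / q)) / t) * Lp_norm 2 f) powr q)"
    by (rule ennreal_leI[OF le])
  finally show ?thesis .
qed

text \<open>Contraction transfers convergence in \<open>L\<^sup>2\<close> to the images; their
  squared differences tend to 0 in \<open>L\<^sup>1\<close>, so a subsequence converges almost
  everywhere.\<close>

lemma S_tendsto_AE_subseq:
  assumes f: "\<And>n. f n \<in> Lp_space 2" and g: "g \<in> Lp_space 2" and t: "0 \<le> t"
    and lim: "(\<lambda>n. L2_inner (\<lambda>x. f n x - g x) (\<lambda>x. f n x - g x)) \<longlonglongrightarrow> 0"
  obtains r :: "nat \<Rightarrow> nat" where "AE x in lborel. (\<lambda>n. S t (f (r n)) x) \<longlonglongrightarrow> S t g x"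
proof -
  let ?u = "\<lambda>n x. (S t (f n) x - S t g x)\<^sup>2"
  have Sd: "(\<lambda>x. S t (f n) x - S t g x) \<in> Lp_space 2" for n by (intro L2_diff S_L2 f g t)
  then have i: "integrable lborel (?u n)" for n by (simp add: Lp_space_2_iff)
  have "(\<integral>x. norm (?u n x) \<partial>lborel) \<le> L2_inner (\<lambda>x. f n x - g x) (\<lambda>x. f n x - g x)" for n
  proof -
    have d: "(\<lambda>x. f n x - g x) \<in> Lp_space 2" by (intro L2_diff f g)
    have AE: "AE x in lborel. S t (f n) x - S t g x = S t (\<lambda>x. f n x - g x) x"
      using S_diff[OF f[of n] g t] by eventually_elim simp
    have "(\<integral>x. norm (?u n x) \<partial>lborel)
        = L2_inner (\<lambda>x. S t (f n) x - S t g x) (\<lambda>x. S t (f n) x - S t g x)"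
      by (simp add: L2_inner_def power2_eq_square)
    also have "\<dots> = L2_inner (S t (\<lambda>x. f n x - g x)) (S t (\<lambda>x. f n x - g x))"
      using L2_borel[OF Sd] S_borel[OF d t] by (intro L2_inner_cong_AE[OF AE AE]) auto
    finally show ?thesis using S_contraction[OF d t] by simp
  qed
  then have "(\<lambda>n. \<integral>x. norm (?u n x) \<partial>lborel) \<longlonglongrightarrow> 0"
    by (intro tendsto_sandwich[OF _ _ tendsto_const lim]) auto
  from tendsto_L1_AE_subseq[OF i this] obtain r :: "nat \<Rightarrow> nat"
    where "AE x in lborel. (\<lambda>n. ?u (r n) x) \<longlonglongrightarrow> 0" by blast
  then have "AE x in lborel. (\<lambda>n. S t (f (r n)) x) \<longlonglongrightarrow> S t g x"
  proof eventually_elim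
    case (elim x)
    then have "(\<lambda>n. sqrt (?u (r n) x)) \<longlonglongrightarrow> sqrt 0" by (rule tendsto_real_sqrt)
    then have "(\<lambda>n. S t (f (r n)) x - S t g x) \<longlonglongrightarrow> 0" by (simp add: tendsto_rabs_zero_iff)
    then show ?case by (simp add: LIM_zero_iff)
  qed
  then show ?thesis by (rule that)
qed

text \<open>Positivity reduces \<open>u\<close> to |u|. Cutting |u| off in height and in space gives
  bounded integrable data with no larger norm, and Fatou's lemma along an almost everywhere
  convergent subsequence passes to the limit.\<close>

lemma S_hypercontractive:
  assumes ls: "\<And>\<epsilon>. 0 < \<epsilon> \<Longrightarrow> log_sobolev J (\<beta> \<epsilon>) \<epsilon>"
    and F: "\<And>x. 0 < x \<Longrightarrow> (F has_real_derivative \<beta> x) (at x)"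
    and t: "0 < t" and q: "2 \<le> q" and u: "u \<in> Lp_space 2"
  shows "S t u \<in> Lp_space q \<and> Lp_norm q (S t u) \<le> exp ((F t - F (2 * t / q)) / t) * Lp_norm 2 u"
proof -
  define K where "K = exp ((F t - F (2 * t / q)) / t)"
  define g where "g = (\<lambda>x. \<bar>u x\<bar>)"
  define f where "f = (\<lambda>n x. min (g x) (real n) * indicator (ball 0 (real n)) x)"
  have t0: "0 \<le> t" using t by simp
  have gL: "g \<in> Lp_space 2" unfolding g_def by (rule L2_abs[OF u])
  note [measurable] = L2_borel[OF gL]
  have [measurable]: "ball (0::real^'n) r \<in> sets borel" for r by simp
  have [measurable]: "f n \<in> borel_measurable lborel" for n unfolding f_def by measurable
  have fg: "0 \<le> f n x" "f n x \<le> g x" "f n x \<le> real n" "f n x \<le> real n * indicator (ball 0 (real n)) x" for n x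
    by (auto simp: f_def g_def indicator_def)
  have fL: "f n \<in> Lp_space 2" for n
    using fg by (intro L2_dominated[OF gL, of _ 1]) (auto simp: g_def)
  have fb: "f n \<in> bounded_L2" for n using fL fg by (auto simp: bounded_L2_def intro!: exI[of _ "real n"])
  have fi: "integrable lborel (f n)" for n
  proof (rule Bochner_Integration.integrable_bound)
    show "integrable lborel (\<lambda>x::real^'n. real n * indicator (ball 0 (real n)) x :: real)"
      by (intro integrable_mult_right integrable_real_indicator emeasure_lborel_ball_finite) auto
    show "AE x in lborel. norm (f n x) \<le> norm (real n * indicator (ball 0 (real n)) x :: real)"
      using fg by (intro AE_I2) (auto intro: order_trans[OF _ abs_ge_self])
  qed measurable
  have "(\<lambda>n. L2_inner (\<lambda>x. f n x - g x) (\<lambda>x. f n x - g x)) \<longlonglongrightarrow> (\<integral>x. 0 \<partial>(lborel :: (real^'n) measure))"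
    unfolding L2_inner_def
  proof (rule integral_dominated_convergence)
    show "integrable lborel (\<lambda>x. g x * g x)" by (intro L2_integrable_mult gL)
    show "AE x in lborel. (\<lambda>n. (f n x - g x) * (f n x - g x)) \<longlonglongrightarrow> 0"
    proof (rule AE_I2, rule tendsto_eventually)
      fix x :: "real^'n"
      obtain m :: nat where "max (g x) (norm x) < real m" using reals_Archimedean2 by blast
      then show "\<forall>\<^sub>F n in sequentially. (f n x - g x) * (f n x - g x) = 0"
        unfolding eventually_sequentially f_def by (intro exI[of _ m]) (auto simp: min_def)
    qed
    show "AE x in lborel. norm ((f n x - g x) * (f n x - g x)) \<le> g x * g x" for n
    proof (rule AE_I2)
      fix x
      have "\<bar>f n x - g x\<bar> \<le> g x" using fg[of n x] by linarith
      then have "\<bar>f n x - g x\<bar> * \<bar>f n x - g x\<bar> \<le> g x * g x" by (intro mult_mono) auto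
      then show "norm ((f n x - g x) * (f n x - g x)) \<le> g x * g x" by (simp add: abs_mult)
    qed
  qed measurable
  then have lim: "(\<lambda>n. L2_inner (\<lambda>x. f n x - g x) (\<lambda>x. f n x - g x)) \<longlonglongrightarrow> 0" by simp
  obtain r :: "nat \<Rightarrow> nat" where r: "AE x in lborel. (\<lambda>n. S t (f (r n)) x) \<longlonglongrightarrow> S t g x"
    using S_tendsto_AE_subseq[OF fL gL t0 lim] by blast
  have "(\<integral>\<^sup>+x. ennreal (\<bar>S t u x\<bar> powr q) \<partial>lborel)
      \<le> (\<integral>\<^sup>+x. liminf (\<lambda>n. ennreal (\<bar>S t (f (r n)) x\<bar> powr q)) \<partial>lborel)"
  proof (rule nn_integral_mono_AE)
    show "AE x in lborel. ennreal (\<bar>S t u x\<bar> powr q) \<le> liminf (\<lambda>n. ennreal (\<bar>S t (f (r n)) x\<bar> powr q))"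
      using r S_abs_le[OF u t0, folded g_def]
    proof eventually_elim
      case (elim x)
      have "(\<lambda>n. ennreal (\<bar>S t (f (r n)) x\<bar> powr q)) \<longlonglongrightarrow> ennreal (\<bar>S t g x\<bar> powr q)"
        using q by (intro tendsto_ennrealI tendsto_powr' tendsto_rabs elim(1) tendsto_const) auto
      then have "liminf (\<lambda>n. ennreal (\<bar>S t (f (r n)) x\<bar> powr q)) = ennreal (\<bar>S t g x\<bar> powr q)"
        by (intro lim_imp_Liminf) auto
      moreover have "\<bar>S t u x\<bar> powr q \<le> \<bar>S t g x\<bar> powr q"
        using elim(2) q by (intro powr_mono2) auto
      ultimately show ?case by (simp add: ennreal_leI)
    qed
  qed
  also have "\<dots> \<le> liminf (\<lambda>n. \<integral>\<^sup>+x. ennreal (\<bar>S t (f (r n)) x\<bar> powr q) \<partial>lborel)"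
  proof (rule nn_integral_liminf)
    note [measurable] = S_borel[OF fL t0]
    show "(\<lambda>x. ennreal (\<bar>S t (f (r n)) x\<bar> powr q)) \<in> borel_measurable lborel" for n by measurable
  qed
  also have "\<dots> \<le> liminf (\<lambda>n::nat. ennreal ((K * Lp_norm 2 u) powr q))"
  proof (intro Liminf_mono always_eventually allI)
    fix n
    have "Lp_norm 2 (f (r n)) \<le> 1 * Lp_norm 2 u"
      using fg by (intro L2_norm_le[OF u]) (auto simp: g_def)
    then have "(K * Lp_norm 2 (f (r n))) powr q \<le> (K * Lp_norm 2 u) powr q"
      using q by (intro powr_mono2 mult_left_mono) (auto simp: K_def)
    then show "(\<integral>\<^sup>+x. ennreal (\<bar>S t (f (r n)) x\<bar> powr q) \<partial>lborel) \<le> ennreal ((K * Lp_norm 2 u) powr q)"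
      using S_hypercontractive_bounded[OF ls F t q fb fi, of "r n"]
      by (auto simp: K_def intro: order_trans ennreal_leI)
  qed
  also have "\<dots> = ennreal ((K * Lp_norm 2 u) powr q)" by (simp add: Liminf_const)
  finally have bd: "(\<integral>\<^sup>+x. ennreal (\<bar>S t u x\<bar> powr q) \<partial>lborel) \<le> ennreal ((K * Lp_norm 2 u) powr q)" .
  note [measurable] = S_borel[OF u t0]
  have i: "integrable lborel (\<lambda>x. \<bar>S t u x\<bar> powr q)"
    using bd by (intro integrableI_nonneg) (auto intro: order_le_less_trans)
  then have "ennreal (\<integral>x. \<bar>S t u x\<bar> powr q \<partial>lborel) \<le> ennreal ((K * Lp_norm 2 u) powr q)"
    using bd by (subst (asm) nn_integral_eq_integral) auto
  then have "(\<integral>x. \<bar>S t u x\<bar> powr q \<partial>lborel) \<le> (K * Lp_norm 2 u) powr q" by simp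
  then have "Lp_norm q (S t u) \<le> ((K * Lp_norm 2 u) powr q) powr (1 / q)"
    unfolding Lp_norm_def using q by (intro powr_mono2) (auto simp: integral_nonneg_AE)
  also have "\<dots> = K * Lp_norm 2 u" using q by (simp add: powr_powr K_def)
  finally show ?thesis using i S_borel[OF u t0] by (simp add: Lp_space_def K_def)
qed

lemma log_sobolev_supercontractive_with:
  assumes "\<And>\<epsilon>. 0 < \<epsilon> \<Longrightarrow> log_sobolev J (\<beta> \<epsilon>) \<epsilon>"
    and "\<And>x. 0 < x \<Longrightarrow> (F has_real_derivative \<beta> x) (at x)"
  shows "supercontractive_with S (\<lambda>t q. exp ((F t - F (2 * t / q)) / t))"
  using S_hypercontractive[OF assms] by (auto simp: supercontractive_with_def)

lemma log_sobolev_supercontractive: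
  assumes "continuous_on {0<..} \<beta>" "\<And>\<epsilon>. 0 < \<epsilon> \<Longrightarrow> log_sobolev J (\<beta> \<epsilon>) \<epsilon>"
  shows "supercontractive S"
proof -
  obtain F where "\<And>x. 0 < x \<Longrightarrow> (F has_real_derivative \<beta> x) (at x)"
    using antiderivative_on_positive[OF assms(1)] by blast
  from log_sobolev_supercontractive_with[OF assms(2) this] show ?thesis
    by (auto simp: supercontractive_def)
qed

lemma log_sobolev_ultracontractive:
  assumes cont: "continuous_on {0<..} \<beta>" and ls: "\<And>\<epsilon>. 0 < \<epsilon> \<Longrightarrow> log_sobolev J (\<beta> \<epsilon>) \<epsilon>"
    and mean: "\<And>t. 0 < t \<Longrightarrow> beta_mean \<beta> t < \<infinity>"
  shows "ultracontractive S"
proof -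
  obtain F where F: "\<And>x. 0 < x \<Longrightarrow> (F has_real_derivative \<beta> x) (at x)"
    using antiderivative_on_positive[OF cont] by blast
  have "bdd_above ((\<lambda>q. exp ((F t - F (2 * t / q)) / t)) ` {2..})" if t: "0 < t" for t
  proof -
    obtain C where C: "\<And>a. 0 < a \<Longrightarrow> a \<le> t \<Longrightarrow> F t - F a \<le> C"
      using antiderivative_increment_le[OF cont F mean[OF t] t] by blast
    \<comment> \<open>The constant \<open>C\<close> bounds the increments from all points of (0, t],
      and 2 t / q never leaves that interval.\<close>
    have "exp ((F t - F (2 * t / q)) / t) \<le> exp (C / t)" if "2 \<le> q" for q
    proof -
      have "0 < 2 * t / q" "2 * t / q \<le> t" using that t by (auto simp: field_simps)
      then have "F t - F (2 * t / q) \<le> C" by (rule C)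
      then show ?thesis using t by (simp add: divide_right_mono)
    qed
    then show ?thesis by (intro bdd_aboveI2[where M = "exp (C / t)"]) auto
  qed
  then show ?thesis
    using log_sobolev_supercontractive_with[OF ls F]
    by (auto simp: ultracontractive_def ultracontractive_with_def)
qed

end

theorem theorem3p18:
  fixes J :: "real^'n \<Rightarrow> real^'n \<Rightarrow> real"
    and S :: "real \<Rightarrow> (real^'n \<Rightarrow> real) \<Rightarrow> (real^'n \<Rightarrow> real)"
  assumes "levy_kernel J"
    and "levy_semigroup J S"
  shows
    "(\<forall>B (q::real). q > 2 \<longrightarrow> supercontractive_with S B \<longrightarrow>
        (\<forall>\<epsilon>>0. log_sobolev J (inverse (1 - 2 / q) * ln (B (\<epsilon> * (1 - 2 / q)) q)) \<epsilon>))
   \<and> (\<forall>B. ultracontractive_with S B \<longrightarrow>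
        (\<forall>t>0. \<forall>u0 \<in> Lp_space 2. AE x in lborel.
            \<bar>S t u0 x\<bar> \<le> (SUP q\<in>{2..}. B t q) * Lp_norm 2 u0) \<and>
        (\<forall>\<epsilon>>0. log_sobolev J (ln (SUP q\<in>{2..}. B \<epsilon> q)) \<epsilon>))
   \<and> (\<forall>\<beta>::real \<Rightarrow> real. continuous_on {0<..} \<beta> \<longrightarrow> (\<forall>\<epsilon>>0. log_sobolev J (\<beta> \<epsilon>) \<epsilon>) \<longrightarrow>
        supercontractive S)
   \<and> (\<forall>\<beta>::real \<Rightarrow> real. continuous_on {0<..} \<beta> \<longrightarrow> (\<forall>\<epsilon>>0. log_sobolev J (\<beta> \<epsilon>) \<epsilon>) \<longrightarrow>
        (\<forall>t>0. beta_mean \<beta> t < \<infinity>) \<longrightarrow>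
        ultracontractive S)"
proof -
  interpret levy_sg J S by unfold_locales fact+
  show ?thesis
  proof (intro conjI allI impI ballI)
    show "log_sobolev J (inverse (1 - 2 / q) * ln (B (\<epsilon> * (1 - 2 / q)) q)) \<epsilon>"
      if "2 < q" "supercontractive_with S B" "0 < \<epsilon>" for B and q \<epsilon> :: real
      using supercontractive_log_sobolev[OF that(2,1,3)] .
    show "AE x in lborel. \<bar>S t u0 x\<bar> \<le> (SUP q\<in>{2..}. B t q) * Lp_norm 2 u0"
      if "ultracontractive_with S B" "0 < t" "u0 \<in> Lp_space 2" for B t u0
      using ultracontractive_bound[OF that] .
    show "log_sobolev J (ln (SUP q\<in>{2..}. B \<epsilon> q)) \<epsilon>" if "ultracontractive_with S B" "0 < \<epsilon>" for B \<epsilon>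
      using ultracontractive_log_sobolev[OF that] .
    show "supercontractive S"
      if "continuous_on {0<..} \<beta>" "\<forall>\<epsilon>>0. log_sobolev J (\<beta> \<epsilon>) \<epsilon>" for \<beta> :: "real \<Rightarrow> real"
      using log_sobolev_supercontractive[OF that(1)] that(2) by blast
    show "ultracontractive S"
      if "continuous_on {0<..} \<beta>" "\<forall>\<epsilon>>0. log_sobolev J (\<beta> \<epsilon>) \<epsilon>" "\<forall>t>0. beta_mean \<beta> t < \<infinity>"
      for \<beta> :: "real \<Rightarrow> real"
      using log_sobolev_ultracontractive[OF that(1)] that(2,3) by blast
  qed
qed

end
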